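(* Let $\Sigma$ be an oriented surface and $\nabla$ a timelike/spacelike minimal Lagrangian connection on $T\Sigma$. Then we obtain a triple $(g,\beta,C)$ on $\Sigma$ consisting of a Riemannian metric $g=\pm\mathrm{Ric}(\nabla)$, a $1$-form $\beta=\frac38\mathrm{tr}_g\,\mathrm{Sym}\nabla g$ and a cubic differential $C$ with $\mathrm{Re}(C)=\mp\frac12\mathrm{Sym}_0\nabla g$. Furthermore, the triple $(g,\beta,C)$ satisfies $$K_g=\pm1+2|C|_g^2+\delta_g\beta,\qquad \overline\partial C=(\beta-\mathrm{i}\star_g\beta)\otimes C,\qquad d\beta=0.$$ Here upper signs refer to the timelike case and lower signs to the spacelike case.
   Context: All manifolds and maps are smooth; surfaces have no boundary. For a torsion-free connection $\nabla$ on $T\Sigma$ the Ricci tensor is $\mathrm{Ric}(\nabla)(X,Y)=\mathrm{tr}\,(Z\mapsto \nabla_Z\nabla_XY-\nabla_X\nabla_ZY-\nabla_{[Z,X]}Y)$, with symmetric part $\mathrm{Ric}^+(\nabla)$ and anti-symmetric part $\mathrm{Ric}^-(\nabla)$; put $\mathrm{Schout}(\nabla)=\mathrm{Ric}^+(\nabla)-\frac13\mathrm{Ric}^-(\nabla)$. Define a split-signature metric $h_\nabla$ on the total space of $T^*\Sigma$ as follows: in local coordinates $x^i$ on $\Sigma$ with fibre coordinates $\xi_i$ (covector $\xi_i dx^i$), with $\nabla_{\partial_i}\partial_j=\Gamma^k_{ij}\partial_k$ and $\mathrm{Schout}(\nabla)=S_{ij}dx^i\otimes dx^j$, let $\psi_i=d\xi_i-\xi_k\Gamma^k_{ij}dx^j-\xi_i\xi_jdx^j-S_{ji}dx^j$;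 then $h_\nabla$ is the symmetric part of $\psi_i\otimes dx^i$ (coordinate independent). With $o:\Sigma\to T^*\Sigma$ the zero section, $o^*h_\nabla=-\mathrm{Ric}^+(\nabla)$. The connection $\nabla$ is called Lagrangian if $\mathrm{Ric}^-(\nabla)=0$, timelike (spacelike) if $\mathrm{Ric}^+(\nabla)$ is positive (negative) definite, and minimal if the trace, with respect to the induced metric, of the second fundamental form of $o:\Sigma\to(T^*\Sigma,h_\nabla)$ vanishes identically. A timelike/spacelike minimal Lagrangian connection is a torsion-free connection on $T\Sigma$ that is timelike/spacelike, Lagrangian and minimal. $\mathrm{Sym}$ is total symmetrisation (projection $T^*\Sigma\otimes S^2(T^*\Sigma)\to S^3(T^*\Sigma)$), $\mathrm{Sym}_0$ its $g$-trace-free part. A cubic differential is a smooth section of $K_\Sigma^3$, where $K_\Sigma$ is the canonical bundle of the complex structure determined by $[g]$ and the orientation; every trace-free symmetric covariant $3$-tensor is the real part of a unique cubic differential. $\overline\partial$ is the associated del-bar operator; $\star_g$, $\delta_g$, $K_g$ are the Hodge star, co-differential (formal adjoint of $d$) and Gauss curvature of $g$. The norm $|C|_g$ is normalised so that if $(\omega_1,\omega_2)$ is an oriented $g$-orthonormal coframe and $C=c\,(\omega_1+\mathrm{i}\omega_2)^3$, then $|C|_g^2=|c|^2$. *)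

theory Defs
  imports "HOL-Analysis.Analysis"
begin

section \<open>Calculus on open subsets of Euclidean space\<close>

definition pd :: "'n::finite \<Rightarrow> (real^'n \<Rightarrow> 'b::real_normed_vector) \<Rightarrow> real^'n \<Rightarrow> 'b" where
  "pd i f x = frechet_derivative f (at x) (axis i 1)"

text \<open>Only used on open sets \<open>S\<close>.\<close>

primrec Ck_on ::
  "nat \<Rightarrow> ('a::real_normed_vector \<Rightarrow> 'b::real_normed_vector) \<Rightarrow> 'a set \<Rightarrow> bool" where
  "Ck_on 0 f S \<longleftrightarrow> continuous_on S f"
| "Ck_on (Suc k) f S \<longleftrightarrow>
     f differentiable_on S \<and> (\<forall>v. Ck_on k (\<lambda>x. frechet_derivative f (at x) v) S)"

definition smooth_on :: "('a::real_normed_vector \<Rightarrow> 'b::real_normed_vector) \<Rightarrow> 'a set \<Rightarrow> bool" where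
  "smooth_on f S \<longleftrightarrow> (\<forall>k. Ck_on k f S)"


section \<open>Oriented surfaces\<close>

type_synonym 'a chart = "'a set \<times> ('a \<Rightarrow> real^2)"

abbreviation cdom :: "'a chart \<Rightarrow> 'a set" where "cdom \<equiv> fst"
abbreviation crd :: "'a chart \<Rightarrow> 'a \<Rightarrow> real^2" where "crd \<equiv> snd"

definition cimg :: "'a chart \<Rightarrow> (real^2) set" where
  "cimg c = crd c ` cdom c"

definition overlap :: "'a chart \<Rightarrow> 'a chart \<Rightarrow> (real^2) set" where
  "overlap c c' = crd c ` (cdom c \<inter> cdom c')"

definition transition :: "'a chart \<Rightarrow> 'a chart \<Rightarrow> real^2 \<Rightarrow> real^2" where
  "transition c c' = crd c' \<circ> inv_into (cdom c) (crd c)"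

text \<open>\<open>A\<close> is an atlas (not necessarily maximal) representing the smooth structure and the
  orientation of the surface with underlying space \<open>X\<close>.\<close>

definition oriented_surface :: "'a topology \<Rightarrow> 'a chart set \<Rightarrow> bool" where
  "oriented_surface X A \<longleftrightarrow>
     Hausdorff_space X \<and> second_countable X \<and>
     (\<Union>c\<in>A. cdom c) = topspace X \<and>
     (\<forall>c\<in>A. openin X (cdom c) \<and> open (cimg c) \<and>
        homeomorphic_map (subtopology X (cdom c)) (top_of_set (cimg c)) (crd c)) \<and>
     (\<forall>c\<in>A. \<forall>c'\<in>A. smooth_on (transition c c') (overlap c c') \<and>
        (\<forall>x\<in>overlap c c'. det (jacobian (transition c c') (at x)) > 0))"


section \<open>Tensor fields and connections on a surface\<close>

text \<open>A field on the surface assigns to every chart \<open>c\<close> the component functions on \<open>cimg c\<close>;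
  on overlaps the components are related by the classical transformation rules.  Values
  outside \<open>cimg c\<close> are irrelevant.\<close>

type_synonym ('a, 'b) field = "'a chart \<Rightarrow> real^2 \<Rightarrow> 'b"

definition one_form :: "'a chart set \<Rightarrow> ('a, real^2) field \<Rightarrow> bool" where
  "one_form A \<alpha> \<longleftrightarrow>
     (\<forall>c\<in>A. smooth_on (\<alpha> c) (cimg c)) \<and>
     (\<forall>c\<in>A. \<forall>c'\<in>A. \<forall>x\<in>overlap c c'.
        let J = jacobian (transition c c') (at x); y = transition c c' x
        in \<forall>i. \<alpha> c x $ i = (\<Sum>a\<in>UNIV. J$a$i * \<alpha> c' y $ a))"

definition tensor2_field :: "'a chart set \<Rightarrow> ('a, real^2^2) field \<Rightarrow> bool" where
  "tensor2_field A T \<longleftrightarrow>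
     (\<forall>c\<in>A. smooth_on (T c) (cimg c)) \<and>
     (\<forall>c\<in>A. \<forall>c'\<in>A. \<forall>x\<in>overlap c c'.
        let J = jacobian (transition c c') (at x); y = transition c c' x
        in \<forall>i j. T c x $ i $ j = (\<Sum>a\<in>UNIV. \<Sum>b\<in>UNIV. J$a$i * J$b$j * T c' y $ a $ b))"

definition complex_tensor3_field :: "'a chart set \<Rightarrow> ('a, complex^2^2^2) field \<Rightarrow> bool" where
  "complex_tensor3_field A T \<longleftrightarrow>
     (\<forall>c\<in>A. smooth_on (T c) (cimg c)) \<and>
     (\<forall>c\<in>A. \<forall>c'\<in>A. \<forall>x\<in>overlap c c'.
        let J = jacobian (transition c c') (at x); y = transition c c' x
        in \<forall>i j k. T c x $ i $ j $ k =
             (\<Sum>a\<in>UNIV. \<Sum>b\<in>UNIV. \<Sum>d\<in>UNIV. complex_of_real (J$a$i * J$b$j * J$d$k) * T c' y $ a $ b $ d))"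

definition riemannian_metric :: "'a chart set \<Rightarrow> ('a, real^2^2) field \<Rightarrow> bool" where
  "riemannian_metric A g \<longleftrightarrow>
     tensor2_field A g \<and>
     (\<forall>c\<in>A. \<forall>x\<in>cimg c. transpose (g c x) = g c x \<and> (\<forall>v. v \<noteq> 0 \<longrightarrow> v \<bullet> (g c x *v v) > 0))"

text \<open>Throughout, \<open>\<Gamma> $ k $ i $ j\<close> is the \<open>k\<close>-th component of the covariant derivative of
  \<open>\<partial>\<^sub>j\<close> in direction \<open>\<partial>\<^sub>i\<close>.\<close>

definition connection :: "'a chart set \<Rightarrow> ('a, real^2^2^2) field \<Rightarrow> bool" where
  "connection A \<Gamma> \<longleftrightarrow>
     (\<forall>c\<in>A. smooth_on (\<Gamma> c) (cimg c)) \<and>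
     (\<forall>c\<in>A. \<forall>c'\<in>A. \<forall>x\<in>overlap c c'.
        let \<tau> = transition c c'; J = jacobian \<tau> (at x)
        in \<forall>m i j. (\<Sum>k\<in>UNIV. J$m$k * \<Gamma> c x $ k $ i $ j) =
             pd i (pd j \<tau>) x $ m + (\<Sum>a\<in>UNIV. \<Sum>b\<in>UNIV. J$a$i * J$b$j * \<Gamma> c' (\<tau> x) $ m $ a $ b))"

definition torsion_free :: "'a chart set \<Rightarrow> ('a, real^2^2^2) field \<Rightarrow> bool" where
  "torsion_free A \<Gamma> \<longleftrightarrow> (\<forall>c\<in>A. \<forall>x\<in>cimg c. \<forall>k i j. \<Gamma> c x $ k $ i $ j = \<Gamma> c x $ k $ j $ i)"


section \<open>Curvature\<close>

text \<open>\<open>riem \<Gamma> x k i j l\<close> is the \<open>l\<close>-th component of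
  \<open>R(\<partial>\<^sub>k,\<partial>\<^sub>i)\<partial>\<^sub>j\<close>, where \<open>R(X,Y)Z = \<nabla>\<^sub>X\<nabla>\<^sub>YZ - \<nabla>\<^sub>Y\<nabla>\<^sub>XZ - \<nabla>\<^sub>[\<^sub>X\<^sub>,\<^sub>Y\<^sub>]Z\<close>.\<close>

definition riem :: "(real^'n \<Rightarrow> real^'n^'n^'n) \<Rightarrow> real^'n \<Rightarrow> 'n::finite \<Rightarrow> 'n \<Rightarrow> 'n \<Rightarrow> 'n \<Rightarrow> real" where
  "riem \<Gamma> x k i j l =
     pd k \<Gamma> x $ l $ i $ j - pd i \<Gamma> x $ l $ k $ j
     + (\<Sum>m\<in>UNIV. \<Gamma> x $ l $ k $ m * \<Gamma> x $ m $ i $ j - \<Gamma> x $ l $ i $ m * \<Gamma> x $ m $ k $ j)"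

definition ricci :: "(real^'n \<Rightarrow> real^'n^'n^'n) \<Rightarrow> real^'n \<Rightarrow> real^'n^'n" where
  "ricci \<Gamma> x = (\<chi> i j. \<Sum>k\<in>UNIV. riem \<Gamma> x k i j k)"

definition ricci_sym :: "(real^'n \<Rightarrow> real^'n^'n^'n) \<Rightarrow> real^'n \<Rightarrow> real^'n^'n" where
  "ricci_sym \<Gamma> x = (1/2) *\<^sub>R (ricci \<Gamma> x + transpose (ricci \<Gamma> x))"

definition ricci_skew :: "(real^'n \<Rightarrow> real^'n^'n^'n) \<Rightarrow> real^'n \<Rightarrow> real^'n^'n" where
  "ricci_skew \<Gamma> x = (1/2) *\<^sub>R (ricci \<Gamma> x - transpose (ricci \<Gamma> x))"

definition schout :: "(real^2 \<Rightarrow> real^2^2^2) \<Rightarrow> real^2 \<Rightarrow> real^2^2" where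
  "schout \<Gamma> x = ricci_sym \<Gamma> x - (1/3) *\<^sub>R ricci_skew \<Gamma> x"

text \<open>The Levi-Civita connection of a (pseudo-)Riemannian metric.\<close>

definition christoffel :: "(real^'n \<Rightarrow> real^'n^'n) \<Rightarrow> real^'n \<Rightarrow> real^'n^'n^'n" where
  "christoffel h x = (\<chi> k i j. (1/2) * (\<Sum>l\<in>UNIV. matrix_inv (h x) $ k $ l *
     (pd i h x $ l $ j + pd j h x $ l $ i - pd l h x $ i $ j)))"

definition gauss_curvature :: "(real^2 \<Rightarrow> real^2^2) \<Rightarrow> real^2 \<Rightarrow> real" where
  "gauss_curvature g x =
     (\<Sum>l\<in>UNIV. riem (christoffel g) x 1 2 2 l * g x $ l $ 1) / det (g x)"


section \<open>Second fundamental form of an immersion into a pseudo-Riemannian manifold\<close>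

context
  fixes h :: "real^'n \<Rightarrow> real^'n^'n" and f :: "real^'m \<Rightarrow> real^'n"
begin

definition induced_metric :: "real^'m \<Rightarrow> real^'m^'m" where
  "induced_metric x = (\<chi> i j. pd i f x \<bullet> (h (f x) *v pd j f x))"

text \<open>The derivative of \<open>f\<^sub>*\<partial>\<^sub>j\<close> in direction \<open>\<partial>\<^sub>i\<close> with respect to the
  Levi-Civita connection of \<open>h\<close>.\<close>

definition ambient_derivative :: "real^'m \<Rightarrow> 'm \<Rightarrow> 'm \<Rightarrow> real^'n" where
  "ambient_derivative x i j = pd i (pd j f) x +
     (\<chi> a. \<Sum>b\<in>UNIV. \<Sum>c\<in>UNIV. christoffel h (f x) $ a $ b $ c * pd i f x $ b * pd j f x $ c)"

definition normal_part :: "real^'m \<Rightarrow> real^'n \<Rightarrow> real^'n" where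
  "normal_part x v = v - (\<Sum>k\<in>UNIV. \<Sum>l\<in>UNIV.
     (matrix_inv (induced_metric x) $ k $ l * (v \<bullet> (h (f x) *v pd k f x))) *\<^sub>R pd l f x)"

definition second_fundamental_form :: "real^'m \<Rightarrow> 'm \<Rightarrow> 'm \<Rightarrow> real^'n" where
  "second_fundamental_form x i j = normal_part x (ambient_derivative x i j)"

definition trace_second_fundamental_form :: "real^'m \<Rightarrow> real^'n" where
  "trace_second_fundamental_form x = (\<Sum>i\<in>UNIV. \<Sum>j\<in>UNIV.
     matrix_inv (induced_metric x) $ i $ j *\<^sub>R second_fundamental_form x i j)"

end


section \<open>Minimal Lagrangian connections\<close>

text \<open>A chart with coordinates \<open>x\<^sup>i\<close> induces the coordinates \<open>(x\<^sup>i, \<xi>\<^sub>i)\<close> on the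
  cotangent bundle; \<open>Inl i\<close> indexes \<open>x\<^sup>i\<close> and \<open>Inr i\<close> indexes \<open>\<xi>\<^sub>i\<close>.\<close>

definition base :: "real^(2+2) \<Rightarrow> real^2" where
  "base p = (\<chi> i. p $ Inl i)"

definition fibre :: "real^(2+2) \<Rightarrow> real^2" where
  "fibre p = (\<chi> i. p $ Inr i)"

definition zero_section :: "real^2 \<Rightarrow> real^(2+2)" where
  "zero_section x = (\<chi> u. case u of Inl i \<Rightarrow> x $ i | Inr i \<Rightarrow> 0)"

text \<open>\<open>psi \<Gamma> p $ i $ u\<close> is the value of \<open>\<psi>\<^sub>i\<close> on the \<open>u\<close>-th coordinate vector field.\<close>

definition psi :: "(real^2 \<Rightarrow> real^2^2^2) \<Rightarrow> real^(2+2) \<Rightarrow> real^(2+2)^2" where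
  "psi \<Gamma> p = (let x = base p; \<xi> = fibre p in
     \<chi> i u. case u of
        Inl j \<Rightarrow> - (\<Sum>k\<in>UNIV. \<xi> $ k * \<Gamma> x $ k $ i $ j) - \<xi> $ i * \<xi> $ j - schout \<Gamma> x $ j $ i
      | Inr l \<Rightarrow> (if l = i then 1 else 0))"

definition psi_dx :: "(real^2 \<Rightarrow> real^2^2^2) \<Rightarrow> real^(2+2) \<Rightarrow> real^(2+2)^(2+2)" where
  "psi_dx \<Gamma> p = (\<chi> u v. \<Sum>i\<in>UNIV. psi \<Gamma> p $ i $ u * (if v = Inl i then 1 else 0))"

definition h_metric :: "(real^2 \<Rightarrow> real^2^2^2) \<Rightarrow> real^(2+2) \<Rightarrow> real^(2+2)^(2+2)" where
  "h_metric \<Gamma> p = (1/2) *\<^sub>R (psi_dx \<Gamma> p + transpose (psi_dx \<Gamma> p))"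

definition lagrangian :: "'a chart set \<Rightarrow> ('a, real^2^2^2) field \<Rightarrow> bool" where
  "lagrangian A \<Gamma> \<longleftrightarrow> (\<forall>c\<in>A. \<forall>x\<in>cimg c. ricci_skew (\<Gamma> c) x = 0)"

definition timelike :: "'a chart set \<Rightarrow> ('a, real^2^2^2) field \<Rightarrow> bool" where
  "timelike A \<Gamma> \<longleftrightarrow> (\<forall>c\<in>A. \<forall>x\<in>cimg c. \<forall>v. v \<noteq> 0 \<longrightarrow> v \<bullet> (ricci_sym (\<Gamma> c) x *v v) > 0)"

definition spacelike :: "'a chart set \<Rightarrow> ('a, real^2^2^2) field \<Rightarrow> bool" where
  "spacelike A \<Gamma> \<longleftrightarrow> (\<forall>c\<in>A. \<forall>x\<in>cimg c. \<forall>v. v \<noteq> 0 \<longrightarrow> v \<bullet> (ricci_sym (\<Gamma> c) x *v v) < 0)"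

definition minimal :: "'a chart set \<Rightarrow> ('a, real^2^2^2) field \<Rightarrow> bool" where
  "minimal A \<Gamma> \<longleftrightarrow>
     (\<forall>c\<in>A. \<forall>x\<in>cimg c. trace_second_fundamental_form (h_metric (\<Gamma> c)) zero_section x = 0)"


section \<open>The covariant derivative of the metric\<close>

definition nabla :: "(real^2 \<Rightarrow> real^2^2^2) \<Rightarrow> (real^2 \<Rightarrow> real^2^2) \<Rightarrow> real^2 \<Rightarrow> real^2^2^2" where
  "nabla \<Gamma> g x = (\<chi> i j k. pd i g x $ j $ k
     - (\<Sum>m\<in>UNIV. \<Gamma> x $ m $ i $ j * g x $ m $ k + \<Gamma> x $ m $ i $ k * g x $ j $ m))"

definition Sym :: "real^2^2^2 \<Rightarrow> real^2^2^2" where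
  "Sym T = (\<chi> i j k. (T$i$j$k + T$i$k$j + T$j$i$k + T$j$k$i + T$k$i$j + T$k$j$i) / 6)"

definition tr3 :: "real^2^2 \<Rightarrow> real^2^2^2 \<Rightarrow> real^2" where
  "tr3 g T = (\<chi> k. \<Sum>i\<in>UNIV. \<Sum>j\<in>UNIV. matrix_inv g $ i $ j * T $ i $ j $ k)"

text \<open>In dimension two \<open>tr\<^sub>g (Sym (g \<otimes> \<alpha>)) = (4/3) \<alpha>\<close>, which accounts for the factor \<open>3/4\<close>.\<close>

definition Sym0 :: "real^2^2 \<Rightarrow> real^2^2^2 \<Rightarrow> real^2^2^2" where
  "Sym0 g T = Sym T - (3/4) *\<^sub>R Sym (\<chi> i j k. g $ i $ j * tr3 g (Sym T) $ k)"


section \<open>Operators of an oriented Riemannian surface\<close>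

text \<open>All components refer to positively oriented coordinates.\<close>

definition area_form :: "real^2^2 \<Rightarrow> real^2^2" where
  "area_form g = (\<chi> i j. if i = 1 \<and> j = 2 then sqrt (det g)
                         else if i = 2 \<and> j = 1 then - sqrt (det g) else 0)"

text \<open>Rotation by \<open>\<pi>/2\<close>, determined by \<open>g(JX,Y) = vol(X,Y)\<close>; \<open>cstr g $ k $ i\<close> is the \<open>k\<close>-th
  component of \<open>J\<partial>\<^sub>i\<close>.\<close>

definition cstr :: "real^2^2 \<Rightarrow> real^2^2" where
  "cstr g = (\<chi> k i. \<Sum>m\<in>UNIV. area_form g $ i $ m * matrix_inv g $ m $ k)"

text \<open>Normalised so that \<open>\<alpha> \<and> \<star>\<alpha> = \<bar>\<alpha>\<bar>\<^sup>2 vol\<close>, i.e.\ \<open>\<star>\<omega>\<^sub>1 = \<omega>\<^sub>2\<close> and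
  \<open>\<star>\<omega>\<^sub>2 = -\<omega>\<^sub>1\<close> for an oriented orthonormal coframe.\<close>

definition hodge :: "real^2^2 \<Rightarrow> real^2 \<Rightarrow> real^2" where
  "hodge g \<alpha> = (\<chi> j. \<Sum>i\<in>UNIV. \<Sum>k\<in>UNIV. \<alpha> $ i * matrix_inv g $ i $ k * area_form g $ k $ j)"

definition hodge2 :: "real^2^2 \<Rightarrow> real^2^2 \<Rightarrow> real" where
  "hodge2 g \<omega> = \<omega> $ 1 $ 2 / area_form g $ 1 $ 2"

definition extd :: "(real^2 \<Rightarrow> real^2) \<Rightarrow> real^2 \<Rightarrow> real^2^2" where
  "extd \<alpha> x = (\<chi> i j. pd i \<alpha> x $ j - pd j \<alpha> x $ i)"

text \<open>On 1-forms of an oriented Riemannian surface the formal adjoint of \<open>d\<close> is \<open>-\<star>d\<star>\<close>.\<close>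

definition codiff :: "(real^2 \<Rightarrow> real^2^2) \<Rightarrow> (real^2 \<Rightarrow> real^2) \<Rightarrow> real^2 \<Rightarrow> real" where
  "codiff g \<alpha> x = - hodge2 (g x) (extd (\<lambda>y. hodge (g y) (\<alpha> y)) x)"

text \<open>\<open>K\<^sup>3\<close> is the third tensor power of the bundle of complex-linear covectors; since \<open>K\<close> is a
  line bundle its elements are exactly the tensors of type (1,0) in every argument.\<close>

definition type30 :: "real^2^2 \<Rightarrow> complex^2^2^2 \<Rightarrow> bool" where
  "type30 g C \<longleftrightarrow> (\<forall>i j k.
     (\<Sum>m\<in>UNIV. cstr g $ m $ i * C $ m $ j $ k) = \<i> * C $ i $ j $ k \<and>
     (\<Sum>m\<in>UNIV. cstr g $ m $ j * C $ i $ m $ k) = \<i> * C $ i $ j $ k \<and>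
     (\<Sum>m\<in>UNIV. cstr g $ m $ k * C $ i $ j $ m) = \<i> * C $ i $ j $ k)"

definition cubic_differential ::
    "'a chart set \<Rightarrow> ('a, real^2^2) field \<Rightarrow> ('a, complex^2^2^2) field \<Rightarrow> bool" where
  "cubic_differential A g C \<longleftrightarrow>
     complex_tensor3_field A C \<and> (\<forall>c\<in>A. \<forall>x\<in>cimg c. type30 (g c x) (C c x))"

definition oriented_orthonormal_coframe :: "real^2^2 \<Rightarrow> real^2 \<Rightarrow> real^2 \<Rightarrow> bool" where
  "oriented_orthonormal_coframe g w1 w2 \<longleftrightarrow>
     w1 \<bullet> (matrix_inv g *v w1) = 1 \<and> w2 \<bullet> (matrix_inv g *v w2) = 1 \<and>
     w1 \<bullet> (matrix_inv g *v w2) = 0 \<and> w1 $ 1 * w2 $ 2 - w1 $ 2 * w2 $ 1 > 0"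

definition cube :: "complex^2 \<Rightarrow> complex^2^2^2" where
  "cube \<theta> = (\<chi> i j k. \<theta> $ i * \<theta> $ j * \<theta> $ k)"

definition cubic_norm_sq :: "real^2^2 \<Rightarrow> complex^2^2^2 \<Rightarrow> real" where
  "cubic_norm_sq g C = (THE r. \<exists>w1 w2 c. oriented_orthonormal_coframe g w1 w2 \<and>
     C = (\<chi> i j k. c * cube (\<chi> i. Complex (w1 $ i) (w2 $ i)) $ i $ j $ k) \<and> r = (cmod c)\<^sup>2)"

text \<open>The (0,1)-part of the coordinate vector field \<open>\<partial>\<^sub>i\<close>.\<close>

definition dbar_vec :: "real^2^2 \<Rightarrow> 2 \<Rightarrow> complex^2" where
  "dbar_vec g i = (\<chi> m. ((if m = i then 1 else 0) + \<i> * cstr g $ m $ i) / 2)"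

text \<open>The Dolbeault operator: on (1,0)-vector fields \<open>Y\<close> and for \<open>X\<close> of type (0,1),
  \<open>(\<partial>-bar C)(X; Y\<^sub>1, Y\<^sub>2, Y\<^sub>3)\<close> is \<open>X(C(Y\<^sub>1, Y\<^sub>2, Y\<^sub>3))\<close> minus the three terms in which \<open>[X, Y\<^sub>i]\<close>
  is inserted, that is, the Lie derivative of \<open>C\<close> along \<open>X\<close>.  The first index of \<open>delbar\<close> is the
  one of the (0,1)-form.  See \<open>delbar_closed\<close> below for the comparison with the expression in
  holomorphic coordinates (\<open>\<theta> = dz\<close>).\<close>

definition delbar ::
    "(real^2 \<Rightarrow> real^2^2) \<Rightarrow> (real^2 \<Rightarrow> complex^2^2^2) \<Rightarrow> real^2 \<Rightarrow> complex^2^2^2^2" where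
  "delbar g C x = (\<chi> l i j k. let X = (\<lambda>y. dbar_vec (g y) l) in
     \<Sum>m\<in>UNIV. X x $ m * pd m C x $ i $ j $ k
       + pd i X x $ m * C x $ m $ j $ k
       + pd j X x $ m * C x $ i $ m $ k
       + pd k X x $ m * C x $ i $ j $ m)"

lemma has_derivative_nth_frechet:
  fixes f :: "real^'n \<Rightarrow> ('b::real_normed_vector)^'m"
  assumes "f differentiable at x"
  shows "((\<lambda>y. f y $ j) has_derivative (\<lambda>v. frechet_derivative f (at x) v $ j)) (at x)"
  using assms bounded_linear.has_derivative[OF bounded_linear_vec_nth]
  by (auto simp: frechet_derivative_works)

text \<open>If \<open>\<theta>\<close> is a closed (that is, holomorphic) (1,0)-form and \<open>C = f \<theta>\<^sup>3\<close>, then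
  \<open>\<partial>-bar C = (\<partial>-bar f) \<otimes> \<theta>\<^sup>3\<close>.\<close>

lemma delbar_closed:
  fixes \<theta> :: "real^2 \<Rightarrow> complex^2" and f :: "real^2 \<Rightarrow> complex"
  assumes U: "open U" "x \<in> U"
    and diff: "f differentiable at x" "\<theta> differentiable at x" "C differentiable at x"
      "(\<lambda>y. dbar_vec (g y) l) differentiable at x"
    and C: "\<And>y i j k. y \<in> U \<Longrightarrow> C y $ i $ j $ k = f y * cube (\<theta> y) $ i $ j $ k"
    and type10: "\<And>y i. y \<in> U \<Longrightarrow> (\<Sum>m\<in>UNIV. cstr (g y) $ m $ i * \<theta> y $ m) = \<i> * \<theta> y $ i"
    and closed: "\<And>i j. pd i \<theta> x $ j = pd j \<theta> x $ i"
  shows "delbar g C x $ l $ i $ j $ k =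
    (\<Sum>m\<in>UNIV. dbar_vec (g x) l $ m * pd m f x) * cube (\<theta> x) $ i $ j $ k"
proof -
  define X where "X = (\<lambda>y. dbar_vec (g y) l)"
  have Xx: "dbar_vec (g y) l = X y" for y by (simp add: X_def)
  have Xth: "(\<Sum>m\<in>UNIV. X y $ m * \<theta> y $ m) = 0" if "y \<in> U" for y
  proof -
    have "(\<Sum>m\<in>UNIV. X y $ m * \<theta> y $ m) =
      ((\<Sum>m\<in>UNIV. (if m = l then 1 else 0) * \<theta> y $ m) + \<i> * (\<Sum>m\<in>UNIV. cstr (g y) $ m $ l * \<theta> y $ m)) / 2"
      by (simp add: X_def dbar_vec_def sum_2 field_simps)
    also have "(\<Sum>m\<in>UNIV. (if m = l then 1 else 0) * \<theta> y $ m) = (\<Sum>m\<in>UNIV. if m = l then \<theta> y $ m else 0)"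
      by (rule sum.cong) auto
    finally show ?thesis using type10[OF that, of l] by simp
  qed
  have dX: "((\<lambda>y. X y $ m) has_derivative (\<lambda>v. frechet_derivative X (at x) v $ m)) (at x)" for m
    using has_derivative_nth_frechet diff(4) by (auto simp: X_def)
  have dth: "((\<lambda>y. \<theta> y $ m) has_derivative (\<lambda>v. frechet_derivative \<theta> (at x) v $ m)) (at x)" for m
    using has_derivative_nth_frechet diff(2) by auto
  have df: "(f has_derivative frechet_derivative f (at x)) (at x)"
    using diff(1) by (simp add: frechet_derivative_works)
  have A: "(\<Sum>m\<in>UNIV. pd b X x $ m * \<theta> x $ m) = - (\<Sum>m\<in>UNIV. X x $ m * pd b \<theta> x $ m)" for b
  proof -
    have "((\<lambda>y. \<Sum>m\<in>UNIV. X y $ m * \<theta> y $ m) has_derivative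
        (\<lambda>v. \<Sum>m\<in>UNIV. X x $ m * frechet_derivative \<theta> (at x) v $ m +
            frechet_derivative X (at x) v $ m * \<theta> x $ m)) (at x)"
      by (intro has_derivative_sum has_derivative_mult dX dth)
    moreover have "((\<lambda>y. \<Sum>m\<in>UNIV. X y $ m * \<theta> y $ m) has_derivative (\<lambda>v. 0)) (at x)"
      by (rule has_derivative_transform_within_open[OF has_derivative_const[of 0] U]) (simp add: Xth)
    ultimately have "(\<lambda>v. \<Sum>m\<in>UNIV. X x $ m * frechet_derivative \<theta> (at x) v $ m +
            frechet_derivative X (at x) v $ m * \<theta> x $ m) = (\<lambda>v. 0)"
      by (rule has_derivative_unique)
    from fun_cong[OF this, of "axis b 1"] show ?thesis
      by (simp add: pd_def sum.distrib add_eq_0_iff)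
  qed
  have dC: "pd m C x $ i $ j $ k = pd m f x * (\<theta> x $ i * \<theta> x $ j * \<theta> x $ k)
     + f x * (pd m \<theta> x $ i * \<theta> x $ j * \<theta> x $ k + \<theta> x $ i * pd m \<theta> x $ j * \<theta> x $ k + \<theta> x $ i * \<theta> x $ j * pd m \<theta> x $ k)" for m
  proof -
    have "((\<lambda>y. C y $ i $ j $ k) has_derivative (\<lambda>v. frechet_derivative C (at x) v $ i $ j $ k)) (at x)"
      using diff(3) by (auto simp: frechet_derivative_works
        intro!: bounded_linear.has_derivative[OF bounded_linear_vec_nth])
    then have "((\<lambda>y. f y * (\<theta> y $ i * \<theta> y $ j * \<theta> y $ k)) has_derivative (\<lambda>v. frechet_derivative C (at x) v $ i $ j $ k)) (at x)"
      by (rule has_derivative_transform_within_open[OF _ U]) (simp add: C cube_def)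
    moreover have "((\<lambda>y. f y * (\<theta> y $ i * \<theta> y $ j * \<theta> y $ k)) has_derivative
      (\<lambda>v. f x * ((\<theta> x $ i * \<theta> x $ j) * frechet_derivative \<theta> (at x) v $ k + (\<theta> x $ i * frechet_derivative \<theta> (at x) v $ j + frechet_derivative \<theta> (at x) v $ i * \<theta> x $ j) * \<theta> x $ k)
        + frechet_derivative f (at x) v * (\<theta> x $ i * \<theta> x $ j * \<theta> x $ k))) (at x)"
      by (intro has_derivative_mult df dth)
    ultimately have "(\<lambda>v. frechet_derivative C (at x) v $ i $ j $ k) = (\<lambda>v. f x * ((\<theta> x $ i * \<theta> x $ j) * frechet_derivative \<theta> (at x) v $ k + (\<theta> x $ i * frechet_derivative \<theta> (at x) v $ j + frechet_derivative \<theta> (at x) v $ i * \<theta> x $ j) * \<theta> x $ k)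
        + frechet_derivative f (at x) v * (\<theta> x $ i * \<theta> x $ j * \<theta> x $ k))"
      by (rule has_derivative_unique)
    from fun_cong[OF this, of "axis m 1"] show ?thesis
      by (simp add: pd_def algebra_simps)
  qed
  have Cx: "C x $ a $ b $ c = f x * (\<theta> x $ a * \<theta> x $ b * \<theta> x $ c)" for a b c
    using C[OF U(2)] by (simp add: cube_def)
  define P where "P = f x * \<theta> x $ j * \<theta> x $ k"
  define Q where "Q = f x * \<theta> x $ i * \<theta> x $ k"
  define R where "R = f x * \<theta> x $ i * \<theta> x $ j"
  have "delbar g C x $ l $ i $ j $ k = (\<Sum>m\<in>UNIV. X x $ m * pd m f x) * (\<theta> x $ i * \<theta> x $ j * \<theta> x $ k)
     + P * ((\<Sum>m\<in>UNIV. pd i X x $ m * \<theta> x $ m) + (\<Sum>m\<in>UNIV. X x $ m * pd m \<theta> x $ i))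
     + Q * ((\<Sum>m\<in>UNIV. pd j X x $ m * \<theta> x $ m) + (\<Sum>m\<in>UNIV. X x $ m * pd m \<theta> x $ j))
     + R * ((\<Sum>m\<in>UNIV. pd k X x $ m * \<theta> x $ m) + (\<Sum>m\<in>UNIV. X x $ m * pd m \<theta> x $ k))"
    unfolding delbar_def X_def[symmetric] vec_lambda_beta Let_def dC Cx P_def Q_def R_def
    by (simp add: Xx sum_2 algebra_simps)
  then show ?thesis
    unfolding A by (simp add: closed[of _ i] closed[of _ j] closed[of _ k] X_def cube_def)
qed

end

theory Submission
  imports Defs
begin

text \<open>
  Write \<open>\<nabla> = D + A\<close>, where \<open>D\<close> is the Levi-Civita connection of \<open>g = s Ric(\<nabla>)\<close> and \<open>s = 1\<close> or \<open>s = -1\<close>,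
  and lower the upper index of \<open>A\<close> with \<open>g\<close>.  The Christoffel symbols of \<open>h\<^sub>\<nabla>\<close> along the zero section
  show that the fibre component of the traced second fundamental form is a multiple of
  \<open>g\<^sup>i\<^sup>j A\<^sub>k\<^sub>i\<^sub>j\<close>, so minimality forces this trace to vanish (\<open>christoffel_h_metric\<close>, \<open>A_trace_free\<close>).
  As \<open>A\<^sub>k\<^sub>i\<^sub>j\<close> is symmetric in \<open>i\<close> and \<open>j\<close>, what remains is a 1-form \<open>\<beta>\<close> and a trace-free cubic form \<open>P\<close>,
  \[ A_{kij} = g_{ij} \beta_k - g_{ki} \beta_j - g_{kj} \beta_i + s P_{kij}, \]
  and since \<open>\<nabla>\<^sub>i g\<^sub>j\<^sub>k = - A\<^sub>k\<^sub>i\<^sub>j - A\<^sub>j\<^sub>i\<^sub>k\<close> these are the 1-form of the theorem and the real part of \<open>C\<close>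
  (\<open>difference_decomposition\<close>).

  Inserting this into the Ricci tensor of \<open>D + A\<close> gives (\<open>ricci_decomposition\<close>)
  \[ Ric(\nabla)_{ij} = (K_g + div \beta - 2 |C|^2) g_{ij} + (D_i \beta_j - D_j \beta_i)
       + s (div P - 2 P(\beta))_{ij} . \]
  The summands are pure trace, skew, and symmetric trace-free, so \<open>Ric(\<nabla>) = s g\<close> splits into three
  equations (\<open>structure_equations\<close>).  The first one is the equation for the Gauss curvature because
  \<open>\<delta>\<beta> = - div \<beta>\<close>, and the second one is \<open>d\<beta> = 0\<close>.  The third one, \<open>div P = 2 P(\<beta>)\<close>, is the equation for
  the Dolbeault operator: \<open>D\<close> preserves the complex structure, so \<open>\<partial>\<close>-bar \<open>C\<close> is the (0,1)-part of \<open>DC\<close>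
  (\<open>delbar_cov3\<close>), and in dimension two a 1-form with values in trace-free cubic forms is
  divergence-free only if its complexification has no (0,1)-part
  (\<open>divergence_free_imp_holomorphic\<close>), which is applied to \<open>DC - 2 \<beta> \<otimes> C\<close>.

  These identities are local.  That \<open>g\<close>, \<open>\<beta>\<close> and \<open>C\<close> are tensor fields on the surface follows from the
  transformation law of the connection, which makes \<open>Ric(\<nabla>)\<close> and \<open>\<nabla>g\<close> tensorial
  (\<open>ricci_transform\<close>, \<open>nabla_transform\<close>), and from the invariance of the complex structure under
  orientation preserving coordinate changes (\<open>cstr_pull\<close>).
\<close>

section \<open>Smooth functions on open sets\<close>

lemma Ck_on_cong:
  assumes "open S" "\<And>x. x \<in> S \<Longrightarrow> f x = g x" "Ck_on k f S"
  shows "Ck_on k g S"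
  using assms(2,3)
proof (induction k arbitrary: f g)
  case 0
  have "continuous_on S f" using 0(2) by (simp only: Ck_on.simps)
  then have "continuous_on S g" by (rule continuous_on_eq) (rule 0(1))
  then show ?case by (simp only: Ck_on.simps)
next
  case (Suc k)
  have fr: "frechet_derivative f (at x) = frechet_derivative g (at x)" if "x \<in> S" for x
  proof (rule frechet_derivative_transform_within_open[OF _ \<open>open S\<close> that])
    show "f differentiable at x"
      using Suc.prems(2) that at_within_open[OF that \<open>open S\<close>] by (force simp: differentiable_on_def)
  qed (use Suc.prems(1) in blast)
  have "g differentiable_on S"
    unfolding differentiable_on_def
  proof
    fix x assume "x \<in> S"
    then have "f differentiable at x within S" using Suc.prems(2) by (simp add: differentiable_on_def)
    then show "g differentiable at x within S"
      by (rule differentiable_transform_within[where d=1]) (use Suc.prems(1) \<open>x \<in> S\<close> in auto)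
  qed
  moreover have "Ck_on k (\<lambda>x. frechet_derivative g (at x) v) S" for v
    by (rule Suc.IH[of "\<lambda>x. frechet_derivative f (at x) v"]) (use Suc.prems fr in auto)
  ultimately show ?case by simp
qed

text \<open>Only the derivative on \<open>S\<close> matters, so an explicit derivative \<open>D\<close> can replace the one selected by
  \<open>frechet_derivative\<close>.  The closure properties below all differentiate once by a rule of calculus
  and apply the induction hypothesis to \<open>D\<close>.\<close>

lemma Ck_on_Suc_intro:
  assumes "open S" "\<And>x. x \<in> S \<Longrightarrow> (f has_derivative D x) (at x)"
    and "\<And>v. Ck_on k (\<lambda>x. D x v) S"
  shows "Ck_on (Suc k) f S"
proof -
  have "f differentiable_on S"
    unfolding differentiable_on_def differentiable_def
    using has_derivative_at_withinI[OF assms(2)] by blast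
  moreover have "Ck_on k (\<lambda>x. frechet_derivative f (at x) v) S" for v
    by (rule Ck_on_cong[OF assms(1) _ assms(3)[of v]]) (simp add: frechet_derivative_at[OF assms(2), symmetric])
  ultimately show ?thesis by simp
qed

lemma Ck_on_SucD:
  assumes "open S" "Ck_on (Suc k) f S" "x \<in> S"
  shows "(f has_derivative frechet_derivative f (at x)) (at x)"
proof -
  have "f differentiable at x"
    using assms(2,3) at_within_open[OF assms(3,1)] by (force simp: differentiable_on_def)
  then show ?thesis by (simp add: frechet_derivative_works)
qed

lemma Ck_on_Suc_imp: "Ck_on (Suc k) f S \<Longrightarrow> Ck_on k f S"
proof (induction k arbitrary: f)
  case 0 then show ?case by (simp add: differentiable_imp_continuous_on)
next
  case (Suc k) then show ?case by (metis Ck_on.simps(2))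
qed

lemma Ck_on_const: "open S \<Longrightarrow> Ck_on k (\<lambda>x. c) S"
proof (induction k arbitrary: c)
  case (Suc k) then show ?case by (intro Ck_on_Suc_intro[where D="\<lambda>x v. 0"]) auto
qed simp

lemma Ck_on_add:
  assumes "open S" "Ck_on k f S" "Ck_on k g S"
  shows "Ck_on k (\<lambda>x. f x + g x) S"
  using assms(2,3)
proof (induction k arbitrary: f g)
  case 0 then show ?case by (auto intro: continuous_on_add)
next
  case (Suc k)
  show ?case
    by (rule Ck_on_Suc_intro[OF assms(1) has_derivative_add[OF Ck_on_SucD[OF assms(1) Suc.prems(1)] Ck_on_SucD[OF assms(1) Suc.prems(2)]]])
       (use Suc in auto)
qed

lemma Ck_on_linear:
  assumes "open S" "bounded_linear h" "Ck_on k f S"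
  shows "Ck_on k (\<lambda>x. h (f x)) S"
  using assms(3)
proof (induction k arbitrary: f)
  case 0 then show ?case using bounded_linear.continuous_on[OF assms(2)] by auto
next
  case (Suc k)
  show ?case
    by (rule Ck_on_Suc_intro[OF assms(1) bounded_linear.has_derivative[OF assms(2) Ck_on_SucD[OF assms(1) Suc.prems]]])
       (use Suc in auto)
qed

lemma Ck_on_mult:
  fixes f g :: "'a::real_normed_vector \<Rightarrow> 'b::real_normed_algebra"
  assumes "open S" "Ck_on k f S" "Ck_on k g S"
  shows "Ck_on k (\<lambda>x. f x * g x) S"
  using assms(2,3)
proof (induction k arbitrary: f g)
  case 0 then show ?case by (auto intro: continuous_on_mult)
next
  case (Suc k)
  show ?case
    by (rule Ck_on_Suc_intro[OF assms(1) has_derivative_mult[OF Ck_on_SucD[OF assms(1) Suc.prems(1)] Ck_on_SucD[OF assms(1) Suc.prems(2)]]])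
       (use Suc Ck_on_Suc_imp[OF Suc.prems(1)] Ck_on_Suc_imp[OF Suc.prems(2)] in \<open>auto intro!: Ck_on_add[OF assms(1)]\<close>)
qed

lemma Ck_on_inverse:
  fixes f :: "'a::real_normed_vector \<Rightarrow> real"
  assumes "open S" "Ck_on k f S" "\<And>x. x \<in> S \<Longrightarrow> f x \<noteq> 0"
  shows "Ck_on k (\<lambda>x. inverse (f x)) S"
  using assms(2)
proof (induction k)
  case 0 then show ?case using assms(3) by (auto intro: continuous_on_inverse)
next
  case (Suc k)
  have "Ck_on k (\<lambda>x. - (inverse (f x) * frechet_derivative f (at x) v * inverse (f x))) S" for v
    using Suc Ck_on_Suc_imp[OF Suc.prems]
    by (intro Ck_on_linear[OF assms(1) bounded_linear_minus[OF bounded_linear_ident]] Ck_on_mult[OF assms(1)]) auto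
  then show ?case
    by (intro Ck_on_Suc_intro[OF assms(1) Deriv.has_derivative_inverse[OF _ Ck_on_SucD[OF assms(1) Suc.prems]]])
       (use assms(3) in auto)
qed

lemma Ck_on_sqrt:
  fixes f :: "'a::real_normed_vector \<Rightarrow> real"
  assumes "open S" "Ck_on k f S" "\<And>x. x \<in> S \<Longrightarrow> f x > 0"
  shows "Ck_on k (\<lambda>x. sqrt (f x)) S"
  using assms(2)
proof (induction k)
  case 0 then show ?case by (auto intro!: continuous_on_real_sqrt)
next
  case (Suc k)
  have "Ck_on k (\<lambda>x. (1/2) * (frechet_derivative f (at x) v * inverse (sqrt (f x)))) S" for v
    using Suc Ck_on_Suc_imp[OF Suc.prems] assms(3)
    by (intro Ck_on_mult[OF assms(1)] Ck_on_const[OF assms(1)] Ck_on_inverse[OF assms(1)])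
      (auto simp: less_imp_neq[THEN not_sym])
  then show ?case
    by (intro Ck_on_Suc_intro[OF assms(1), where D="\<lambda>x v. (1/2) * (frechet_derivative f (at x) v * inverse (sqrt (f x)))"])
       (use assms(3) Ck_on_SucD[OF assms(1) Suc.prems] in \<open>auto intro!: derivative_eq_intros simp: field_simps fun_eq_iff\<close>)
qed

lemma bounded_linear_axis: "bounded_linear (axis i :: 'b::real_normed_vector \<Rightarrow> 'b^'n::finite)"
proof
  show "axis i (a + b) = axis i a + axis i b" for a b :: 'b by (simp add: axis_def vec_eq_iff)
  show "axis i (r *\<^sub>R a) = r *\<^sub>R axis i a" for r and a :: 'b by (simp add: axis_def vec_eq_iff)
  show "\<exists>K. \<forall>a::'b. norm (axis i a :: 'b^'n) \<le> norm a * K"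
    by (rule exI[of _ 1]) (auto simp: norm_vec_def L2_set_def axis_def if_distrib[of norm] if_distrib[of "\<lambda>x. x^2"] cong: if_cong)
qed

lemma vec_lambda_axis: "(\<chi> i. f i) = (\<Sum>i\<in>UNIV. axis i (f i :: 'b::real_normed_vector) :: 'b^'n::finite)"
  by (simp add: vec_eq_iff axis_def)

lemma smooth_on_const [simp]: "open S \<Longrightarrow> smooth_on (\<lambda>x. c) S"
  by (simp add: smooth_on_def Ck_on_const)

lemma smooth_on_add: "open S \<Longrightarrow> smooth_on f S \<Longrightarrow> smooth_on g S \<Longrightarrow> smooth_on (\<lambda>x. f x + g x) S"
  by (simp add: smooth_on_def Ck_on_add)

lemma smooth_on_linear: "open S \<Longrightarrow> bounded_linear h \<Longrightarrow> smooth_on f S \<Longrightarrow> smooth_on (\<lambda>x. h (f x)) S"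
  by (simp add: smooth_on_def Ck_on_linear)

lemma smooth_on_minus: "open S \<Longrightarrow> smooth_on f S \<Longrightarrow> smooth_on (\<lambda>x. - f x) S"
  by (rule smooth_on_linear[OF _ bounded_linear_minus[OF bounded_linear_ident]])

lemma smooth_on_diff: "open S \<Longrightarrow> smooth_on f S \<Longrightarrow> smooth_on g S \<Longrightarrow> smooth_on (\<lambda>x. f x - g x) S"
  using smooth_on_add[of S f "\<lambda>x. - g x"] smooth_on_minus[of S g] by simp

lemma smooth_on_mult:
  fixes f g :: "'a::real_normed_vector \<Rightarrow> 'b::real_normed_algebra"
  shows "open S \<Longrightarrow> smooth_on f S \<Longrightarrow> smooth_on g S \<Longrightarrow> smooth_on (\<lambda>x. f x * g x) S"
  by (simp add: smooth_on_def Ck_on_mult)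

lemma smooth_on_divide:
  fixes f g :: "'a::real_normed_vector \<Rightarrow> real"
  shows "open S \<Longrightarrow> smooth_on f S \<Longrightarrow> smooth_on g S \<Longrightarrow> (\<And>x. x \<in> S \<Longrightarrow> g x \<noteq> 0) \<Longrightarrow> smooth_on (\<lambda>x. f x / g x) S"
  by (simp add: smooth_on_def Ck_on_mult Ck_on_inverse divide_inverse)

lemma smooth_on_sqrt:
  fixes f :: "'a::real_normed_vector \<Rightarrow> real"
  shows "open S \<Longrightarrow> smooth_on f S \<Longrightarrow> (\<And>x. x \<in> S \<Longrightarrow> f x > 0) \<Longrightarrow> smooth_on (\<lambda>x. sqrt (f x)) S"
  by (simp add: smooth_on_def Ck_on_sqrt)

lemma smooth_on_sum:
  "open S \<Longrightarrow> (\<And>i. i \<in> I \<Longrightarrow> smooth_on (f i) S) \<Longrightarrow> smooth_on (\<lambda>x. \<Sum>i\<in>I. f i x) S"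
  by (induction I rule: infinite_finite_induct) (auto intro: smooth_on_add)

lemma smooth_on_vec_lambda:
  fixes f :: "'n::finite \<Rightarrow> 'a::real_normed_vector \<Rightarrow> 'b::real_normed_vector"
  shows "open S \<Longrightarrow> (\<And>i. smooth_on (f i) S) \<Longrightarrow> smooth_on (\<lambda>x. \<chi> i. f i x) S"
  unfolding vec_lambda_axis
  by (intro smooth_on_sum smooth_on_linear[OF _ bounded_linear_axis])

lemma smooth_on_nth: "open S \<Longrightarrow> smooth_on f S \<Longrightarrow> smooth_on (\<lambda>x. f x $ i) S"
  by (rule smooth_on_linear[OF _ bounded_linear_vec_nth])

lemma smooth_on_pd: "smooth_on f S \<Longrightarrow> smooth_on (pd i f) S"
  unfolding smooth_on_def pd_def[abs_def] using Ck_on.simps(2) by blast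

lemma smooth_on_of_real: "open S \<Longrightarrow> smooth_on f S \<Longrightarrow> smooth_on (\<lambda>x. complex_of_real (f x)) S"
  by (rule smooth_on_linear[OF _ bounded_linear_of_real])

lemma smooth_on_cong:
  "open S \<Longrightarrow> (\<And>x. x \<in> S \<Longrightarrow> f x = g x) \<Longrightarrow> smooth_on f S \<Longrightarrow> smooth_on g S"
  unfolding smooth_on_def using Ck_on_cong by blast

lemma smooth_on_subset: "smooth_on f S \<Longrightarrow> T \<subseteq> S \<Longrightarrow> smooth_on f T"
proof -
  have "Ck_on k f S \<Longrightarrow> T \<subseteq> S \<Longrightarrow> Ck_on k f T" for k
    by (induction k arbitrary: f) (auto intro: continuous_on_subset differentiable_on_subset)
  then show "smooth_on f S \<Longrightarrow> T \<subseteq> S \<Longrightarrow> smooth_on f T" by (simp add: smooth_on_def)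
qed

lemma smooth_on_differentiable:
  assumes "smooth_on f S" "open S" "x \<in> S"
  shows "f differentiable at x"
proof -
  have "Ck_on (Suc 0) f S" using assms(1) unfolding smooth_on_def by blast
  then show ?thesis
    using assms(3) at_within_open[OF assms(3,2)] by (force simp: differentiable_on_def)
qed

lemma smooth_on_continuous: "smooth_on f S \<Longrightarrow> continuous_on S f"
  unfolding smooth_on_def by (metis Ck_on.simps(1))


section \<open>Partial derivatives\<close>

lemma pd_has_derivative: "(f has_derivative D) (at x) \<Longrightarrow> pd i f x = D (axis i 1)"
  by (simp add: pd_def frechet_derivative_at[symmetric])

lemma differentiable_has: "f differentiable at x \<Longrightarrow> (f has_derivative frechet_derivative f (at x)) (at x)"
  by (simp add: frechet_derivative_works)

lemma pd_const [simp]: "pd i (\<lambda>y. c) x = 0"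
  by (rule pd_has_derivative[OF has_derivative_const])

lemma pd_add: "f differentiable at x \<Longrightarrow> g differentiable at x \<Longrightarrow>
    pd i (\<lambda>y. f y + g y) x = pd i f x + pd i g x"
  using pd_has_derivative[OF has_derivative_add[OF differentiable_has differentiable_has], of f x g i]
  by (simp add: pd_def)

lemma pd_linear: "bounded_linear h \<Longrightarrow> f differentiable at x \<Longrightarrow> pd i (\<lambda>y. h (f y)) x = h (pd i f x)"
  using pd_has_derivative[OF bounded_linear.has_derivative[OF _ differentiable_has], of h f x i]
  by (simp add: pd_def)

lemma pd_minus: "f differentiable at x \<Longrightarrow> pd i (\<lambda>y. - f y) x = - pd i f x"
  by (rule pd_linear[OF bounded_linear_minus[OF bounded_linear_ident]])

lemma pd_diff: "f differentiable at x \<Longrightarrow> g differentiable at x \<Longrightarrow>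
    pd i (\<lambda>y. f y - g y) x = pd i f x - pd i g x"
  using pd_add[of f x "\<lambda>y. - g y" i] pd_minus[of g x i] by (simp add: differentiable_minus)

lemma pd_mult:
  fixes f g :: "real^'n \<Rightarrow> 'b::real_normed_algebra"
  shows "f differentiable at x \<Longrightarrow> g differentiable at x \<Longrightarrow>
    pd i (\<lambda>y. f y * g y) x = pd i f x * g x + f x * pd i g x"
  using pd_has_derivative[OF has_derivative_mult[OF differentiable_has differentiable_has], of f x g i]
  by (simp add: pd_def)

lemma pd_sum: "(\<And>k. k \<in> I \<Longrightarrow> f k differentiable at x) \<Longrightarrow>
    pd i (\<lambda>y. \<Sum>k\<in>I. f k y) x = (\<Sum>k\<in>I. pd i (f k) x)"
  using pd_has_derivative[OF has_derivative_sum[OF differentiable_has], of I f x i]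
  by (simp add: pd_def)

lemma pd_nth: "f differentiable at x \<Longrightarrow> pd i (\<lambda>y. f y $ j) x = pd i f x $ j"
  by (rule pd_linear[OF bounded_linear_vec_nth])

lemma differentiable_nth: "f differentiable at x \<Longrightarrow> (\<lambda>y. f y $ j) differentiable at x"
  unfolding differentiable_def using bounded_linear.has_derivative[OF bounded_linear_vec_nth] by blast

lemma pd_cong:
  assumes "open S" "x \<in> S" "\<And>y. y \<in> S \<Longrightarrow> f y = g y" "f differentiable at x"
  shows "pd i f x = pd i g x"
  unfolding pd_def using frechet_derivative_transform_within_open[of f x S g] assms by simp

lemma pd_chain:
  fixes \<tau> :: "real^'n \<Rightarrow> real^'m"
  assumes "\<tau> differentiable at x" "f differentiable at (\<tau> x)"
  shows "pd i (\<lambda>y. f (\<tau> y)) x = (\<Sum>a\<in>UNIV. pd i \<tau> x $ a *\<^sub>R pd a f (\<tau> x))"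
proof -
  have "pd i (\<lambda>y. f (\<tau> y)) x = frechet_derivative f (at (\<tau> x)) (pd i \<tau> x)"
    using pd_has_derivative[OF has_derivative_compose[OF differentiable_has[OF assms(1)] differentiable_has[OF assms(2)]], of i]
    by (simp add: pd_def)
  also have "pd i \<tau> x = (\<Sum>a\<in>UNIV. (pd i \<tau> x $ a) *\<^sub>R axis a 1)"
    by (simp add: vec_eq_iff axis_def if_distrib cong: if_cong)
  also have "frechet_derivative f (at (\<tau> x)) \<dots> = (\<Sum>a\<in>UNIV. pd i \<tau> x $ a *\<^sub>R pd a f (\<tau> x))"
    using linear_frechet_derivative[OF assms(2)] by (simp add: linear_sum linear_scale pd_def)
  finally show ?thesis .
qed

lemma differentiable_chain:
  "\<tau> differentiable at x \<Longrightarrow> f differentiable at (\<tau> x) \<Longrightarrow> (\<lambda>y. f (\<tau> y)) differentiable at x"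
  unfolding differentiable_def using has_derivative_compose by blast

text \<open>Two applications of the mean value theorem, in direction \<open>u\<close> and then in direction \<open>v\<close>.  The
  left-hand side is symmetric in \<open>u\<close> and \<open>v\<close>, which is what makes mixed derivatives commute.\<close>

lemma second_difference_mvt:
  fixes f :: "'a::real_normed_vector \<Rightarrow> real"
  assumes "t > 0"
    and D: "\<And>a b. 0 \<le> a \<Longrightarrow> a \<le> t \<Longrightarrow> 0 \<le> b \<Longrightarrow> b \<le> t \<Longrightarrow> f differentiable at (x + a *\<^sub>R u + b *\<^sub>R v)"
    and E: "\<And>a b. 0 \<le> a \<Longrightarrow> a \<le> t \<Longrightarrow> 0 \<le> b \<Longrightarrow> b \<le> t \<Longrightarrow>
       (\<lambda>y. frechet_derivative f (at y) u) differentiable at (x + a *\<^sub>R u + b *\<^sub>R v)"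
  shows "\<exists>a b. 0 \<le> a \<and> a \<le> t \<and> 0 \<le> b \<and> b \<le> t \<and>
    f (x + t *\<^sub>R u + t *\<^sub>R v) - f (x + t *\<^sub>R u) - f (x + t *\<^sub>R v) + f x =
    t * t * frechet_derivative (\<lambda>y. frechet_derivative f (at y) u) (at (x + a *\<^sub>R u + b *\<^sub>R v)) v"
proof -
  let ?g = "\<lambda>y. frechet_derivative f (at y) u"
  have df: "((\<lambda>a. f (x + a *\<^sub>R u + b *\<^sub>R v)) has_real_derivative ?g (x + a *\<^sub>R u + b *\<^sub>R v)) (at a)"
    if "0 \<le> a" "a \<le> t" "0 \<le> b" "b \<le> t" for a b
  proof -
    have "((\<lambda>a. x + a *\<^sub>R u + b *\<^sub>R v) has_derivative (\<lambda>h. h *\<^sub>R u)) (at a)"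
      by (auto intro!: derivative_eq_intros)
    from has_derivative_compose[OF this differentiable_has[OF D[OF that]]]
    show ?thesis
      unfolding has_field_derivative_def
      using linear_frechet_derivative[OF D[OF that]] by (simp add: linear_scale mult.commute[of _ "frechet_derivative _ _ _"])
  qed
  have dg: "((\<lambda>b. ?g (x + a *\<^sub>R u + b *\<^sub>R v)) has_real_derivative frechet_derivative ?g (at (x + a *\<^sub>R u + b *\<^sub>R v)) v) (at b)"
    if "0 \<le> a" "a \<le> t" "0 \<le> b" "b \<le> t" for a b
  proof -
    have "((\<lambda>b. x + a *\<^sub>R u + b *\<^sub>R v) has_derivative (\<lambda>h. h *\<^sub>R v)) (at b)"
      by (auto intro!: derivative_eq_intros)
    from has_derivative_compose[OF this differentiable_has[OF E[OF that]]]
    show ?thesis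
      unfolding has_field_derivative_def
      using linear_frechet_derivative[OF E[OF that]] by (simp add: linear_scale mult.commute[of _ "frechet_derivative _ _ _"])
  qed
  define \<phi> where "\<phi> a = f (x + a *\<^sub>R u + t *\<^sub>R v) - f (x + a *\<^sub>R u)" for a
  have "(\<phi> has_real_derivative (?g (x + a *\<^sub>R u + t *\<^sub>R v) - ?g (x + a *\<^sub>R u))) (at a)"
    if "0 \<le> a" "a \<le> t" for a
    unfolding \<phi>_def using DERIV_diff[OF df[of a t] df[of a 0]] that \<open>t > 0\<close> by simp
  from MVT2[OF \<open>t > 0\<close> this]
  obtain a where a: "0 < a" "a < t" "\<phi> t - \<phi> 0 = t * (?g (x + a *\<^sub>R u + t *\<^sub>R v) - ?g (x + a *\<^sub>R u))"
    by auto
  obtain b where b: "0 < b" "b < t" "?g (x + a *\<^sub>R u + t *\<^sub>R v) - ?g (x + a *\<^sub>R u)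
      = t * frechet_derivative ?g (at (x + a *\<^sub>R u + b *\<^sub>R v)) v"
    using MVT2[OF \<open>t > 0\<close> dg[of a]] a by auto
  have "\<phi> t - \<phi> 0 = t * t * frechet_derivative ?g (at (x + a *\<^sub>R u + b *\<^sub>R v)) v"
    using a(3) b(3) by simp
  then show ?thesis
    using a b by (intro exI[of _ a] exI[of _ b]) (simp add: \<phi>_def)
qed

text \<open>Schwarz's theorem: by continuity both mixed derivatives at \<open>x\<close> are limits, for \<open>t\<close> tending
  to 0, of the same second difference divided by \<open>t\<^sup>2\<close>.\<close>

lemma frechet_derivative_commute:
  fixes f :: "'a::real_normed_vector \<Rightarrow> real"
  assumes "open S" "x \<in> S" "smooth_on f S"
  shows "frechet_derivative (\<lambda>y. frechet_derivative f (at y) u) (at x) v =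
         frechet_derivative (\<lambda>y. frechet_derivative f (at y) v) (at x) u"
proof -
  define F where "F = (\<lambda>u v y. frechet_derivative (\<lambda>y. frechet_derivative f (at y) u) (at y) v)"
  have sm1: "smooth_on (\<lambda>y. frechet_derivative f (at y) u) S" for u
    using assms(3) unfolding smooth_on_def using Ck_on.simps(2) by blast
  have sm2: "smooth_on (F u v) S" for u v
    using sm1[of u] unfolding smooth_on_def F_def using Ck_on.simps(2) by blast
  have cont: "isCont (F u v) x" for u v
    using smooth_on_continuous[OF sm2] assms(1,2) continuous_on_eq_continuous_at by blast
  have "dist (F u v x) (F v u x) < e" if "e > 0" for e
  proof -
    from cont[of u v] \<open>e > 0\<close> obtain d1 where d1: "d1 > 0" "\<And>y. dist y x < d1 \<Longrightarrow> dist (F u v y) (F u v x) < e/2"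
      unfolding continuous_at_eps_delta by (metis half_gt_zero dist_norm)
    from cont[of v u] \<open>e > 0\<close> obtain d2 where d2: "d2 > 0" "\<And>y. dist y x < d2 \<Longrightarrow> dist (F v u y) (F v u x) < e/2"
      unfolding continuous_at_eps_delta by (metis half_gt_zero dist_norm)
    obtain d3 where d3: "d3 > 0" "ball x d3 \<subseteq> S" using assms(1,2) open_contains_ball by blast
    define d where "d = min d1 (min d2 d3)"
    (* small enough that all points x + a u + b v with 0 <= a, b <= t lie within d of x *)
    define t where "t = d / (2 * (norm u + norm v + 1))"
    have "d > 0" using d1 d2 d3 by (simp add: d_def)
    have npos: "norm u + norm v + 1 > 0" by (simp add: add_nonneg_pos)
    have "t > 0" using \<open>d > 0\<close> npos by (simp add: t_def)
    have near: "dist (x + a *\<^sub>R u + b *\<^sub>R v) x < d"  "dist (x + b *\<^sub>R v + a *\<^sub>R u) x < d" if "0 \<le> a" "a \<le> t" "0 \<le> b" "b \<le> t" for a b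
    proof -
      have "norm (a *\<^sub>R u + b *\<^sub>R v) \<le> a * norm u + b * norm v"
        using that by (metis norm_triangle_ineq norm_scaleR abs_of_nonneg)
      also have "\<dots> \<le> t * norm u + t * norm v"
        using that by (intro add_mono mult_right_mono) auto
      also have "\<dots> \<le> t * (norm u + norm v + 1)" using \<open>t > 0\<close> by (simp add: algebra_simps)
      also have "\<dots> = d / 2" using npos unfolding t_def by (simp add: divide_simps)
      also have "\<dots> < d" using \<open>d > 0\<close> by simp
      finally show "dist (x + a *\<^sub>R u + b *\<^sub>R v) x < d" "dist (x + b *\<^sub>R v + a *\<^sub>R u) x < d"
        by (simp_all add: dist_norm add.assoc add.commute[of "b *\<^sub>R v"])
    qed
    have inS: "y \<in> S" if "dist y x < d" for y
      using that d3 by (auto simp: d_def dist_commute)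
    note diff = smooth_on_differentiable[OF assms(3,1) inS] smooth_on_differentiable[OF sm1 assms(1) inS]
    obtain a b where 1: "0 \<le> a" "a \<le> t" "0 \<le> b" "b \<le> t"
      "f (x + t *\<^sub>R u + t *\<^sub>R v) - f (x + t *\<^sub>R u) - f (x + t *\<^sub>R v) + f x = t * t * F u v (x + a *\<^sub>R u + b *\<^sub>R v)"
      using second_difference_mvt[OF \<open>t > 0\<close> diff(1)[OF near(1)] diff(2)[OF near(1)]]
      unfolding F_def by blast
    obtain a' b' where 2: "0 \<le> a'" "a' \<le> t" "0 \<le> b'" "b' \<le> t"
      "f (x + t *\<^sub>R v + t *\<^sub>R u) - f (x + t *\<^sub>R v) - f (x + t *\<^sub>R u) + f x = t * t * F v u (x + a' *\<^sub>R v + b' *\<^sub>R u)"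
      using second_difference_mvt[OF \<open>t > 0\<close> diff(1)[OF near(2)] diff(2)[OF near(2)]]
      unfolding F_def by blast
    have "t * t * F u v (x + a *\<^sub>R u + b *\<^sub>R v) = t * t * F v u (x + a' *\<^sub>R v + b' *\<^sub>R u)"
    proof -
      have "x + t *\<^sub>R v + t *\<^sub>R u = x + t *\<^sub>R u + t *\<^sub>R v" by (simp add: add.assoc add.commute[of "t *\<^sub>R v"])
      then show ?thesis using 1(5) 2(5) by (simp only:)
    qed
    then have "F u v (x + a *\<^sub>R u + b *\<^sub>R v) = F v u (x + a' *\<^sub>R v + b' *\<^sub>R u)"
      using \<open>t > 0\<close> by simp
    moreover have "dist (F u v (x + a *\<^sub>R u + b *\<^sub>R v)) (F u v x) < e/2"
      using near(1)[OF 1(1-4)] by (intro d1) (simp add: d_def)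
    moreover have "dist (F v u (x + a' *\<^sub>R v + b' *\<^sub>R u)) (F v u x) < e/2"
      using near(2)[OF 2(3,4,1,2)] by (intro d2) (simp add: d_def)
    ultimately show ?thesis by (metis dist_triangle_half_r)
  qed
  then have "F u v x = F v u x"
    by (metis dist_nz less_irrefl)
  then show ?thesis by (simp add: F_def)
qed

lemma pd_commute:
  fixes f :: "real^'n \<Rightarrow> real"
  assumes "open S" "x \<in> S" "smooth_on f S"
  shows "pd i (pd j f) x = pd j (pd i f) x"
  unfolding pd_def[abs_def] using frechet_derivative_commute[OF assms] .

section \<open>Tensor algebra in dimension two\<close>

lemma matrix_inv_unique:
  fixes M N :: "real^'n^'n"
  assumes "M ** N = mat 1"
  shows "matrix_inv M = N"
proof -
  have NM: "N ** M = mat 1" using assms matrix_left_right_inverse by blast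
  have "M ** matrix_inv M = mat 1 \<and> matrix_inv M ** M = mat 1"
    unfolding matrix_inv_def by (rule someI[of _ N]) (use assms NM in auto)
  then show ?thesis
    by (metis NM matrix_mul_assoc matrix_mul_lid matrix_mul_rid)
qed

lemma matrix_inv_2:
  fixes g :: "real^2^2"
  assumes "det g \<noteq> 0"
  shows "matrix_inv g $ 1 $ 1 = g$2$2 / det g" "matrix_inv g $ 1 $ 2 = - g$1$2 / det g"
        "matrix_inv g $ 2 $ 1 = - g$2$1 / det g" "matrix_inv g $ 2 $ 2 = g$1$1 / det g"
proof -
  define N :: "real^2^2" where "N = (\<chi> i j. if i = 1 then (if j = 1 then g$2$2 / det g else - g$1$2 / det g)
      else (if j = 1 then - g$2$1 / det g else g$1$1 / det g))"
  have "g ** N = mat 1"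
    using assms
    by (simp add: vec_eq_iff forall_2 matrix_matrix_mult_def sum_2 N_def mat_def divide_simps)
       (simp add: det_2 algebra_simps)
  from matrix_inv_unique[OF this] show "matrix_inv g $ 1 $ 1 = g$2$2 / det g" "matrix_inv g $ 1 $ 2 = - g$1$2 / det g"
        "matrix_inv g $ 2 $ 1 = - g$2$1 / det g" "matrix_inv g $ 2 $ 2 = g$1$1 / det g"
    by (simp_all add: N_def)
qed

text \<open>In the next three definitions \<open>J\<close> is the Jacobian matrix of a change of coordinates and the
  tensor lives in the target coordinates.\<close>

definition pull1 :: "real^2^2 \<Rightarrow> real^2 \<Rightarrow> real^2" where
  "pull1 J \<alpha> = (\<chi> i. \<Sum>a\<in>UNIV. J$a$i * \<alpha> $ a)"

definition pull2 :: "real^2^2 \<Rightarrow> real^2^2 \<Rightarrow> real^2^2" where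
  "pull2 J T = (\<chi> i j. \<Sum>a\<in>UNIV. \<Sum>b\<in>UNIV. J$a$i * J$b$j * T $ a $ b)"

definition pull3 :: "real^2^2 \<Rightarrow> real^2^2^2 \<Rightarrow> real^2^2^2" where
  "pull3 J T = (\<chi> i j k. \<Sum>a\<in>UNIV. \<Sum>b\<in>UNIV. \<Sum>d\<in>UNIV. J$a$i * J$b$j * J$d$k * T $ a $ b $ d)"

lemma det_pull2: "det (pull2 J g) = (det J)\<^sup>2 * det g"
  by (simp add: det_2 pull2_def sum_2 power2_eq_square algebra_simps)

lemma pull2_matrix: "pull2 J g = transpose J ** g ** J"
  by (simp add: vec_eq_iff pull2_def matrix_matrix_mult_def transpose_def sum_2 forall_2 algebra_simps)

lemma matrix_inv_mult:
  fixes M :: "real^2^2"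
  assumes "det M \<noteq> 0"
  shows "M ** matrix_inv M = mat 1" "matrix_inv M ** M = mat 1"
  using assms matrix_inv_unique[of M] invertible_det_nz[of M] unfolding invertible_def by metis+

lemma matrix_inv_pull2:
  assumes "det J \<noteq> 0" "det g \<noteq> 0"
  shows "J ** matrix_inv (pull2 J g) ** transpose J = matrix_inv g"
proof -
  have d: "det (pull2 J g) \<noteq> 0" using assms by (simp add: det_pull2)
  let ?J' = "matrix_inv J" and ?K = "matrix_inv (transpose J)"
  note one = matrix_inv_mult[OF assms(1)] matrix_inv_mult[OF assms(2)]
    matrix_inv_mult[of "transpose J", unfolded det_transpose, OF assms(1)]
  have "pull2 J g ** (?J' ** matrix_inv g ** ?K) = transpose J ** (g ** (J ** ?J') ** matrix_inv g) ** ?K"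
    by (simp only: pull2_matrix matrix_mul_assoc)
  also have "\<dots> = mat 1" by (simp only: one matrix_mul_rid)
  finally have "matrix_inv (pull2 J g) = ?J' ** matrix_inv g ** ?K" by (rule matrix_inv_unique)
  then have "J ** matrix_inv (pull2 J g) ** transpose J = (J ** ?J') ** matrix_inv g ** (?K ** transpose J)"
    by (simp only: matrix_mul_assoc)
  then show ?thesis by (simp only: one matrix_mul_rid matrix_mul_lid)
qed

text \<open>The inverse metric is a contravariant tensor; every trace below transforms correctly because of this.\<close>

lemma matrix_inv_pull2_nth:
  assumes "det J \<noteq> 0" "det g \<noteq> 0"
  shows "(\<Sum>i\<in>UNIV. \<Sum>j\<in>UNIV. matrix_inv (pull2 J g) $ i $ j * J $ a $ i * J $ b $ j) = matrix_inv g $ a $ b"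
  unfolding matrix_inv_pull2[OF assms, symmetric]
  by (simp add: matrix_matrix_mult_def transpose_def sum_2 algebra_simps)

lemma tr3_pull:
  assumes "det J \<noteq> 0" "det g \<noteq> 0"
  shows "tr3 (pull2 J g) (pull3 J T) = pull1 J (tr3 g T)"
proof -
  have "tr3 (pull2 J g) (pull3 J T) $ k = pull1 J (tr3 g T) $ k" for k
  proof -
    have "tr3 (pull2 J g) (pull3 J T) $ k = (\<Sum>d\<in>UNIV. J$d$k * (\<Sum>a\<in>UNIV. \<Sum>b\<in>UNIV.
        (\<Sum>i\<in>UNIV. \<Sum>j\<in>UNIV. matrix_inv (pull2 J g) $ i $ j * J $ a $ i * J $ b $ j) * T$a$b$d))"
      by (simp add: tr3_def pull3_def sum_2 algebra_simps)
    then show ?thesis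
      unfolding matrix_inv_pull2_nth[OF assms] by (simp add: tr3_def pull1_def)
  qed
  then show ?thesis by (simp add: vec_eq_iff)
qed

lemma Sym_pull: "Sym (pull3 J T) = pull3 J (Sym T)"
  by (simp add: vec_eq_iff forall_2 Sym_def pull3_def sum_2 field_simps)

lemma pull3_diff: "pull3 J (S - T) = pull3 J S - pull3 J T"
  by (simp add: vec_eq_iff pull3_def sum_subtractf right_diff_distrib)

lemma pull3_scale: "pull3 J (r *\<^sub>R T) = r *\<^sub>R pull3 J T"
  by (simp add: vec_eq_iff pull3_def sum_distrib_left mult.left_commute)

lemma Sym0_pull:
  assumes "det J \<noteq> 0" "det g \<noteq> 0"
  shows "Sym0 (pull2 J g) (pull3 J T) = pull3 J (Sym0 g T)"
proof -
  have "(\<chi> i j k. pull2 J g $ i $ j * pull1 J \<alpha> $ k) = pull3 J (\<chi> i j k. g $ i $ j * \<alpha> $ k)" for \<alpha>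
    by (simp add: vec_eq_iff forall_2 pull1_def pull2_def pull3_def sum_2 algebra_simps)
  then show ?thesis
    unfolding Sym0_def Sym_pull tr3_pull[OF assms]
    by (simp add: Sym_pull pull3_diff pull3_scale)
qed

text \<open>This is where the orientation enters: \<open>det J > 0\<close> makes \<open>sqrt (det g)\<close> pick up the factor
  \<open>det J\<close>, so that the area form is a tensor and with it the complex structure.\<close>

lemma cstr_pull:
  assumes "det J > 0" "det g > 0"
  shows "(\<Sum>k\<in>UNIV. J $ m $ k * cstr (pull2 J g) $ k $ i) = (\<Sum>a\<in>UNIV. J$a$i * cstr g $ m $ a)"
proof -
  have "sqrt (det (pull2 J g)) = det J * sqrt (det g)"
    using assms by (simp add: det_pull2 real_sqrt_mult)
  then have ar: "area_form (pull2 J g) = pull2 J (area_form g)"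
    by (simp add: vec_eq_iff forall_2 area_form_def pull2_def sum_2 det_2 algebra_simps)
  have "(\<Sum>k\<in>UNIV. J $ m $ k * cstr (pull2 J g) $ k $ i) =
     (\<Sum>a\<in>UNIV. J$a$i * (\<Sum>b\<in>UNIV. area_form g $ a $ b *
        (\<Sum>n\<in>UNIV. \<Sum>k\<in>UNIV. matrix_inv (pull2 J g) $ n $ k * J $ b $ n * J $ m $ k)))"
    unfolding cstr_def ar by (simp add: pull2_def sum_2 algebra_simps)
  then show ?thesis
    using assms by (simp add: matrix_inv_pull2_nth cstr_def)
qed

text \<open>Gram matrices of inner products on the tangent plane.\<close>

definition inner_product :: "real^2^2 \<Rightarrow> bool" where
  "inner_product g \<longleftrightarrow> transpose g = g \<and> (\<forall>v. v \<noteq> 0 \<longrightarrow> v \<bullet> (g *v v) > 0)"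

lemma inner_productD:
  assumes "inner_product g"
  shows "g$2$1 = g$1$2" "g$1$1 > 0" "g$2$2 > 0" "det g > 0"
proof -
  have tr: "transpose g = g" and pos: "\<And>v. v \<noteq> 0 \<Longrightarrow> v \<bullet> (g *v v) > 0"
    using assms by (auto simp: inner_product_def)
  show sym: "g$2$1 = g$1$2" using arg_cong[OF tr, of "\<lambda>M. M$1$2"] by (simp add: transpose_def)
  have q: "v \<bullet> (g *v v) = g$1$1 * (v$1)\<^sup>2 + 2 * g$1$2 * v$1 * v$2 + g$2$2 * (v$2)\<^sup>2" for v
    by (simp add: inner_vec_def matrix_vector_mult_def sum_2 sym power2_eq_square algebra_simps)
  have "(axis i 1 :: real^2) \<noteq> 0" for i by simp
  note ax = pos[OF this]
  show g1: "g$1$1 > 0" using ax[of 1] unfolding q by (simp add: axis_def)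
  show "g$2$2 > 0" using ax[of 2] unfolding q by (simp add: axis_def)
  (* the quadratic form takes the value g11 det g on this vector *)
  let ?v = "vector [- g$1$2, g$1$1] :: real^2"
  have "?v \<noteq> 0" using g1 by (auto simp: vec_eq_iff forall_2)
  then have "0 < g$1$1 * det g"
    using pos[of ?v] q[of ?v] by (simp add: det_2 sym power2_eq_square algebra_simps)
  then show "det g > 0" using g1 zero_less_mult_pos by blast
qed

definition symmetric3 :: "real^2^2^2 \<Rightarrow> bool" where
  "symmetric3 P \<longleftrightarrow> (\<forall>i j k. P$i$j$k = P$j$i$k \<and> P$i$j$k = P$i$k$j)"

lemma symmetric3_eqs:
  assumes "symmetric3 P"
  shows "P$1$2$1 = P$1$1$2" "P$2$1$1 = P$1$1$2" "P$2$1$2 = P$1$2$2" "P$2$2$1 = P$1$2$2"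
  using assms unfolding symmetric3_def by metis+

lemma symmetric3_Sym: "symmetric3 (Sym T)"
  by (simp add: symmetric3_def Sym_def add_ac)

lemma symmetric3_Sym0: "symmetric3 (Sym0 g T)"
  using symmetric3_Sym unfolding symmetric3_def Sym0_def by simp

lemma symmetric3_scale: "symmetric3 T \<Longrightarrow> symmetric3 (r *\<^sub>R T)"
  by (simp add: symmetric3_def)

text \<open>Clearing the denominator of the inverse metric keeps later computations polynomial.\<close>

lemma tr3_symmetric3:
  assumes "inner_product g" "symmetric3 P"
  shows "det g * tr3 g P $ k = g$2$2 * P$1$1$k - 2 * g$1$2 * P$1$2$k + g$1$1 * P$2$2$k"
proof -
  have "P$2$1$k = P$1$2$k" using assms(2) by (simp add: symmetric3_def)
  then show ?thesis
    using inner_productD[OF assms(1)]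
    by (simp add: tr3_def sum_2 matrix_inv_2 field_simps)
qed

lemma tr3_Sym_metric:
  assumes "inner_product g"
  shows "tr3 g (Sym (\<chi> i j k. g$i$j * \<alpha>$k)) = (4/3) *\<^sub>R \<alpha>"
proof -
  note D = inner_productD[OF assms]
  have "\<forall>k. det g * tr3 g (Sym (\<chi> i j k. g$i$j * \<alpha>$k)) $ k = det g * (4/3 * \<alpha> $ k)"
    unfolding tr3_symmetric3[OF assms symmetric3_Sym] forall_2 
    by (simp add: Sym_def det_2 D(1) field_simps)
  then show ?thesis using D by (simp add: vec_eq_iff)
qed

lemma tr3_Sym0:
  assumes "inner_product g"
  shows "tr3 g (Sym0 g T) = 0"
proof -
  have "tr3 g (S - r *\<^sub>R T) = tr3 g S - r *\<^sub>R tr3 g T" for r S T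
    by (simp add: tr3_def vec_eq_iff sum_2 algebra_simps)
  then show ?thesis
    unfolding Sym0_def using tr3_Sym_metric[OF assms] by simp
qed

subsection \<open>Cubic forms\<close>

lemma cstr_2:
  assumes "inner_product g"
  shows "cstr g $ 1 $ 1 = - g$1$2 / sqrt (det g)" "cstr g $ 2 $ 1 = g$1$1 / sqrt (det g)"
        "cstr g $ 1 $ 2 = - g$2$2 / sqrt (det g)" "cstr g $ 2 $ 2 = g$1$2 / sqrt (det g)"
proof -
  note D = inner_productD[OF assms]
  have s: "sqrt (det g) * a / det g = a / sqrt (det g)" for a
    using D(4) by (metis less_imp_le mult.commute real_div_sqrt divide_divide_eq_right times_divide_eq_left)
  show "cstr g $ 1 $ 1 = - g$1$2 / sqrt (det g)" "cstr g $ 2 $ 1 = g$1$1 / sqrt (det g)"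
        "cstr g $ 1 $ 2 = - g$2$2 / sqrt (det g)" "cstr g $ 2 $ 2 = g$1$2 / sqrt (det g)"
    using D s[of "g$1$1"] s[of "g$1$2"] s[of "g$2$2"] by (simp_all add: cstr_def area_form_def sum_2 matrix_inv_2)
qed

text \<open>\<open>C(X,Y,Z) = P(X,Y,Z) - \<i> P(JX,Y,Z)\<close> is the cubic differential whose real part is the trace-free
  cubic form \<open>P\<close>.\<close>

definition cubic_of :: "real^2^2 \<Rightarrow> real^2^2^2 \<Rightarrow> complex^2^2^2" where
  "cubic_of g P = (\<chi> i j k. complex_of_real (P$i$j$k) - \<i> * complex_of_real (\<Sum>m\<in>UNIV. cstr g $ m $ i * P$m$j$k))"

lemma cstr_square:
  assumes "inner_product g"
  shows "(\<Sum>m\<in>UNIV. cstr g $ k $ m * cstr g $ m $ i) = (if k = i then -1 else 0)"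
proof -
  note D = inner_productD[OF assms]
  have "sqrt (det g) * sqrt (det g) = g$1$1 * g$2$2 - g$1$2 * g$1$2" "sqrt (det g) > 0"
    using D by (simp_all add: det_2)
  then have "\<forall>k i. (\<Sum>m\<in>UNIV. cstr g $ k $ m * cstr g $ m $ i) = (if k = i then -1 else 0)"
    unfolding forall_2 by (simp add: sum_2 cstr_2[OF assms] field_simps)
  then show ?thesis by blast
qed

text \<open>Trace-freeness says \<open>P(e\<^sub>1,e\<^sub>1,\<cdot>) = - P(e\<^sub>2,e\<^sub>2,\<cdot>)\<close> in an orthonormal frame, which is
  \<open>P(e\<^sub>1,Je\<^sub>2,\<cdot>) = P(Je\<^sub>1,e\<^sub>2,\<cdot>)\<close>; hence the rotation \<open>J\<close> may be moved from one argument to another.\<close>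

lemma cstr_slot:
  assumes "inner_product g" "symmetric3 P" "tr3 g P = 0"
  shows "(\<Sum>m\<in>UNIV. cstr g $ m $ j * P$i$m$k) = (\<Sum>m\<in>UNIV. cstr g $ m $ i * P$m$j$k)"
proof -
  note D = inner_productD[OF assms(1)]
  have "g$2$2 * P$1$1$k - 2 * g$1$2 * P$1$2$k + g$1$1 * P$2$2$k = 0" for k
    using tr3_symmetric3[OF assms(1,2)] assms(3) by simp
  from this[of 1] this[of 2]
  have "\<forall>i j k. (\<Sum>m\<in>UNIV. cstr g $ m $ j * P$i$m$k) = (\<Sum>m\<in>UNIV. cstr g $ m $ i * P$m$j$k)"
    using D unfolding forall_2 
    by (simp add: sum_2 cstr_2[OF assms(1)] symmetric3_eqs[OF assms(2)] field_simps)
  then show ?thesis by blast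
qed

lemma type30_cubic_of:
  assumes "inner_product g" "symmetric3 P" "tr3 g P = 0"
  shows "type30 g (cubic_of g P)"
proof -
  define Q where "Q i j k = (\<Sum>m\<in>UNIV. cstr g $ m $ i * P$m$j$k)" for i j k
  have Qsym: "Q i j k = Q j i k" "Q i j k = Q i k j" for i j k
  proof -
    show "Q i j k = Q i k j" using assms(2) by (simp add: Q_def symmetric3_def)
    have "(\<Sum>m\<in>UNIV. cstr g $ m $ j * P$i$m$k) = (\<Sum>m\<in>UNIV. cstr g $ m $ j * P$m$i$k)"
      using assms(2) by (intro sum.cong refl) (metis symmetric3_def)
    then show "Q i j k = Q j i k" using cstr_slot[OF assms, of j i k] by (simp add: Q_def)
  qed
  have JQ: "(\<Sum>m\<in>UNIV. cstr g $ m $ i * Q m j k) = - P$i$j$k" for i j k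
  proof -
    have "(\<Sum>m\<in>UNIV. cstr g $ m $ i * Q m j k) = (\<Sum>n\<in>UNIV. (\<Sum>m\<in>UNIV. cstr g $ n $ m * cstr g $ m $ i) * P$n$j$k)"
      by (simp add: Q_def sum_2 algebra_simps)
    then show ?thesis unfolding cstr_square[OF assms(1)] by (simp add: if_distrib if_distribR sum.delta cong: if_cong)
  qed
  have C: "cubic_of g P $ i $ j $ k = complex_of_real (P$i$j$k) - \<i> * complex_of_real (Q i j k)" for i j k
    by (simp add: cubic_of_def Q_def)
  have first: "(\<Sum>m\<in>UNIV. cstr g $ m $ i * cubic_of g P $ m $ j $ k) = \<i> * cubic_of g P $ i $ j $ k" for i j k
  proof -
    have "(\<Sum>m\<in>UNIV. cstr g $ m $ i * cubic_of g P $ m $ j $ k) =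
       complex_of_real (\<Sum>m\<in>UNIV. cstr g $ m $ i * P$m$j$k) - \<i> * complex_of_real (\<Sum>m\<in>UNIV. cstr g $ m $ i * Q m j k)"
      unfolding C by (simp add: sum_2 algebra_simps)
    also have "\<dots> = \<i> * cubic_of g P $ i $ j $ k"
      unfolding JQ C Q_def[symmetric] by (simp add: algebra_simps)
    finally show ?thesis .
  qed
  have sy: "cubic_of g P $ i $ j $ k = cubic_of g P $ j $ i $ k" "cubic_of g P $ i $ j $ k = cubic_of g P $ k $ j $ i" for i j k
    unfolding C using Qsym assms(2) unfolding symmetric3_def by metis+
  show ?thesis
    unfolding type30_def using first sy by (metis (no_types, lifting) sum.cong)
qed

lemma Re_cubic_of: "Re (cubic_of g P $ i $ j $ k) = P $ i $ j $ k"
  by (simp add: cubic_of_def)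

lemma cubic_of_pull:
  assumes "det J > 0" "det g > 0"
  shows "cubic_of (pull2 J g) (pull3 J P) $ i $ j $ k =
    (\<Sum>a\<in>UNIV. \<Sum>b\<in>UNIV. \<Sum>d\<in>UNIV. complex_of_real (J$a$i * J$b$j * J$d$k) * cubic_of g P $ a $ b $ d)"
proof -
  have "(\<Sum>m\<in>UNIV. cstr (pull2 J g) $ m $ i * pull3 J P $ m $ j $ k) =
     (\<Sum>a\<in>UNIV. \<Sum>b\<in>UNIV. \<Sum>d\<in>UNIV. (\<Sum>m\<in>UNIV. J $ a $ m * cstr (pull2 J g) $ m $ i) * J$b$j * J$d$k * P$a$b$d)"
    by (simp add: pull3_def sum_2 algebra_simps)
  also have "\<dots> = (\<Sum>a\<in>UNIV. \<Sum>b\<in>UNIV. \<Sum>d\<in>UNIV. J$a$i * J$b$j * J$d$k * (\<Sum>m\<in>UNIV. cstr g $ m $ a * P$m$b$d))"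
    unfolding cstr_pull[OF assms] by (simp add: sum_2 algebra_simps)
  finally have 1: "(\<Sum>m\<in>UNIV. cstr (pull2 J g) $ m $ i * pull3 J P $ m $ j $ k) =
    (\<Sum>a\<in>UNIV. \<Sum>b\<in>UNIV. \<Sum>d\<in>UNIV. J$a$i * J$b$j * J$d$k * (\<Sum>m\<in>UNIV. cstr g $ m $ a * P$m$b$d))" .
  show ?thesis
    unfolding cubic_of_def vec_lambda_beta 1
    by (simp add: pull3_def sum_2 algebra_simps)
qed

text \<open>A (1,0)-covector is a multiple of \<open>(1, \<mu>)\<close>, since evaluating it on \<open>J\<partial>\<^sub>1\<close> expresses its second
  component by the first one.  So a cubic differential is known from its first component.\<close>

lemma type30_eqs:
  assumes "inner_product g" "type30 g C"
  defines "\<mu> \<equiv> Complex (g$1$2 / g$1$1) (sqrt (det g) / g$1$1)"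
  shows "C $ i $ j $ k = C $ 1 $ 1 $ 1 * cube (\<chi> i. if i = 1 then 1 else \<mu>) $ i $ j $ k"
proof -
  note D = inner_productD[OF assms(1)]
  have W: "sqrt (det g) > 0" using D by simp
  have key: "b = \<mu> * a" if "cstr g $ 1 $ 1 * a + cstr g $ 2 $ 1 * b = \<i> * a" for a b :: complex
    using that W D unfolding cstr_2[OF assms(1)] \<mu>_def
    by (simp add: complex_eq_iff field_simps)
  have "C$2$j$k = \<mu> * C$1$j$k" "C$i$2$k = \<mu> * C$i$1$k" "C$i$j$2 = \<mu> * C$i$j$1" for i j k
    using assms(2) unfolding type30_def by (auto intro!: key simp: sum_2)
  then have "\<forall>i j k. C $ i $ j $ k = C $ 1 $ 1 $ 1 * cube (\<chi> i. if i = 1 then 1 else \<mu>) $ i $ j $ k"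
    unfolding forall_2 by (simp add: cube_def)
  then show ?thesis by blast
qed

text \<open>The matrix \<open>M\<close> with rows \<open>w1\<close>, \<open>w2\<close> satisfies \<open>M g\<^sup>-\<^sup>1 M\<^sup>T = 1\<close>, and a one-sided inverse of a
  square matrix is two-sided.\<close>

lemma coframe_metric:
  assumes "inner_product g" "oriented_orthonormal_coframe g w1 w2"
  shows "g $ i $ j = w1 $ i * w1 $ j + w2 $ i * w2 $ j"
proof -
  note D = inner_productD[OF assms(1)]
  define M :: "real^2^2" where "M = (\<chi> i. if i = 1 then w1 else w2)"
  have M: "M$1 = w1" "M$2 = w2" by (simp_all add: M_def)
  let ?h = "matrix_inv g"
  have o: "w1 \<bullet> (?h *v w1) = 1" "w2 \<bullet> (?h *v w2) = 1" "w1 \<bullet> (?h *v w2) = 0"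
    using assms(2) by (auto simp: oriented_orthonormal_coframe_def)
  have "?h$1$2 = ?h$2$1" using D by (simp add: matrix_inv_2)
  then have "w2 \<bullet> (?h *v w1) = 0"
    using o(3) by (simp add: inner_vec_def matrix_vector_mult_def sum_2 algebra_simps)
  with o have "M ** (?h ** transpose M) = mat 1"
    by (simp add: vec_eq_iff forall_2 mat_def matrix_matrix_mult_def transpose_def sum_2 M
        inner_vec_def matrix_vector_mult_def algebra_simps)
  then have "?h ** transpose M ** M = mat 1"
    using matrix_left_right_inverse[of M "?h ** transpose M"] by simp
  then have "g ** ?h ** (transpose M ** M) = g"
    by (metis matrix_mul_assoc matrix_mul_rid)
  then have "transpose M ** M = g" using D by (simp add: matrix_inv_mult)
  then have "g $ i $ j = (transpose M ** M) $ i $ j" by simp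
  then show ?thesis by (simp add: matrix_matrix_mult_def transpose_def sum_2 M)
qed

text \<open>Whatever the coframe, \<open>|(\<omega>\<^sub>1 + \<i> \<omega>\<^sub>2)(\<partial>\<^sub>1)|\<^sup>2 = g\<^sub>1\<^sub>1\<close>.  Comparing first components of
  \<open>C = c (\<omega>\<^sub>1 + \<i> \<omega>\<^sub>2)\<^sup>3\<close> therefore determines \<open>|c|\<close>.\<close>

lemma cubic_norm_sq_eq:
  assumes "inner_product g" "type30 g C"
  shows "cubic_norm_sq g C = (cmod (C$1$1$1))\<^sup>2 / (g$1$1)^3"
proof -
  note D = inner_productD[OF assms(1)]
  define E F W where "E = g$1$1" "F = g$1$2" "W = sqrt (det g)"
  have pos: "E > 0" "W > 0" using D by (simp_all add: E_F_W_def)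
  have WW: "W * W = E * g$2$2 - F * F" using D by (simp add: E_F_W_def det_2)
  (* w2 vanishes on the first coordinate vector: the Cholesky factorisation of g *)
  define w1 :: "real^2" where "w1 = vector [sqrt E, F / sqrt E]"
  define w2 :: "real^2" where "w2 = vector [0, W / sqrt E]"
  have sE: "sqrt E * sqrt E = E" "sqrt E > 0" using pos by auto
  have detg: "det g = W * W" using D by (simp add: E_F_W_def)
  have G: "g$2$2 = (W * W + F * F) / E" using WW pos by (simp add: field_simps)
  have frame: "oriented_orthonormal_coframe g w1 w2"
    unfolding oriented_orthonormal_coframe_def inner_vec_def matrix_vector_mult_def w1_def w2_def
    using pos sE D(1)
    by (simp add: sum_2 matrix_inv_2 D(4)[THEN less_imp_neq, THEN not_sym] detg G E_F_W_def(1,2)[symmetric])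
       (simp add: field_simps)
  have ex: "C = (\<chi> i j k. (C$1$1$1 / (complex_of_real (sqrt E))^3) * cube (\<chi> i. Complex (w1 $ i) (w2 $ i)) $ i $ j $ k)"
  proof -
    have "Complex (w1 $ i) (w2 $ i) = complex_of_real (sqrt E) * (if i = 1 then 1 else Complex (g$1$2 / g$1$1) (sqrt (det g) / g$1$1))" for i
      using pos sE exhaust_2[of i] unfolding E_F_W_def(1,2,3)[symmetric] w1_def w2_def
      by (auto simp: complex_eq_iff field_simps)
    then have "C$i$j$k = (C$1$1$1 / (complex_of_real (sqrt E))^3) * cube (\<chi> i. Complex (w1 $ i) (w2 $ i)) $ i $ j $ k" for i j k
      unfolding type30_eqs[OF assms, of i j k] cube_def vec_lambda_beta
      using pos by (simp add: power3_eq_cube)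
    then show ?thesis unfolding vec_eq_iff vec_lambda_beta by blast
  qed
  have uniq: "r = (cmod (C$1$1$1))\<^sup>2 / (g$1$1)^3"
    if fr: "oriented_orthonormal_coframe g w1 w2"
      and C: "C = (\<chi> i j k. c * cube (\<chi> i. Complex (w1 $ i) (w2 $ i)) $ i $ j $ k)" and r: "r = (cmod c)\<^sup>2" for r w1 w2 c
  proof -
    have "C$1$1$1 = c * Complex (w1$1) (w2$1) ^ 3"
      by (subst C) (simp add: cube_def power3_eq_cube)
    then have "(cmod (C$1$1$1))\<^sup>2 = (cmod c)\<^sup>2 * ((cmod (Complex (w1$1) (w2$1)))\<^sup>2)^3"
      by (simp add: norm_mult norm_power power_mult_distrib power2_eq_square power3_eq_cube algebra_simps)
    also have "(cmod (Complex (w1$1) (w2$1)))\<^sup>2 = g$1$1"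
      using coframe_metric[OF assms(1) fr, of 1 1] by (simp only: cmod_power2) (simp add: power2_eq_square)
    finally show ?thesis using D r by simp
  qed
  show ?thesis
    unfolding cubic_norm_sq_def
  proof (rule the_equality)
    define c where "c = C$1$1$1 / (complex_of_real (sqrt E))^3"
    have "C = (\<chi> i j k. c * cube (\<chi> i. Complex (w1 $ i) (w2 $ i)) $ i $ j $ k)" using ex unfolding c_def .
    note C = this
    show "\<exists>w1 w2 c. oriented_orthonormal_coframe g w1 w2 \<and>
       C = (\<chi> i j k. c * cube (\<chi> i. Complex (w1 $ i) (w2 $ i)) $ i $ j $ k) \<and>
       (cmod (C$1$1$1))\<^sup>2 / (g$1$1)^3 = (cmod c)\<^sup>2"
      by (intro exI[of _ w1] exI[of _ w2] exI[of _ c] conjI frame C uniq[OF frame C refl, symmetric])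
  qed (use uniq in blast)
qed

subsection \<open>Contractions\<close>

definition raise3 :: "real^2^2 \<Rightarrow> real^2^2^2 \<Rightarrow> real^2^2^2" where
  "raise3 g P = (\<chi> l i j. \<Sum>p\<in>UNIV. matrix_inv g $ l $ p * P $ p $ i $ j)"

definition raise1 :: "real^2^2 \<Rightarrow> real^2 \<Rightarrow> real^2" where
  "raise1 g \<beta> = (\<chi> l. \<Sum>p\<in>UNIV. matrix_inv g $ l $ p * \<beta> $ p)"

lemma metric_inverse:
  assumes "inner_product g"
  shows "(\<Sum>l\<in>UNIV. g$k$l * matrix_inv g $ l $ p) = (if k = p then 1 else 0)"
    "(\<Sum>l\<in>UNIV. matrix_inv g $ k $ l * g$l$p) = (if k = p then 1 else 0)"
    "matrix_inv g $ k $ p = matrix_inv g $ p $ k" "g $ k $ p = g $ p $ k"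
proof -
  note D = inner_productD[OF assms]
  have "det g \<noteq> 0" using D by simp
  note I = matrix_inv_mult[OF this]
  show "(\<Sum>l\<in>UNIV. g$k$l * matrix_inv g $ l $ p) = (if k = p then 1 else 0)"
    using arg_cong[OF I(1), of "\<lambda>M. M$k$p"] by (simp add: matrix_matrix_mult_def mat_def)
  show "(\<Sum>l\<in>UNIV. matrix_inv g $ k $ l * g$l$p) = (if k = p then 1 else 0)"
    using arg_cong[OF I(2), of "\<lambda>M. M$k$p"] by (simp add: matrix_matrix_mult_def mat_def)
  show "matrix_inv g $ k $ p = matrix_inv g $ p $ k" "g $ k $ p = g $ p $ k"
    using exhaust_2[of k] exhaust_2[of p] D by (auto simp: matrix_inv_2)
qed

lemma lower_raise3:
  assumes "inner_product g"
  shows "(\<Sum>l\<in>UNIV. g$k$l * raise3 g P $ l $ i $ j) = P $ k $ i $ j"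
proof -
  have "(\<Sum>l\<in>UNIV. g$k$l * raise3 g P $ l $ i $ j) = (\<Sum>p\<in>UNIV. (\<Sum>l\<in>UNIV. g$k$l * matrix_inv g $ l $ p) * P $ p $ i $ j)"
    by (simp add: raise3_def sum_2 algebra_simps)
  then show ?thesis
    unfolding metric_inverse(1)[OF assms] by (simp add: if_distrib if_distribR cong: if_cong)
qed

lemma lower_raise1:
  assumes "inner_product g"
  shows "(\<Sum>l\<in>UNIV. g$k$l * raise1 g \<beta> $ l) = \<beta> $ k"
proof -
  have "(\<Sum>l\<in>UNIV. g$k$l * raise1 g \<beta> $ l) = (\<Sum>p\<in>UNIV. (\<Sum>l\<in>UNIV. g$k$l * matrix_inv g $ l $ p) * \<beta> $ p)"
    by (simp add: raise1_def sum_2 algebra_simps)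
  then show ?thesis
    unfolding metric_inverse(1)[OF assms] by (simp add: if_distrib if_distribR cong: if_cong)
qed

lemma raise3_trace:
  assumes "inner_product g" "symmetric3 P" "tr3 g P = 0"
  shows "(\<Sum>k\<in>UNIV. raise3 g P $ k $ k $ j) = 0"
proof -
  have "(\<Sum>k\<in>UNIV. raise3 g P $ k $ k $ j) = tr3 g P $ j"
    using metric_inverse(3)[OF assms(1), of 2 1] assms(2)
    by (simp add: raise3_def tr3_def sum_2 symmetric3_eqs algebra_simps)
  then show ?thesis using assms(3) by simp
qed

text \<open>The endomorphisms \<open>P\<^sub>i = (P\<^sup>k\<^sub>i\<^sub>m)\<close> are symmetric and trace-free for \<open>g\<close>; in an orthonormal frame
  they are \<open>(a, b; b, -a)\<close> and \<open>(b, -a; -a, -b)\<close>, which are orthogonal of squared length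
  \<open>2 (a\<^sup>2 + b\<^sup>2)\<close>.  The proof is the same computation in arbitrary coordinates.\<close>

lemma raise3_quadratic:
  assumes "inner_product g" "symmetric3 P" "tr3 g P = 0"
  shows "(\<Sum>k\<in>UNIV. \<Sum>m\<in>UNIV. raise3 g P $ k $ i $ m * raise3 g P $ m $ k $ j) =
     2 * cubic_norm_sq g (cubic_of g P) * g $ i $ j"
proof -
  note D = inner_productD[OF assms(1)]
  define E F G where "E = g$1$1" "F = g$1$2" "G = g$2$2"
  define x y z t where "x = raise3 g P $ 1 $ 1 $ 1" "y = raise3 g P $ 1 $ 1 $ 2"
    "z = raise3 g P $ 2 $ 1 $ 1" "t = raise3 g P $ 1 $ 2 $ 2"
  have g: "g$1$1 = E" "g$1$2 = F" "g$2$1 = F" "g$2$2 = G" using D by (simp_all add: E_F_G_def)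
  have sy: "raise3 g P $ l $ 2 $ 1 = raise3 g P $ l $ 1 $ 2" for l
    using assms(2) by (simp add: raise3_def sum_2 symmetric3_eqs)
  have tr: "raise3 g P $ 2 $ 1 $ 2 = - x" "raise3 g P $ 2 $ 2 $ 2 = - y"
    using raise3_trace[OF assms, of 1] raise3_trace[OF assms, of 2] sy
    by (simp_all add: sum_2 x_y_z_t_def)
  have M: "raise3 g P $ 1 $ 1 $ 1 = x" "raise3 g P $ 1 $ 1 $ 2 = y" "raise3 g P $ 1 $ 2 $ 1 = y"
    "raise3 g P $ 1 $ 2 $ 2 = t" "raise3 g P $ 2 $ 1 $ 1 = z" "raise3 g P $ 2 $ 1 $ 2 = - x"
    "raise3 g P $ 2 $ 2 $ 1 = - x" "raise3 g P $ 2 $ 2 $ 2 = - y"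
    using sy[of 1] sy[of 2] tr by (simp_all add: x_y_z_t_def)
  have P: "P$1$1$1 = E * x + F * z" "P$1$1$2 = E * y - F * x" "P$2$1$1 = F * x + G * z"
     "P$1$2$2 = E * t - F * y" "P$2$1$2 = F * y - G * x"
    using lower_raise3[OF assms(1), of 1 P 1 1] lower_raise3[OF assms(1), of 1 P 1 2] lower_raise3[OF assms(1), of 2 P 1 1]
      lower_raise3[OF assms(1), of 1 P 2 2] lower_raise3[OF assms(1), of 2 P 1 2]
    by (simp_all add: sum_2 g M)
  (* symmetry of the lowered tensor in its first two indices *)
  have c1: "G * z = E * y - 2 * F * x" and c2: "E * t = 2 * F * y - G * x"
    using P symmetric3_eqs[OF assms(2)] by simp_all
  have pos: "E > 0" "E * G - F * F > 0" using D g by (simp_all add: det_2)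
  define N where "N = cubic_norm_sq g (cubic_of g P)"
  have W: "sqrt (det g) * sqrt (det g) = E * G - F * F" "sqrt (det g) > 0" using D g by (simp_all add: det_2)
  have "cubic_of g P $ 1 $ 1 $ 1 = Complex (P$1$1$1) (- (E * P$1$1$2 - F * P$1$1$1) / sqrt (det g))"
    using symmetric3_eqs[OF assms(2)]
    by (simp add: cubic_of_def sum_2 cstr_2[OF assms(1)] complex_eq_iff g diff_divide_distrib)
  moreover have "E * P$1$1$2 - F * P$1$1$1 = (E * G - F * F) * z"
  proof -
    have "E * P$1$1$2 - F * P$1$1$1 = E * (E * y - 2 * F * x) - F * F * z" unfolding P by (simp add: algebra_simps)
    then show ?thesis unfolding c1[symmetric] by (simp add: algebra_simps)
  qed
  ultimately have "(cmod (cubic_of g P $ 1 $ 1 $ 1))\<^sup>2 = (E * x + F * z)\<^sup>2 + ((E * G - F * F) * z)\<^sup>2 / (E * G - F * F)"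
    using W by (simp only: cmod_power2) (simp add: power2_eq_square P(1))
  also have "\<dots> = (E * x + F * z)\<^sup>2 + (E * G - F * F) * z\<^sup>2"
    using pos by (simp add: power2_eq_square)
  also have "\<dots> = E * (E * x\<^sup>2 + 2 * F * x * z + z * (G * z))"
    by (simp add: power2_eq_square algebra_simps)
  also have "\<dots> = E * E * (x\<^sup>2 + y * z)"
    unfolding c1 by (simp add: power2_eq_square algebra_simps)
  finally have N: "N * E = x\<^sup>2 + y * z"
    using pos unfolding N_def cubic_norm_sq_eq[OF assms(1) type30_cubic_of[OF assms]] g
    by (simp add: power3_eq_cube)
  have "E * (x * y + z * t) = E * x * y + z * (E * t)" by (simp add: algebra_simps)
  also have "\<dots> = 2 * F * y * z + x * (E * y) - x * (G * z)" unfolding c2 by (simp add: algebra_simps)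
  also have "\<dots> = 2 * F * (x\<^sup>2 + y * z)" unfolding c1 by (simp add: power2_eq_square algebra_simps)
  also have "\<dots> = E * (2 * N * F)" unfolding N[symmetric] by simp
  finally have "E * (x * y + z * t) = E * (2 * N * F)" .
  then have q12: "x * y + z * t = 2 * N * F" using pos by simp
  have "E * (2 * (y\<^sup>2 - x * t)) = 2 * E * y\<^sup>2 - 2 * x * (E * t)" by (simp add: algebra_simps)
  also have "\<dots> = 2 * (y * (E * y - 2 * F * x) + G * x\<^sup>2)" unfolding c2 by (simp add: power2_eq_square algebra_simps)
  also have "\<dots> = 2 * G * (x\<^sup>2 + y * z)" unfolding c1[symmetric] by (simp add: power2_eq_square algebra_simps)
  finally have "E * (2 * (y\<^sup>2 - x * t)) = E * (2 * N * G)" unfolding N[symmetric] by (simp add: algebra_simps)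
  then have q22: "2 * (y\<^sup>2 - x * t) = 2 * N * G" using pos by simp
  have "\<forall>i j. (\<Sum>k\<in>UNIV. \<Sum>m\<in>UNIV. raise3 g P $ k $ i $ m * raise3 g P $ m $ k $ j) = 2 * N * g $ i $ j"
    unfolding forall_2 using N q12 q22 by (simp add: sum_2 M g power2_eq_square algebra_simps)
  then show ?thesis by (simp add: N_def)
qed

text \<open>The tensor \<open>A\<close> in \<open>\<nabla> = D + A\<close>, where \<open>D\<close> is the Levi-Civita connection of \<open>g\<close>, for a minimal
  Lagrangian connection \<open>\<nabla>\<close> with invariants \<open>\<beta>\<close> and \<open>P\<close>.  Up to the last summand it is the
  difference tensor of a Weyl connection for the conformal class of \<open>g\<close>.\<close>

definition difference_tensor :: "real \<Rightarrow> real^2^2 \<Rightarrow> real^2 \<Rightarrow> real^2^2^2 \<Rightarrow> real^2^2^2" where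
  "difference_tensor s g \<beta> P = (\<chi> l i j. g$i$j * raise1 g \<beta> $ l - (if l = i then \<beta>$j else 0) - (if l = j then \<beta>$i else 0)
      + s * raise3 g P $ l $ i $ j)"

lemma difference_tensor_trace:
  assumes "inner_product g" "symmetric3 P" "tr3 g P = 0"
  shows "(\<Sum>k\<in>UNIV. difference_tensor s g \<beta> P $ k $ k $ j) = - 2 * \<beta> $ j"
proof -
  have "(\<Sum>k\<in>UNIV. difference_tensor s g \<beta> P $ k $ k $ j) =
      (\<Sum>k\<in>UNIV. g$j$k * raise1 g \<beta> $ k) - 3 * \<beta> $ j + s * (\<Sum>k\<in>UNIV. raise3 g P $ k $ k $ j)"
    using exhaust_2[of j] by (auto simp: difference_tensor_def sum_2 algebra_simps metric_inverse(4)[OF assms(1), of 2 1])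
  then show ?thesis unfolding lower_raise1[OF assms(1)] raise3_trace[OF assms] by simp
qed

text \<open>Both products contribute the same multiple \<open>4 \<beta>\<^sub>i \<beta>\<^sub>j - 2 |\<beta>|\<^sup>2 g\<^sub>i\<^sub>j\<close>, which cancels.  In the second
  product the terms mixing \<open>\<beta>\<close> and \<open>P\<close> vanish because \<open>P\<close> is symmetric and trace-free.\<close>

lemma difference_tensor_quadratic:
  assumes "inner_product g" "symmetric3 P" "tr3 g P = 0" "s * s = 1"
  shows "(\<Sum>k\<in>UNIV. \<Sum>m\<in>UNIV. difference_tensor s g \<beta> P $ k $ k $ m * difference_tensor s g \<beta> P $ m $ i $ j
       - difference_tensor s g \<beta> P $ k $ i $ m * difference_tensor s g \<beta> P $ m $ k $ j) =
     - 2 * cubic_norm_sq g (cubic_of g P) * g $ i $ j - 2 * s * (\<Sum>m\<in>UNIV. raise1 g \<beta> $ m * P $ m $ i $ j)"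
proof -
  define A where "A = difference_tensor s g \<beta> P"
  define M where "M = raise3 g P"
  define u where "u = raise1 g \<beta>"
  have A: "A $ l $ i $ j = g$i$j * u $ l - (if l = i then \<beta>$j else 0) - (if l = j then \<beta>$i else 0) + s * M $ l $ i $ j" for l i j
    by (simp add: A_def difference_tensor_def M_def u_def)
  have b: "\<beta> $ k = (\<Sum>l\<in>UNIV. g$k$l * u $ l)" for k using lower_raise1[OF assms(1)] by (simp add: u_def)
  have P: "P $ k $ i $ j = (\<Sum>l\<in>UNIV. g$k$l * M $ l $ i $ j)" for k i j using lower_raise3[OF assms(1)] by (simp add: M_def)
  have Pu: "(\<Sum>m\<in>UNIV. u$m * P$m$i$j) = (\<Sum>m\<in>UNIV. \<beta>$m * M$m$i$j)" for i j
    unfolding b P by (simp add: sum_2 metric_inverse(4)[OF assms(1), of 2 1] algebra_simps)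
  have first: "(\<Sum>k\<in>UNIV. \<Sum>m\<in>UNIV. A $ k $ k $ m * A $ m $ i $ j) = - 2 * (\<Sum>m\<in>UNIV. \<beta>$m * A$m$i$j)" for i j
  proof -
    have "(\<Sum>k\<in>UNIV. \<Sum>m\<in>UNIV. A $ k $ k $ m * A $ m $ i $ j) = (\<Sum>m\<in>UNIV. (\<Sum>k\<in>UNIV. A $ k $ k $ m) * A $ m $ i $ j)"
      by (simp add: sum_2 algebra_simps)
    then show ?thesis
      unfolding A_def difference_tensor_trace[OF assms(1-3)] by (simp add: sum_2)
  qed
  have tr: "(\<Sum>k\<in>UNIV. M $ k $ k $ j) = 0" for j using raise3_trace[OF assms(1-3)] by (simp add: M_def)
  have Msy: "M$l$i$j = M$l$j$i" for l i j
    unfolding M_def raise3_def using assms(2) by (simp add: symmetric3_def)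
  have cross: "(\<Sum>k\<in>UNIV. \<Sum>m\<in>UNIV. g$i$k * M$k$j$m * u$m) = (\<Sum>m\<in>UNIV. \<beta>$m * M$m$i$j)" for i j
  proof -
    have "(\<Sum>k\<in>UNIV. \<Sum>m\<in>UNIV. g$i$k * M$k$j$m * u$m) = (\<Sum>m\<in>UNIV. P$i$j$m * u$m)"
      unfolding P by (simp add: sum_2 algebra_simps)
    also have "\<dots> = (\<Sum>m\<in>UNIV. u$m * P$m$i$j)"
      using assms(2) by (intro sum.cong refl) (metis symmetric3_def mult.commute)
    finally show ?thesis using Pu by simp
  qed
  have second: "(\<Sum>k\<in>UNIV. \<Sum>m\<in>UNIV. A $ k $ i $ m * A $ m $ k $ j) =
     4 * \<beta>$i * \<beta>$j - 2 * g$i$j * (\<Sum>m\<in>UNIV. \<beta>$m * u$m) + s * s * (\<Sum>k\<in>UNIV. \<Sum>m\<in>UNIV. M$k$i$m * M$m$k$j)" for i j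
  proof -
    have b1: "\<beta> $ i * \<beta> $ j = (\<Sum>k\<in>UNIV. \<Sum>m\<in>UNIV. g$i$m * u$k * g$k$j * u$m)" for i j
      unfolding b by (simp add: sum_2 metric_inverse(4)[OF assms(1), of 2 1] metric_inverse(4)[OF assms(1), of j] algebra_simps)
    have "(\<Sum>k\<in>UNIV. \<Sum>m\<in>UNIV. A $ k $ i $ m * A $ m $ k $ j) =
      (\<Sum>k\<in>UNIV. \<Sum>m\<in>UNIV. g$i$m * u$k * g$k$j * u$m) - \<beta>$j * (\<Sum>m\<in>UNIV. g$i$m * u$m) - g$i$j * (\<Sum>m\<in>UNIV. \<beta>$m * u$m)
      - g$i$j * (\<Sum>m\<in>UNIV. \<beta>$m * u$m) + 4 * \<beta>$i * \<beta>$j + \<beta>$i * \<beta>$j - \<beta>$i * (\<Sum>m\<in>UNIV. g$j$m * u$m)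
      + s * ((\<Sum>m\<in>UNIV. \<Sum>k\<in>UNIV. g$i$m * M$m$j$k * u$k) - (\<Sum>m\<in>UNIV. \<beta>$m * M$m$i$j) - \<beta>$i * (\<Sum>k\<in>UNIV. M$k$k$j))
      + s * ((\<Sum>m\<in>UNIV. \<Sum>k\<in>UNIV. g$j$m * M$m$i$k * u$k) - (\<Sum>m\<in>UNIV. \<beta>$m * M$m$j$i) - \<beta>$j * (\<Sum>k\<in>UNIV. M$k$k$i))
      + s * s * (\<Sum>k\<in>UNIV. \<Sum>m\<in>UNIV. M$k$i$m * M$m$k$j)"
      using exhaust_2[of i] exhaust_2[of j]
      by (auto simp: A sum_2 metric_inverse(4)[OF assms(1), of 2 1] Msy[of _ 2 1] algebra_simps)
    then show ?thesis
      unfolding cross tr b1[symmetric] b[symmetric] Msy[of _ j i] by (simp add: algebra_simps)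
  qed
  have "(\<Sum>k\<in>UNIV. \<Sum>m\<in>UNIV. A $ k $ k $ m * A $ m $ i $ j - A $ k $ i $ m * A $ m $ k $ j) =
     - 2 * (\<Sum>m\<in>UNIV. \<beta>$m * A$m$i$j) - (4 * \<beta>$i * \<beta>$j - 2 * g$i$j * (\<Sum>m\<in>UNIV. \<beta>$m * u$m)
       + (\<Sum>k\<in>UNIV. \<Sum>m\<in>UNIV. M$k$i$m * M$m$k$j))"
    unfolding sum_subtractf first second using assms(4) by simp
  also have "(\<Sum>m\<in>UNIV. \<beta>$m * A$m$i$j) = g$i$j * (\<Sum>m\<in>UNIV. \<beta>$m * u$m) - 2 * \<beta>$i * \<beta>$j + s * (\<Sum>m\<in>UNIV. \<beta>$m * M$m$i$j)"
    using exhaust_2[of i] exhaust_2[of j] by (auto simp: A sum_2 algebra_simps)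
  also have "(\<Sum>m\<in>UNIV. \<beta>$m * M$m$i$j) = (\<Sum>m\<in>UNIV. u$m * P$m$i$j)" by (simp add: Pu)
  also have "(\<Sum>k\<in>UNIV. \<Sum>m\<in>UNIV. M$k$i$m * M$m$k$j) = 2 * cubic_norm_sq g (cubic_of g P) * g $ i $ j"
    using raise3_quadratic[OF assms(1-3)] by (simp add: M_def)
  finally show ?thesis
    unfolding A_def u_def by (simp add: algebra_simps)
qed

text \<open>\<open>A\<close> has six components, and the two trace conditions leave the four of a 1-form and a trace-free
  cubic form.  Subtracting from \<open>A\<close> its symmetrisation, which is known from \<open>Sym N\<close>, leaves the
  mixed components \<open>a\<close> and \<open>b\<close> of the proof; the trace conditions express \<open>\<beta>\<close> by \<open>a\<close> and \<open>b\<close>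
  and this relation is inverted.\<close>

lemma difference_decomposition:
  fixes s :: real and A :: "real^2^2^2"
  assumes g: "inner_product g" and s: "s * s = 1"
    and sym: "\<And>k i j. A$k$i$j = A$k$j$i"
    and tr: "\<And>k. (\<Sum>i\<in>UNIV. \<Sum>j\<in>UNIV. matrix_inv g $ i $ j * A$k$i$j) = 0"
    and N: "\<And>i j k. N$i$j$k = - A$k$i$j - A$j$i$k"
  defines "\<beta> \<equiv> (3/8) *\<^sub>R tr3 g (Sym N)" and "P \<equiv> - (s/2) *\<^sub>R Sym0 g N"
  shows "A$k$i$j = g$i$j * \<beta>$k - g$k$i * \<beta>$j - g$k$j * \<beta>$i + s * P$k$i$j"
proof -
  note D = inner_productD[OF g]
  have sP: "s * P$k$i$j = - (1/2) * Sym N $k$i$j + (g$i$j * \<beta>$k + g$k$i * \<beta>$j + g$k$j * \<beta>$i) / 3" for k i j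
  proof -
    have "s * P$k$i$j = - (s * s / 2) * Sym0 g N $ k $ i $ j" by (simp add: P_def)
    also have "\<dots> = - (1/2) * Sym0 g N $ k $ i $ j" using s by simp
    also have "\<dots> = - (1/2) * Sym N $k$i$j + (g$i$j * \<beta>$k + g$k$i * \<beta>$j + g$k$j * \<beta>$i) / 3"
      by (simp add: Sym0_def \<beta>_def Sym_def[of "\<chi> i j k. g $ i $ j * tr3 g _ $ k"] metric_inverse(4)[OF g, of j i]
         metric_inverse(4)[OF g, of i k] metric_inverse(4)[OF g, of j k] field_simps)
    finally show ?thesis .
  qed
  have tr': "g$2$2 * A$k$1$1 - 2 * g$1$2 * A$k$1$2 + g$1$1 * A$k$2$2 = 0" for k
  proof -
    have "g$2$2 * A$k$1$1 - 2 * g$1$2 * A$k$1$2 + g$1$1 * A$k$2$2 =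
        det g * (\<Sum>i\<in>UNIV. \<Sum>j\<in>UNIV. matrix_inv g $ i $ j * A$k$i$j)"
      using D sym[of k 2 1] by (simp add: sum_2 matrix_inv_2 field_simps)
    then show ?thesis unfolding tr by simp
  qed
  define a where "a = A$2$1$1 - A$1$1$2"
  define b where "b = A$1$2$2 - A$2$1$2"
  have SN: "Sym N $ i $ j $ k = - (2/3) * (A$i$j$k + A$j$i$k + A$k$i$j)" for i j k
    unfolding Sym_def N by (simp add: sym[of _ j i] sym[of _ k i] sym[of _ k j] field_simps)
  have det\<beta>: "det g * \<beta>$k = - (1/4) * (g$2$2 * (A$1$1$k + A$1$1$k + A$k$1$1) - 2 * g$1$2 * (A$1$2$k + A$2$1$k + A$k$1$2)
      + g$1$1 * (A$2$2$k + A$2$2$k + A$k$2$2))" for k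
  proof -
    have "det g * \<beta>$k = (3/8) * (det g * tr3 g (Sym N) $ k)" by (simp add: \<beta>_def)
    then show ?thesis
      unfolding tr3_symmetric3[OF g symmetric3_Sym] SN by (simp add: algebra_simps)
  qed
  have b1: "det g * \<beta>$1 = (g$1$2 * a + g$1$1 * b) / 2"
    using tr'[of 1] unfolding det\<beta> a_def b_def sym[of _ 2 1] by (simp add: algebra_simps)
  have b2: "det g * \<beta>$2 = (g$2$2 * a + g$1$2 * b) / 2"
    using tr'[of 2] unfolding det\<beta> a_def b_def sym[of _ 2 1] by (simp add: algebra_simps)
  have "det g * a = det g * (2 * (g$1$1 * \<beta>$2 - g$1$2 * \<beta>$1))"
  proof -
    have "det g * (2 * (g$1$1 * \<beta>$2 - g$1$2 * \<beta>$1)) = 2 * (g$1$1 * (det g * \<beta>$2) - g$1$2 * (det g * \<beta>$1))"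
      by (simp add: algebra_simps)
    then show ?thesis unfolding b1 b2 by (simp add: det_2 D(1) field_simps)
  qed
  then have a: "a = 2 * (g$1$1 * \<beta>$2 - g$1$2 * \<beta>$1)" using D(4) by (metis less_irrefl mult_cancel_left)
  have "det g * b = det g * (2 * (g$2$2 * \<beta>$1 - g$1$2 * \<beta>$2))"
  proof -
    have "det g * (2 * (g$2$2 * \<beta>$1 - g$1$2 * \<beta>$2)) = 2 * (g$2$2 * (det g * \<beta>$1) - g$1$2 * (det g * \<beta>$2))"
      by (simp add: algebra_simps)
    then show ?thesis unfolding b1 b2 by (simp add: det_2 D(1) field_simps)
  qed
  then have b: "b = 2 * (g$2$2 * \<beta>$1 - g$1$2 * \<beta>$2)" using D(4) by (metis less_irrefl mult_cancel_left)
  have "\<forall>k i j. A$k$i$j = g$i$j * \<beta>$k - g$k$i * \<beta>$j - g$k$j * \<beta>$i + s * P$k$i$j"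
    unfolding sP SN forall_2 using a b sym[of _ 2 1] D(1) by (simp add: a_def b_def field_simps)
  then show ?thesis by blast
qed

lemma dbar_vec_sum:
  "(\<Sum>m\<in>UNIV. dbar_vec g l $ m * f m) = (f l + \<i> * (\<Sum>m\<in>UNIV. complex_of_real (cstr g $ m $ l) * f m)) / 2"
  using exhaust_2[of l] by (auto simp: dbar_vec_def sum_2 field_simps)

lemma dbar_vec_type30:
  assumes "type30 g C"
  shows "(\<Sum>m\<in>UNIV. dbar_vec g l $ m * C$m$j$k) = 0" "(\<Sum>m\<in>UNIV. dbar_vec g l $ m * C$i$m$k) = 0"
    "(\<Sum>m\<in>UNIV. dbar_vec g l $ m * C$i$j$m) = 0"
proof -
  have t: "(\<Sum>m\<in>UNIV. cstr g $ m $ i * C $ m $ j $ k) = \<i> * C $ i $ j $ k"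
    "(\<Sum>m\<in>UNIV. cstr g $ m $ j * C $ i $ m $ k) = \<i> * C $ i $ j $ k"
    "(\<Sum>m\<in>UNIV. cstr g $ m $ k * C $ i $ j $ m) = \<i> * C $ i $ j $ k" for i j k
    using assms unfolding type30_def by blast+
  show "(\<Sum>m\<in>UNIV. dbar_vec g l $ m * C$m$j$k) = 0" unfolding dbar_vec_sum t by simp
  show "(\<Sum>m\<in>UNIV. dbar_vec g l $ m * C$i$m$k) = 0" unfolding dbar_vec_sum t by simp
  show "(\<Sum>m\<in>UNIV. dbar_vec g l $ m * C$i$j$m) = 0" unfolding dbar_vec_sum t by simp
qed

lemma hodge_cstr:
  assumes "inner_product g"
  shows "hodge g \<beta> $ l = - (\<Sum>m\<in>UNIV. cstr g $ m $ l * \<beta> $ m)"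
proof -
  have "\<forall>l. hodge g \<beta> $ l = - (\<Sum>m\<in>UNIV. cstr g $ m $ l * \<beta> $ m)"
    unfolding forall_2 using metric_inverse(3)[OF assms, of 2 1]
    by (simp add: hodge_def cstr_def area_form_def sum_2 algebra_simps)
  then show ?thesis by blast
qed

lemma dbar_vec_one_form:
  assumes "inner_product g"
  shows "2 * (\<Sum>m\<in>UNIV. dbar_vec g l $ m * complex_of_real (\<beta> $ m)) = complex_of_real (\<beta> $ l) - \<i> * hodge g \<beta> $ l"
  unfolding dbar_vec_sum hodge_cstr[OF assms] by simp

text \<open>In dimension two the divergence of a 1-form \<open>T\<close> with values in trace-free cubic forms carries the
  same information as the (0,1)-part of its complexification \<open>t\<^sub>m \<theta>\<^sup>3\<close>: vanishing divergence makes \<open>t\<close>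
  orthogonal to the null covector \<open>\<theta>\<close>, hence a multiple of \<open>\<theta>\<close>, and \<open>\<theta>\<close> vanishes on (0,1)-vectors.\<close>

lemma divergence_free_imp_holomorphic:
  assumes g: "inner_product g" and T: "\<And>m. symmetric3 (T m)" "\<And>m. tr3 g (T m) = 0"
    and div: "\<And>j k. (\<Sum>m\<in>UNIV. \<Sum>n\<in>UNIV. matrix_inv g $ m $ n * T m $ n $ j $ k) = 0"
  shows "(\<Sum>m\<in>UNIV. dbar_vec g l $ m * cubic_of g (T m) $ i $ j $ k) = 0"
proof -
  note D = inner_productD[OF g]
  define C where "C m = cubic_of g (T m)" for m
  have t30: "type30 g (C m)" for m unfolding C_def using type30_cubic_of[OF g T] .
  define \<mu> where "\<mu> = Complex (g$1$2 / g$1$1) (sqrt (det g) / g$1$1)"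
  define \<theta> :: "complex^2" where "\<theta> = (\<chi> i. if i = 1 then 1 else \<mu>)"
  have Ct: "C m $ i $ j $ k = C m $ 1 $ 1 $ 1 * cube \<theta> $ i $ j $ k" for m i j k
    unfolding \<theta>_def \<mu>_def by (rule type30_eqs[OF g t30])
  have "(\<Sum>m\<in>UNIV. \<Sum>n\<in>UNIV. matrix_inv g $ m $ n * C m $ n $ 1 $ 1) =
    complex_of_real (\<Sum>m\<in>UNIV. \<Sum>n\<in>UNIV. matrix_inv g $ m $ n * T m $ n $ 1 $ 1)
    - \<i> * complex_of_real (\<Sum>m\<in>UNIV. \<Sum>n\<in>UNIV. matrix_inv g $ m $ n * (\<Sum>r\<in>UNIV. cstr g $ r $ n * T m $ r $ 1 $ 1))"
    by (simp add: C_def cubic_of_def sum_2 algebra_simps)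
  also have "(\<Sum>m\<in>UNIV. \<Sum>n\<in>UNIV. matrix_inv g $ m $ n * (\<Sum>r\<in>UNIV. cstr g $ r $ n * T m $ r $ 1 $ 1)) =
    (\<Sum>r\<in>UNIV. cstr g $ r $ 1 * (\<Sum>m\<in>UNIV. \<Sum>n\<in>UNIV. matrix_inv g $ m $ n * T m $ n $ r $ 1))"
    unfolding cstr_slot[OF g T, where j=1, symmetric] by (simp add: sum_2 algebra_simps)
  finally have "(\<Sum>m\<in>UNIV. \<Sum>n\<in>UNIV. matrix_inv g $ m $ n * C m $ n $ 1 $ 1) = 0"
    unfolding div by simp
  moreover have "C 1 $ 1 $ 1 $ 1 * (g$2$2 - g$1$2 * \<mu>) + C 2 $ 1 $ 1 $ 1 * (g$1$1 * \<mu> - g$1$2) =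
    complex_of_real (det g) * (\<Sum>m\<in>UNIV. \<Sum>n\<in>UNIV. matrix_inv g $ m $ n * C m $ n $ 1 $ 1)"
    unfolding sum_2 Ct[of _ 2 1 1] using D
    by (simp add: matrix_inv_2 cube_def \<theta>_def field_simps)
  ultimately have e: "C 1 $ 1 $ 1 $ 1 * (g$2$2 - g$1$2 * \<mu>) + C 2 $ 1 $ 1 $ 1 * (g$1$1 * \<mu> - g$1$2) = 0"
    by simp
  have W: "sqrt (det g) * sqrt (det g) = g$1$1 * g$2$2 - g$1$2 * g$1$2" "sqrt (det g) > 0"
    using D by (simp_all add: det_2)
  have m1: "g$1$1 * \<mu> - g$1$2 = \<i> * sqrt (det g)" using D by (simp add: \<mu>_def complex_eq_iff)
  have m2: "g$2$2 - g$1$2 * \<mu> = - \<i> * sqrt (det g) * \<mu>"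
    using D W by (simp add: \<mu>_def complex_eq_iff field_simps)
  have "\<i> * sqrt (det g) * (C 2 $ 1 $ 1 $ 1 - \<mu> * C 1 $ 1 $ 1 $ 1) = 0"
    using e unfolding m1 m2 by (simp add: algebra_simps)
  then have t: "C 2 $ 1 $ 1 $ 1 = \<mu> * C 1 $ 1 $ 1 $ 1" using W by simp
  have "(\<Sum>m\<in>UNIV. dbar_vec g l $ m * C m $ i $ j $ k) = (\<Sum>m\<in>UNIV. dbar_vec g l $ m * C 1 $ m $ 1 $ 1) * cube \<theta> $ i $ j $ k"
    unfolding sum_2 Ct[of _ i j k] Ct[of 1 2 1 1] by (simp add: t cube_def \<theta>_def algebra_simps)
  then show ?thesis unfolding dbar_vec_type30[OF t30] by (simp add: C_def)
qed

section \<open>The Levi-Civita connection of a metric in a chart\<close>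

lemma pd_nth2:
  assumes "f differentiable at x"
  shows "pd k (\<lambda>y. f y $ i $ j) x = pd k f x $ i $ j"
  using pd_nth[OF assms] pd_nth[OF differentiable_nth[OF assms]] by simp

lemma pd_nth3:
  assumes "f differentiable at x"
  shows "pd k (\<lambda>y. f y $ i $ j $ l) x = pd k f x $ i $ j $ l"
  using pd_nth2[OF assms] pd_nth[OF differentiable_nth[OF differentiable_nth[OF assms]]] by simp

locale metric_chart =
  fixes U :: "(real^2) set" and g :: "real^2 \<Rightarrow> real^2^2"
  assumes open_U: "open U"
    and smooth_g: "smooth_on g U"
    and metric: "\<And>x. x \<in> U \<Longrightarrow> inner_product (g x)"
begin

abbreviation h where "h x \<equiv> matrix_inv (g x)"
abbreviation L where "L \<equiv> christoffel g"

lemmas smooth_rules = smooth_on_add[OF open_U] smooth_on_diff[OF open_U] smooth_on_minus[OF open_U]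
  smooth_on_mult[OF open_U] smooth_on_sum[OF open_U] smooth_on_vec_lambda[OF open_U]
  smooth_on_nth[OF open_U] smooth_on_const[OF open_U] smooth_on_of_real[OF open_U] smooth_on_pd

lemma diffble: "smooth_on f U \<Longrightarrow> x \<in> U \<Longrightarrow> f differentiable at x"
  using smooth_on_differentiable open_U by blast

lemma smooth_det: "smooth_on (\<lambda>x. det (g x)) U"
  unfolding det_2 by (intro smooth_rules smooth_g)

lemma smooth_vol: "smooth_on (\<lambda>x. sqrt (det (g x))) U"
  by (rule smooth_on_sqrt[OF open_U smooth_det]) (use metric inner_productD(4) in blast)

lemma smooth_h_nth: "smooth_on (\<lambda>x. h x $ i $ j) U"
proof -
  have d: "det (g x) \<noteq> 0" if "x \<in> U" for x using metric[OF that] inner_productD(4) by fastforce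
  have "\<forall>i j. smooth_on (\<lambda>x. h x $ i $ j) U"
    unfolding forall_2
    by (intro conjI; rule smooth_on_cong[OF open_U matrix_inv_2(1)[symmetric, OF d]]
          smooth_on_cong[OF open_U matrix_inv_2(2)[symmetric, OF d]]
          smooth_on_cong[OF open_U matrix_inv_2(3)[symmetric, OF d]]
          smooth_on_cong[OF open_U matrix_inv_2(4)[symmetric, OF d]])
       (auto intro!: smooth_on_divide[OF open_U] smooth_rules smooth_g smooth_det d)
  then show ?thesis by blast
qed

lemma smooth_h: "smooth_on h U"
proof -
  have "smooth_on (\<lambda>x. \<chi> i j. h x $ i $ j) U" by (intro smooth_rules smooth_h_nth)
  then show ?thesis by simp
qed

lemma smooth_L: "smooth_on L U"
  unfolding christoffel_def[abs_def]
  by (intro smooth_rules smooth_g smooth_h)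

lemma pd_g_sym: "x \<in> U \<Longrightarrow> pd k g x $ i $ j = pd k g x $ j $ i"
proof -
  assume x: "x \<in> U"
  have "pd k (\<lambda>y. g y $ i $ j) x = pd k (\<lambda>y. g y $ j $ i) x"
    by (rule pd_cong[OF open_U x metric_inverse(4)[OF metric]]) (auto intro!: differentiable_nth diffble smooth_g x)
  then show ?thesis by (simp add: pd_nth2 diffble smooth_g x)
qed

lemma L_sym: "x \<in> U \<Longrightarrow> L x $ k $ i $ j = L x $ k $ j $ i"
  by (simp add: christoffel_def pd_g_sym[of x _ i j] algebra_simps)

lemma lower_L: "x \<in> U \<Longrightarrow>
  (\<Sum>m\<in>UNIV. g x $ j $ m * L x $ m $ k $ i) = (pd k g x $ j $ i + pd i g x $ j $ k - pd j g x $ k $ i) / 2"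
proof -
  assume x: "x \<in> U"
  have "(\<Sum>m\<in>UNIV. g x $ j $ m * L x $ m $ k $ i) =
     (\<Sum>l\<in>UNIV. (\<Sum>m\<in>UNIV. g x $ j $ m * h x $ m $ l) * ((pd k g x $ l $ i + pd i g x $ l $ k - pd l g x $ k $ i) / 2))"
    by (simp add: christoffel_def sum_2 field_simps)
  then show ?thesis
    unfolding metric_inverse(1)[OF metric[OF x]] by (simp add: if_distrib if_distribR cong: if_cong)
qed

lemma compat:
  assumes x: "x \<in> U"
  shows "pd k g x $ i $ j = (\<Sum>m\<in>UNIV. L x $ m $ k $ i * g x $ m $ j + L x $ m $ k $ j * g x $ i $ m)"
proof -
  have "(\<Sum>m\<in>UNIV. L x $ m $ k $ i * g x $ m $ j + L x $ m $ k $ j * g x $ i $ m) =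
    (\<Sum>m\<in>UNIV. g x $ j $ m * L x $ m $ k $ i) + (\<Sum>m\<in>UNIV. g x $ i $ m * L x $ m $ k $ j)"
    unfolding sum.distrib by (simp add: metric_inverse(4)[OF metric[OF x], of _ j] mult.commute)
  then show ?thesis
    unfolding lower_L[OF x] by (simp add: pd_g_sym[OF x, of _ j i] pd_g_sym[OF x, of _ k i] pd_g_sym[OF x, of _ k j] field_simps)
qed

lemma nondegenerate:
  assumes x: "x \<in> U" and "\<And>j. (\<Sum>p\<in>UNIV. z p * g x $ p $ j) = 0"
  shows "z p = 0"
proof -
  have "(\<Sum>j\<in>UNIV. (\<Sum>p\<in>UNIV. z p * g x $ p $ j) * h x $ j $ q) = (\<Sum>p\<in>UNIV. z p * (\<Sum>j\<in>UNIV. g x $ p $ j * h x $ j $ q))" for q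
    by (simp add: sum_2 algebra_simps)
  from this[of p] show ?thesis
    unfolding assms(2) metric_inverse(1)[OF metric[OF x]] by (simp add: if_distrib if_distribR cong: if_cong)
qed

lemma pd_contract:
  assumes x: "x \<in> U" and "\<And>p. smooth_on (a p) U" "\<And>p. smooth_on (b p) U"
  shows "pd k (\<lambda>y. \<Sum>p\<in>UNIV. a p y * (b p y :: real)) x = (\<Sum>p\<in>(UNIV::2 set). pd k (a p) x * b p x + a p x * pd k (b p) x)"
proof -
  have "pd k (\<lambda>y. \<Sum>p\<in>UNIV. a p y * b p y) x = (\<Sum>p\<in>(UNIV::2 set). pd k (\<lambda>y. a p y * b p y) x)"
    using diffble[OF smooth_on_mult[OF open_U assms(2,3)] x] by (intro pd_sum)
  then show ?thesis
    using pd_mult[OF diffble[OF assms(2) x] diffble[OF assms(3) x]] by simp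
qed

lemma inverse_compat:
  assumes x: "x \<in> U"
  shows "pd k (\<lambda>y. h y $ i $ j) x = - (\<Sum>m\<in>UNIV. L x $ i $ k $ m * h x $ m $ j + L x $ j $ k $ m * h x $ i $ m)"
proof -
  let ?z = "\<lambda>p. pd k (\<lambda>y. h y $ i $ p) x + (\<Sum>m\<in>UNIV. L x $ i $ k $ m * h x $ m $ p + L x $ p $ k $ m * h x $ i $ m)"
  have "(\<Sum>p\<in>UNIV. ?z p * g x $ p $ j) = 0" for j
  proof -
    have "pd k (\<lambda>y. \<Sum>p\<in>UNIV. h y $ i $ p * g y $ p $ j) x = pd k (\<lambda>y. if i = j then 1 else (0::real)) x"
      by (rule pd_cong[OF open_U x]) (simp_all add: metric_inverse(2)[OF metric] x diffble smooth_rules smooth_h smooth_g)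
    then have "(\<Sum>p\<in>UNIV. pd k (\<lambda>y. h y $ i $ p) x * g x $ p $ j + h x $ i $ p * pd k g x $ p $ j) = 0"
      by (subst (asm) pd_contract[OF x]) (simp_all add: smooth_rules smooth_h smooth_g pd_nth2 diffble x)
    then have "(\<Sum>p\<in>UNIV. pd k (\<lambda>y. h y $ i $ p) x * g x $ p $ j) = - (\<Sum>p\<in>UNIV. h x $ i $ p * pd k g x $ p $ j)"
      by (simp add: sum.distrib)
    moreover have "(\<Sum>p\<in>UNIV. h x $ i $ p * pd k g x $ p $ j) =
      (\<Sum>m\<in>UNIV. L x $ m $ k $ j * (\<Sum>p\<in>UNIV. h x $ i $ p * g x $ p $ m)) + (\<Sum>p\<in>UNIV. \<Sum>m\<in>UNIV. L x $ p $ k $ m * h x $ i $ m * g x $ p $ j)"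
      unfolding compat[OF x] by (simp add: sum_2 algebra_simps)
    moreover have "(\<Sum>p\<in>UNIV. ?z p * g x $ p $ j) = (\<Sum>p\<in>UNIV. pd k (\<lambda>y. h y $ i $ p) x * g x $ p $ j) +
       (\<Sum>m\<in>UNIV. L x $ i $ k $ m * (\<Sum>p\<in>UNIV. h x $ m $ p * g x $ p $ j)) + (\<Sum>p\<in>UNIV. \<Sum>m\<in>UNIV. L x $ p $ k $ m * h x $ i $ m * g x $ p $ j)"
      by (simp add: sum_2 algebra_simps)
    ultimately show ?thesis
      unfolding metric_inverse(2)[OF metric[OF x]] by (simp add: if_distrib if_distribR cong: if_cong)
  qed
  from nondegenerate[OF x this, of j] show ?thesis by simp
qed

text \<open>Differentiating \<open>W\<^sup>2 = det g\<close> avoids the derivative of the square root.\<close>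

lemma pd_vol:
  assumes x: "x \<in> U"
  shows "pd k (\<lambda>y. sqrt (det (g y))) x = sqrt (det (g x)) * (\<Sum>m\<in>UNIV. L x $ m $ k $ m)"
proof -
  note D = inner_productD[OF metric[OF x]]
  let ?W = "\<lambda>y. sqrt (det (g y))"
  have W: "?W x > 0" using D by simp
  have "pd k (\<lambda>y. ?W y * ?W y) x = pd k (\<lambda>y. det (g y)) x"
    by (rule pd_cong[OF open_U x]) (use metric inner_productD(4) in \<open>fastforce intro: diffble[OF smooth_on_mult[OF open_U smooth_vol smooth_vol] x]\<close>)+
  then have "2 * ?W x * pd k ?W x = pd k (\<lambda>y. det (g y)) x"
    using pd_mult[OF diffble diffble, OF smooth_vol x smooth_vol x, of k] by simp
  also have "\<dots> = pd k g x $ 1 $ 1 * g x $ 2 $ 2 + g x $ 1 $ 1 * pd k g x $ 2 $ 2 - (pd k g x $ 1 $ 2 * g x $ 2 $ 1 + g x $ 1 $ 2 * pd k g x $ 2 $ 1)"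
  proof -
    have n: "(\<lambda>y. g y $ i $ j) differentiable at x" for i j by (intro diffble x smooth_rules smooth_g)
    have m: "(\<lambda>y. g y $ i $ j * g y $ p $ q) differentiable at x" for i j p q by (intro diffble x smooth_rules smooth_g)
    show ?thesis
      unfolding det_2 by (simp add: pd_diff[OF m m] pd_mult[OF n n] pd_nth2 diffble smooth_g x)
  qed
  also have "\<dots> = 2 * det (g x) * (\<Sum>m\<in>UNIV. L x $ m $ k $ m)"
    unfolding compat[OF x] by (simp add: sum_2 det_2 D(1) algebra_simps)
  also have "\<dots> = 2 * (?W x * ?W x) * (\<Sum>m\<in>UNIV. L x $ m $ k $ m)" using D by simp
  finally have "2 * ?W x * pd k ?W x = 2 * (?W x * ?W x) * (\<Sum>m\<in>UNIV. L x $ m $ k $ m)" .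
  moreover have "p = w * S" if "2 * w * p = 2 * (w * w) * S" "w > 0" for p w S :: real
    using that by (simp add: field_simps)
  ultimately show ?thesis using W by blast
qed

text \<open>The area form is parallel, hence so is the complex structure built from it and the metric.\<close>

lemma area_compat:
  assumes x: "x \<in> U"
  shows "pd k (\<lambda>y. area_form (g y) $ i $ j) x = (\<Sum>n\<in>UNIV. L x $ n $ k $ i * area_form (g x) $ n $ j + L x $ n $ k $ j * area_form (g x) $ i $ n)"
proof -
  have "\<forall>i j. pd k (\<lambda>y. area_form (g y) $ i $ j) x = (\<Sum>n\<in>UNIV. L x $ n $ k $ i * area_form (g x) $ n $ j + L x $ n $ k $ j * area_form (g x) $ i $ n)"
    unfolding forall_2 area_form_def
    by (simp add: sum_2 pd_vol[OF x] pd_minus[OF diffble[OF smooth_vol x]] algebra_simps)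
  then show ?thesis by blast
qed

lemma smooth_area: "smooth_on (\<lambda>y. area_form (g y)) U"
proof -
  have "\<forall>i j. smooth_on (\<lambda>y. area_form (g y) $ i $ j) U"
    unfolding forall_2 area_form_def by (simp add: smooth_rules smooth_vol open_U)
  then show ?thesis
    using smooth_on_vec_lambda[OF open_U smooth_on_vec_lambda[OF open_U], of "\<lambda>i j y. area_form (g y) $ i $ j"] by simp
qed

lemma smooth_cstr: "smooth_on (\<lambda>y. cstr (g y)) U"
  unfolding cstr_def by (intro smooth_rules smooth_area smooth_h)

lemma cstr_compat:
  assumes x: "x \<in> U"
  shows "pd k (\<lambda>y. cstr (g y) $ n $ i) x = (\<Sum>r\<in>UNIV. L x $ r $ k $ i * cstr (g x) $ n $ r - L x $ n $ k $ r * cstr (g x) $ r $ i)"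
proof -
  have "pd k (\<lambda>y. cstr (g y) $ n $ i) x = pd k (\<lambda>y. \<Sum>m\<in>UNIV. area_form (g y) $ i $ m * h y $ m $ n) x"
    by (simp add: cstr_def)
  also have "\<dots> = (\<Sum>m\<in>UNIV. pd k (\<lambda>y. area_form (g y) $ i $ m) x * h x $ m $ n + area_form (g x) $ i $ m * pd k (\<lambda>y. h y $ m $ n) x)"
    by (rule pd_contract[OF x]; intro smooth_rules smooth_area smooth_h)
  also have "\<dots> = (\<Sum>r\<in>UNIV. L x $ r $ k $ i * cstr (g x) $ n $ r - L x $ n $ k $ r * cstr (g x) $ r $ i)"
    unfolding area_compat[OF x] inverse_compat[OF x] cstr_def by (simp add: sum_2 algebra_simps)
  finally show ?thesis .
qed

text \<open>Metric compatibility differentiated once more: the left-hand side is the commutator of two second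
  derivatives of \<open>g\<close>.\<close>

lemma riem_skew:
  assumes x: "x \<in> U"
  shows "(\<Sum>m\<in>UNIV. riem L x k i a m * g x $ m $ b + riem L x k i b m * g x $ a $ m) = 0"
proof -
  have c: "pd k (pd i (\<lambda>y. g y $ a $ b)) x =
     (\<Sum>m\<in>UNIV. pd k L x $ m $ i $ a * g x $ m $ b + L x $ m $ i $ a * pd k g x $ m $ b
           + (pd k L x $ m $ i $ b * g x $ a $ m + L x $ m $ i $ b * pd k g x $ a $ m))" for k i
  proof -
    have "pd k (\<lambda>y. (\<Sum>m\<in>UNIV. L y $ m $ i $ a * g y $ m $ b) + (\<Sum>m\<in>UNIV. L y $ m $ i $ b * g y $ a $ m)) x = pd k (pd i (\<lambda>y. g y $ a $ b)) x"
    proof (rule pd_cong[OF open_U x])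
      show "(\<lambda>y. (\<Sum>m\<in>UNIV. L y $ m $ i $ a * g y $ m $ b) + (\<Sum>m\<in>UNIV. L y $ m $ i $ b * g y $ a $ m)) differentiable at x"
        by (intro diffble x smooth_rules smooth_L smooth_g)
      show "(\<Sum>m\<in>UNIV. L y $ m $ i $ a * g y $ m $ b) + (\<Sum>m\<in>UNIV. L y $ m $ i $ b * g y $ a $ m) = pd i (\<lambda>y. g y $ a $ b) y"
        if "y \<in> U" for y
        using compat[OF that, of i a b] pd_nth2[OF diffble[OF smooth_g that]] by (simp add: sum.distrib)
    qed
    moreover have "pd k (\<lambda>y. (\<Sum>m\<in>UNIV. L y $ m $ i $ a * g y $ m $ b) + (\<Sum>m\<in>UNIV. L y $ m $ i $ b * g y $ a $ m)) x =
      pd k (\<lambda>y. \<Sum>m\<in>UNIV. L y $ m $ i $ a * g y $ m $ b) x + pd k (\<lambda>y. \<Sum>m\<in>UNIV. L y $ m $ i $ b * g y $ a $ m) x"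
      by (rule pd_add; intro diffble x smooth_rules smooth_L smooth_g)
    moreover have "pd k (\<lambda>y. \<Sum>m\<in>UNIV. L y $ m $ i $ a * g y $ m $ b) x = (\<Sum>m\<in>UNIV. pd k (\<lambda>y. L y $ m $ i $ a) x * g x $ m $ b + L x $ m $ i $ a * pd k (\<lambda>y. g y $ m $ b) x)"
      by (rule pd_contract[OF x]; intro smooth_rules smooth_L smooth_g)
    moreover have "pd k (\<lambda>y. \<Sum>m\<in>UNIV. L y $ m $ i $ b * g y $ a $ m) x = (\<Sum>m\<in>UNIV. pd k (\<lambda>y. L y $ m $ i $ b) x * g x $ a $ m + L x $ m $ i $ b * pd k (\<lambda>y. g y $ a $ m) x)"
      by (rule pd_contract[OF x]; intro smooth_rules smooth_L smooth_g)
    ultimately show ?thesis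
      by (simp add: sum.distrib pd_nth2 pd_nth3 diffble smooth_g smooth_L x)
  qed
  have "pd k (pd i (\<lambda>y. g y $ a $ b)) x = pd i (pd k (\<lambda>y. g y $ a $ b)) x"
    by (rule pd_commute[OF open_U x]) (intro smooth_rules smooth_g)
  then show ?thesis
    unfolding c unfolding compat[OF x] riem_def by (simp add: sum_2 algebra_simps)
qed

text \<open>Skewness with respect to \<open>g\<close> leaves one independent component of \<open>R(\<partial>\<^sub>1,\<partial>\<^sub>2)\<close>, so all entries
  of this endomorphism are found by solving a linear system with determinant \<open>det g\<close>.\<close>

lemma ricci_L:
  assumes x: "x \<in> U"
  shows "ricci L x $ i $ j = gauss_curvature g x * g x $ i $ j"
proof -
  note D = inner_productD[OF metric[OF x]]
  define K where "K = gauss_curvature g x"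
  define M where "M j l = riem L x 1 2 j l" for j l
  have r0: "riem L x k k j l = 0" "riem L x 2 1 j l = - M j l" for k j l
    by (simp_all add: riem_def M_def sum_2)
  define E F G where "E = g x $ 1 $ 1" "F = g x $ 1 $ 2" "G = g x $ 2 $ 2"
  have g: "g x $ 1 $ 1 = E" "g x $ 1 $ 2 = F" "g x $ 2 $ 1 = F" "g x $ 2 $ 2 = G" using D by (simp_all add: E_F_G_def)
  have d: "E * G - F * F > 0" using D(4) by (simp add: det_2 g)
  have s: "M 1 1 * E + M 1 2 * F = 0" "M 2 1 * F + M 2 2 * G = 0"
     "M 1 1 * F + M 1 2 * G + M 2 1 * E + M 2 2 * F = 0"
    using riem_skew[OF x, of 1 2 1 1] riem_skew[OF x, of 1 2 2 2] riem_skew[OF x, of 1 2 1 2]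
    by (simp_all add: sum_2 M_def g algebra_simps)
  have K: "K * (E * G - F * F) = M 2 1 * E + M 2 2 * F"
    using d unfolding K_def gauss_curvature_def by (simp add: sum_2 M_def g det_2)
  have s3: "M 1 1 * F + M 1 2 * G = - (K * (E * G - F * F))" using s(3) K by linarith
  have "(E * G - F * F) * (- M 1 2) = (E * G - F * F) * (K * E)"
  proof -
    have "(E * G - F * F) * (- M 1 2) = F * (M 1 1 * E + M 1 2 * F) - E * (M 1 1 * F + M 1 2 * G)" by (simp add: algebra_simps)
    also have "\<dots> = E * (K * (E * G - F * F))" unfolding s(1) s3 by simp
    finally show ?thesis by (simp add: algebra_simps)
  qed
  then have a: "- M 1 2 = K * E" using d by (metis less_irrefl mult_cancel_left)
  have "(E * G - F * F) * M 1 1 = (E * G - F * F) * (K * F)"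
  proof -
    have "(E * G - F * F) * M 1 1 = G * (M 1 1 * E + M 1 2 * F) - F * (M 1 1 * F + M 1 2 * G)" by (simp add: algebra_simps)
    also have "\<dots> = F * (K * (E * G - F * F))" unfolding s(1) s3 by simp
    finally show ?thesis by (simp add: algebra_simps)
  qed
  then have b: "M 1 1 = K * F" using d by (metis less_irrefl mult_cancel_left)
  have "(E * G - F * F) * M 2 1 = (E * G - F * F) * (K * G)"
  proof -
    have "(E * G - F * F) * M 2 1 = G * (M 2 1 * E + M 2 2 * F) - F * (M 2 1 * F + M 2 2 * G)" by (simp add: algebra_simps)
    also have "\<dots> = G * (K * (E * G - F * F))" unfolding s(2) K[symmetric] by simp
    finally show ?thesis by (simp add: algebra_simps)
  qed
  then have c: "M 2 1 = K * G" using d by (metis less_irrefl mult_cancel_left)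
  have "(E * G - F * F) * (- M 2 2) = (E * G - F * F) * (K * F)"
  proof -
    have "(E * G - F * F) * (- M 2 2) = F * (M 2 1 * E + M 2 2 * F) - E * (M 2 1 * F + M 2 2 * G)" by (simp add: algebra_simps)
    also have "\<dots> = F * (K * (E * G - F * F))" unfolding s(2) K[symmetric] by simp
    finally show ?thesis by (simp add: algebra_simps)
  qed
  then have e: "- M 2 2 = K * F" using d by (metis less_irrefl mult_cancel_left)
  have "\<forall>i j. ricci L x $ i $ j = K * g x $ i $ j"
    unfolding forall_2 ricci_def using a b c e by (simp add: sum_2 r0 M_def[symmetric] g)
  then show ?thesis by (simp add: K_def)
qed

section \<open>Covariant derivatives\<close>

text \<open>Covariant derivatives of a 1-form and of a covariant 3-tensor; \<open>k\<close> is the direction of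
  differentiation.\<close>

definition cov1 :: "(real^2 \<Rightarrow> real^2) \<Rightarrow> real^2 \<Rightarrow> 2 \<Rightarrow> 2 \<Rightarrow> real" where
  "cov1 \<beta> x k j = pd k \<beta> x $ j - (\<Sum>m\<in>UNIV. L x $ m $ k $ j * \<beta> x $ m)"

definition cov3 :: "(real^2 \<Rightarrow> real^2^2^2) \<Rightarrow> real^2 \<Rightarrow> 2 \<Rightarrow> real^2^2^2" where
  "cov3 P x k = (\<chi> p i j. pd k P x $ p $ i $ j
     - (\<Sum>m\<in>UNIV. L x $ m $ k $ p * P x $ m $ i $ j + L x $ m $ k $ i * P x $ p $ m $ j + L x $ m $ k $ j * P x $ p $ i $ m))"

definition divergence1 :: "(real^2 \<Rightarrow> real^2) \<Rightarrow> real^2 \<Rightarrow> real" where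
  "divergence1 \<beta> x = (\<Sum>k\<in>UNIV. \<Sum>p\<in>UNIV. h x $ k $ p * cov1 \<beta> x k p)"

definition divergence3 :: "(real^2 \<Rightarrow> real^2^2^2) \<Rightarrow> real^2 \<Rightarrow> 2 \<Rightarrow> 2 \<Rightarrow> real" where
  "divergence3 P x i j = (\<Sum>k\<in>UNIV. \<Sum>p\<in>UNIV. h x $ k $ p * cov3 P x k $ p $ i $ j)"

lemma pd_raise1:
  assumes x: "x \<in> U" and b: "smooth_on \<beta> U"
  shows "pd k (\<lambda>y. raise1 (g y) (\<beta> y) $ l) x = (\<Sum>p\<in>UNIV. h x $ l $ p * cov1 \<beta> x k p) - (\<Sum>m\<in>UNIV. L x $ l $ k $ m * raise1 (g x) (\<beta> x) $ m)"
proof -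
  have "pd k (\<lambda>y. raise1 (g y) (\<beta> y) $ l) x = pd k (\<lambda>y. \<Sum>p\<in>UNIV. h y $ l $ p * \<beta> y $ p) x"
    by (simp add: raise1_def)
  also have "\<dots> = (\<Sum>p\<in>UNIV. pd k (\<lambda>y. h y $ l $ p) x * \<beta> x $ p + h x $ l $ p * pd k (\<lambda>y. \<beta> y $ p) x)"
    by (rule pd_contract[OF x]; intro smooth_rules smooth_h b)
  also have "\<dots> = (\<Sum>p\<in>UNIV. h x $ l $ p * cov1 \<beta> x k p) - (\<Sum>m\<in>UNIV. L x $ l $ k $ m * raise1 (g x) (\<beta> x) $ m)"
    unfolding inverse_compat[OF x] pd_nth[OF diffble[OF b x]] cov1_def raise1_def by (simp add: sum_2 algebra_simps)
  finally show ?thesis .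
qed

lemma pd_raise3:
  assumes x: "x \<in> U" and P: "smooth_on P U"
  shows "pd k (\<lambda>y. raise3 (g y) (P y) $ l $ i $ j) x = (\<Sum>p\<in>UNIV. h x $ l $ p * cov3 P x k $ p $ i $ j)
    - (\<Sum>m\<in>UNIV. L x $ l $ k $ m * raise3 (g x) (P x) $ m $ i $ j - L x $ m $ k $ i * raise3 (g x) (P x) $ l $ m $ j
           - L x $ m $ k $ j * raise3 (g x) (P x) $ l $ i $ m)"
proof -
  have "pd k (\<lambda>y. raise3 (g y) (P y) $ l $ i $ j) x = pd k (\<lambda>y. \<Sum>p\<in>UNIV. h y $ l $ p * P y $ p $ i $ j) x"
    by (simp add: raise3_def)
  also have "\<dots> = (\<Sum>p\<in>UNIV. pd k (\<lambda>y. h y $ l $ p) x * P x $ p $ i $ j + h x $ l $ p * pd k (\<lambda>y. P y $ p $ i $ j) x)"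
    by (rule pd_contract[OF x]; intro smooth_rules smooth_h P)
  also have "\<dots> = (\<Sum>p\<in>UNIV. h x $ l $ p * cov3 P x k $ p $ i $ j)
    - (\<Sum>m\<in>UNIV. L x $ l $ k $ m * raise3 (g x) (P x) $ m $ i $ j - L x $ m $ k $ i * raise3 (g x) (P x) $ l $ m $ j
           - L x $ m $ k $ j * raise3 (g x) (P x) $ l $ i $ m)"
    unfolding inverse_compat[OF x] pd_nth3[OF diffble[OF P x]] cov3_def raise3_def by (simp add: sum_2 algebra_simps)
  finally show ?thesis .
qed

text \<open>\<open>\<star>\<beta>\<close> is the contraction of the parallel area form with the vector field dual to \<open>\<beta>\<close>, and
  the exterior derivative of such a contraction is the divergence of the field times the area form.\<close>

lemma codiff_divergence:
  assumes x: "x \<in> U" and b: "smooth_on \<beta> U"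
  shows "codiff g \<beta> x = - divergence1 \<beta> x"
proof -
  note D = inner_productD[OF metric[OF x]]
  let ?W = "\<lambda>y. sqrt (det (g y))"
  have sr: "smooth_on (\<lambda>y. raise1 (g y) (\<beta> y)) U" unfolding raise1_def by (intro smooth_rules smooth_h b)
  have hodge: "hodge (g y) (\<beta> y) $ 2 = ?W y * raise1 (g y) (\<beta> y) $ 1"
    "hodge (g y) (\<beta> y) $ 1 = - (?W y * raise1 (g y) (\<beta> y) $ 2)" if "y \<in> U" for y
    using metric_inverse(3)[OF metric[OF that], of 2 1]
    by (simp_all add: hodge_def area_form_def raise1_def sum_2 algebra_simps)
  have shd: "smooth_on (\<lambda>y. hodge (g y) (\<beta> y)) U"
    unfolding hodge_def by (intro smooth_rules smooth_h smooth_area b)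
  have wr: "smooth_on (\<lambda>y. ?W y * raise1 (g y) (\<beta> y) $ i) U" for i
    by (intro smooth_on_mult[OF open_U] smooth_vol smooth_on_nth[OF open_U sr])
  have p: "pd k (\<lambda>y. ?W y * raise1 (g y) (\<beta> y) $ l) x = ?W x * ((\<Sum>m\<in>UNIV. L x $ m $ k $ m) * raise1 (g x) (\<beta> x) $ l +
      (\<Sum>p\<in>UNIV. h x $ l $ p * cov1 \<beta> x k p) - (\<Sum>m\<in>UNIV. L x $ l $ k $ m * raise1 (g x) (\<beta> x) $ m))" for k l
    using pd_mult[OF diffble[OF smooth_vol x] diffble[OF smooth_on_nth[OF open_U sr] x], of k l]
    by (simp add: pd_vol[OF x] pd_raise1[OF x b] algebra_simps)
  have h2: "pd 1 (\<lambda>y. hodge (g y) (\<beta> y)) x $ 2 = pd 1 (\<lambda>y. ?W y * raise1 (g y) (\<beta> y) $ 1) x"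
    unfolding pd_nth[OF diffble[OF shd x], symmetric]
    by (rule pd_cong[OF open_U x]) (simp_all add: hodge diffble[OF smooth_on_nth[OF open_U shd] x])
  have h1: "pd 2 (\<lambda>y. hodge (g y) (\<beta> y)) x $ 1 = - pd 2 (\<lambda>y. ?W y * raise1 (g y) (\<beta> y) $ 2) x"
    unfolding pd_nth[OF diffble[OF shd x], symmetric] pd_minus[OF diffble[OF wr x], symmetric]
    by (rule pd_cong[OF open_U x]) (simp_all add: hodge diffble[OF smooth_on_nth[OF open_U shd] x])
  have "extd (\<lambda>y. hodge (g y) (\<beta> y)) x $ 1 $ 2 = ?W x * divergence1 \<beta> x"
    unfolding extd_def vec_lambda_beta h1 h2 p divergence1_def
    by (simp add: sum_2 L_sym[OF x, of _ 2 1] algebra_simps)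
  then show ?thesis
    using D(4) by (simp add: codiff_def hodge2_def area_form_def)
qed

end

section \<open>The Ricci tensor of a connection with difference tensor\<close>

context metric_chart
begin

lemma pd_plus:
  assumes x: "x \<in> U" and "smooth_on A U" and "\<And>y. y \<in> U \<Longrightarrow> \<Gamma> y = L y + A y"
  shows "pd k \<Gamma> x = pd k L x + pd k A x"
proof -
  have "pd k (\<lambda>y. L y + A y) x = pd k \<Gamma> x"
    by (rule pd_cong[OF open_U x]) (auto simp: assms(3) intro!: diffble x smooth_rules smooth_L assms(2))
  then show ?thesis using pd_add[OF diffble[OF smooth_L x] diffble[OF assms(2) x]] by simp
qed

lemma pd_trace:
  assumes x: "x \<in> U" and "smooth_on A U"
  shows "pd i (\<lambda>y. \<Sum>k\<in>UNIV. A y $ k $ k $ j) x = (\<Sum>k\<in>UNIV. pd i A x $ k $ k $ j)"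
proof -
  have "pd i (\<lambda>y. \<Sum>k\<in>UNIV. A y $ k $ k $ j) x = (\<Sum>k\<in>UNIV. pd i (\<lambda>y. A y $ k $ k $ j) x)"
    by (rule pd_sum) (intro diffble x smooth_rules assms(2))
  then show ?thesis by (simp add: pd_nth3 diffble assms(2) x)
qed

text \<open>The terms linear in \<open>A\<close> assemble to covariant derivatives \<open>D\<^sub>k A\<^sup>k\<^sub>i\<^sub>j - D\<^sub>i A\<^sup>k\<^sub>k\<^sub>j\<close>; here the
  symmetry of the Christoffel symbols is used.\<close>

lemma ricci_difference:
  assumes x: "x \<in> U" and A: "smooth_on A U" and \<Gamma>: "\<And>y. y \<in> U \<Longrightarrow> \<Gamma> y = L y + A y"
  shows "ricci \<Gamma> x $ i $ j = ricci L x $ i $ j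
     + (\<Sum>k\<in>UNIV. pd k A x $ k $ i $ j + (\<Sum>m\<in>UNIV. L x $ k $ k $ m * A x $ m $ i $ j - L x $ m $ k $ i * A x $ k $ m $ j - L x $ m $ k $ j * A x $ k $ i $ m))
     - (pd i (\<lambda>y. \<Sum>k\<in>UNIV. A y $ k $ k $ j) x - (\<Sum>m\<in>UNIV. L x $ m $ i $ j * (\<Sum>k\<in>UNIV. A x $ k $ k $ m)))
     + (\<Sum>k\<in>UNIV. \<Sum>m\<in>UNIV. A x $ k $ k $ m * A x $ m $ i $ j - A x $ k $ i $ m * A x $ m $ k $ j)"
proof -
  have p: "pd k \<Gamma> x = pd k L x + pd k A x" for k by (rule pd_plus[OF x A \<Gamma>])
  show ?thesis
    unfolding ricci_def riem_def pd_trace[OF x A] p \<Gamma>[OF x]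
    by (simp add: sum_2 L_sym[OF x, of _ 1 i] L_sym[OF x, of _ 2 i] algebra_simps)
qed

lemma smooth_raise1: "smooth_on \<beta> U \<Longrightarrow> smooth_on (\<lambda>y. raise1 (g y) (\<beta> y)) U"
  unfolding raise1_def by (intro smooth_rules smooth_h)

lemma smooth_raise3: "smooth_on P U \<Longrightarrow> smooth_on (\<lambda>y. raise3 (g y) (P y)) U"
  unfolding raise3_def by (intro smooth_rules smooth_h)

lemma smooth_if: "(Q \<Longrightarrow> smooth_on f U) \<Longrightarrow> smooth_on (\<lambda>y. if Q then f y else 0) U"
  by (cases Q) (auto simp: open_U)

lemma smooth_difference_tensor:
  "smooth_on \<beta> U \<Longrightarrow> smooth_on P U \<Longrightarrow> smooth_on (\<lambda>y. difference_tensor s (g y) (\<beta> y) (P y)) U"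
  unfolding difference_tensor_def by (intro smooth_rules smooth_raise1 smooth_raise3 smooth_g smooth_if)

lemma pd_difference_tensor:
  assumes x: "x \<in> U" and b: "smooth_on \<beta> U" and P: "smooth_on P U"
  shows "pd k (\<lambda>y. difference_tensor s (g y) (\<beta> y) (P y)) x $ l $ i $ j =
     pd k g x $ i $ j * raise1 (g x) (\<beta> x) $ l + g x $ i $ j * pd k (\<lambda>y. raise1 (g y) (\<beta> y) $ l) x
     - (if l = i then pd k \<beta> x $ j else 0) - (if l = j then pd k \<beta> x $ i else 0)
     + s * pd k (\<lambda>y. raise3 (g y) (P y) $ l $ i $ j) x"
proof -
  let ?A = "\<lambda>y. difference_tensor s (g y) (\<beta> y) (P y)"
  have d: "(\<lambda>y. g y $ i $ j) differentiable at x" "(\<lambda>y. raise1 (g y) (\<beta> y) $ l) differentiable at x"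
    "(\<lambda>y. raise3 (g y) (P y) $ l $ i $ j) differentiable at x"
    by (intro diffble x smooth_rules smooth_g smooth_raise1 smooth_raise3 b P)+
  have di: "(\<lambda>y. if Q then \<beta> y $ j else 0) differentiable at x" for Q j
    by (intro diffble x smooth_rules smooth_if b)
  have pi: "pd k (\<lambda>y. if Q then \<beta> y $ j else 0) x = (if Q then pd k \<beta> x $ j else 0)" for Q j
    by (simp add: pd_nth diffble x b)
  have "pd k ?A x $ l $ i $ j = pd k (\<lambda>y. ?A y $ l $ i $ j) x"
    by (simp add: pd_nth3 diffble x smooth_difference_tensor b P)
  also have "\<dots> = pd k (\<lambda>y. g y $ i $ j * raise1 (g y) (\<beta> y) $ l - (if l = i then \<beta> y $ j else 0) - (if l = j then \<beta> y $ i else 0)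
      + s * raise3 (g y) (P y) $ l $ i $ j) x"
    by (simp add: difference_tensor_def)
  also have "\<dots> = pd k (\<lambda>y. g y $ i $ j * raise1 (g y) (\<beta> y) $ l) x - (if l = i then pd k \<beta> x $ j else 0) - (if l = j then pd k \<beta> x $ i else 0)
      + pd k (\<lambda>y. s * raise3 (g y) (P y) $ l $ i $ j) x"
  proof -
    have "(\<lambda>y. g y $ i $ j * raise1 (g y) (\<beta> y) $ l) differentiable at x" "(\<lambda>y. s * raise3 (g y) (P y) $ l $ i $ j) differentiable at x"
      using d by (auto intro!: differentiable_mult)
    then show ?thesis
      using di by (simp only: pd_add pd_diff pi differentiable_diff)
  qed
  finally show ?thesis
    using pd_mult[OF d(1,2), of k] pd_mult[OF differentiable_const d(3), of k s] by (simp add: pd_nth2 diffble x smooth_g)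
qed

text \<open>As \<open>g\<close> and its inverse are parallel, only \<open>\<beta>\<close> and \<open>P\<close> get differentiated.\<close>

lemma divergence_difference_tensor:
  fixes s :: real
  assumes x: "x \<in> U" and b: "smooth_on \<beta> U" and P: "smooth_on P U"
  defines "A \<equiv> \<lambda>y. difference_tensor s (g y) (\<beta> y) (P y)"
  shows "(\<Sum>k\<in>UNIV. pd k A x $ k $ i $ j + (\<Sum>m\<in>UNIV. L x $ k $ k $ m * A x $ m $ i $ j - L x $ m $ k $ i * A x $ k $ m $ j - L x $ m $ k $ j * A x $ k $ i $ m))
    = g x $ i $ j * divergence1 \<beta> x - cov1 \<beta> x i j - cov1 \<beta> x j i + s * divergence3 P x i j"
proof -
  define u where "u = raise1 (g x) (\<beta> x)"
  define M where "M = raise3 (g x) (P x)"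
  have A: "A x $ l $ i $ j = g x $ i $ j * u $ l - (if l = i then \<beta> x $ j else 0) - (if l = j then \<beta> x $ i else 0) + s * M $ l $ i $ j" for l i j
    by (simp add: A_def difference_tensor_def u_def M_def)
  have pA: "pd k A x $ k $ i $ j = pd k g x $ i $ j * u $ k
     + g x $ i $ j * ((\<Sum>p\<in>UNIV. h x $ k $ p * cov1 \<beta> x k p) - (\<Sum>m\<in>UNIV. L x $ k $ k $ m * u $ m))
     - (if k = i then cov1 \<beta> x k j + (\<Sum>m\<in>UNIV. L x $ m $ k $ j * \<beta> x $ m) else 0)
     - (if k = j then cov1 \<beta> x k i + (\<Sum>m\<in>UNIV. L x $ m $ k $ i * \<beta> x $ m) else 0)
     + s * ((\<Sum>p\<in>UNIV. h x $ k $ p * cov3 P x k $ p $ i $ j)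
       - (\<Sum>m\<in>UNIV. L x $ k $ k $ m * M $ m $ i $ j - L x $ m $ k $ i * M $ k $ m $ j - L x $ m $ k $ j * M $ k $ i $ m))" for k i j
    unfolding A_def pd_difference_tensor[OF x b P] pd_raise1[OF x b] pd_raise3[OF x P] u_def[symmetric] M_def[symmetric]
    by (simp add: cov1_def)
  have "\<forall>i j. (\<Sum>k\<in>UNIV. pd k A x $ k $ i $ j + (\<Sum>m\<in>UNIV. L x $ k $ k $ m * A x $ m $ i $ j - L x $ m $ k $ i * A x $ k $ m $ j - L x $ m $ k $ j * A x $ k $ i $ m))
    = g x $ i $ j * divergence1 \<beta> x - cov1 \<beta> x i j - cov1 \<beta> x j i + s * divergence3 P x i j"
    unfolding pA A divergence1_def divergence3_def compat[OF x] forall_2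
    by (simp add: sum_2 L_sym[OF x, of _ 2 1] algebra_simps)
  then show ?thesis by blast
qed

text \<open>The three lines are the pure trace part, the skew part and the symmetric trace-free part of the
  Ricci tensor.  The trace \<open>A\<^sup>k\<^sub>k\<^sub>j = - 2 \<beta>\<^sub>j\<close> is responsible for the skew part.\<close>

lemma ricci_decomposition:
  assumes x: "x \<in> U" and b: "smooth_on \<beta> U" and P: "smooth_on P U" and s: "s * s = 1"
    and sym: "\<And>y. y \<in> U \<Longrightarrow> symmetric3 (P y)" and tr: "\<And>y. y \<in> U \<Longrightarrow> tr3 (g y) (P y) = 0"
    and \<Gamma>: "\<And>y. y \<in> U \<Longrightarrow> \<Gamma> y = L y + difference_tensor s (g y) (\<beta> y) (P y)"
  shows "ricci \<Gamma> x $ i $ j =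
     (gauss_curvature g x + divergence1 \<beta> x - 2 * cubic_norm_sq (g x) (cubic_of (g x) (P x))) * g x $ i $ j
     + (cov1 \<beta> x i j - cov1 \<beta> x j i)
     + s * (divergence3 P x i j - 2 * (\<Sum>m\<in>UNIV. raise1 (g x) (\<beta> x) $ m * P x $ m $ i $ j))"
proof -
  have t: "(\<Sum>k\<in>UNIV. difference_tensor s (g y) (\<beta> y) (P y) $ k $ k $ j) = - 2 * \<beta> y $ j" if "y \<in> U" for y j
    by (rule difference_tensor_trace[OF metric sym tr]) (rule that)+
  have "pd i (\<lambda>y. - 2 * \<beta> y $ j) x = pd i (\<lambda>y. \<Sum>k\<in>UNIV. difference_tensor s (g y) (\<beta> y) (P y) $ k $ k $ j) x"
    by (rule pd_cong[OF open_U x t[symmetric]]) (auto intro!: diffble x smooth_rules b)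
  moreover have "pd i (\<lambda>y. - 2 * \<beta> y $ j) x = - 2 * pd i \<beta> x $ j"
    using pd_mult[OF differentiable_const diffble[OF smooth_on_nth[OF open_U b] x], of i "-2" j]
    by (simp add: pd_nth diffble x b)
  ultimately have t': "pd i (\<lambda>y. \<Sum>k\<in>UNIV. difference_tensor s (g y) (\<beta> y) (P y) $ k $ k $ j) x = - 2 * pd i \<beta> x $ j"
    by simp
  have rd: "ricci \<Gamma> x $ i $ j = ricci L x $ i $ j
     + (\<Sum>k\<in>UNIV. pd k A x $ k $ i $ j + (\<Sum>m\<in>UNIV. L x $ k $ k $ m * A x $ m $ i $ j - L x $ m $ k $ i * A x $ k $ m $ j - L x $ m $ k $ j * A x $ k $ i $ m))
     - (pd i (\<lambda>y. \<Sum>k\<in>UNIV. A y $ k $ k $ j) x - (\<Sum>m\<in>UNIV. L x $ m $ i $ j * (\<Sum>k\<in>UNIV. A x $ k $ k $ m)))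
     + (\<Sum>k\<in>UNIV. \<Sum>m\<in>UNIV. A x $ k $ k $ m * A x $ m $ i $ j - A x $ k $ i $ m * A x $ m $ k $ j)"
    if "A = (\<lambda>y. difference_tensor s (g y) (\<beta> y) (P y))" for A
    unfolding that by (rule ricci_difference[OF x smooth_difference_tensor[OF b P] \<Gamma>])
  show ?thesis
    unfolding rd[OF refl] divergence_difference_tensor[OF x b P] t' t[OF x]
      difference_tensor_quadratic[OF metric[OF x] sym[OF x] tr[OF x] s] ricci_L[OF x]
    by (simp add: cov1_def sum_2 algebra_simps)
qed

lemma symmetric3_cov3:
  assumes x: "x \<in> U" and P: "smooth_on P U" and sym: "\<And>y. y \<in> U \<Longrightarrow> symmetric3 (P y)"
  shows "symmetric3 (cov3 P x k)"
proof -
  have pd: "pd k P x $ i $ j $ l = pd k P x $ i' $ j' $ l'"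
    if "\<And>y. y \<in> U \<Longrightarrow> P y $ i $ j $ l = P y $ i' $ j' $ l'" for i j l i' j' l'
  proof -
    have "pd k (\<lambda>y. P y $ i $ j $ l) x = pd k (\<lambda>y. P y $ i' $ j' $ l') x"
      by (rule pd_cong[OF open_U x that]) (auto intro!: diffble x smooth_rules P)
    then show ?thesis by (simp add: pd_nth3 diffble x P)
  qed
  have s: "P y $ i $ j $ l = P y $ j $ i $ l" "P y $ i $ j $ l = P y $ i $ l $ j" if "y \<in> U" for y i j l
    using sym[OF that] unfolding symmetric3_def by blast+
  have q: "pd k P x $ i $ j $ l = pd k P x $ j $ i $ l" "pd k P x $ i $ j $ l = pd k P x $ i $ l $ j" for i j l
    by (rule pd; erule s)+
  note e = symmetric3_eqs[OF sym[OF x]]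
  have q': "pd k P x $ 1 $ 2 $ 1 = pd k P x $ 1 $ 1 $ 2" "pd k P x $ 2 $ 1 $ 1 = pd k P x $ 1 $ 1 $ 2"
    "pd k P x $ 2 $ 1 $ 2 = pd k P x $ 1 $ 2 $ 2" "pd k P x $ 2 $ 2 $ 1 = pd k P x $ 1 $ 2 $ 2"
    using q by metis+
  show ?thesis
    unfolding symmetric3_def forall_2 cov3_def by (simp add: sum_2 e q' algebra_simps)
qed

lemma tr3_cov3:
  assumes x: "x \<in> U" and P: "smooth_on P U" and tr: "\<And>y. y \<in> U \<Longrightarrow> tr3 (g y) (P y) = 0"
  shows "tr3 (g x) (cov3 P x k) = 0"
proof -
  have "tr3 (g x) (cov3 P x k) $ l = 0" for l
  proof -
    have z: "(\<Sum>i\<in>UNIV. \<Sum>j\<in>UNIV. h y $ i $ j * P y $ i $ j $ l) = 0" if "y \<in> U" for y l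
      using arg_cong[OF tr[OF that], of "\<lambda>v. v $ l"] by (simp add: tr3_def)
    have "pd k (\<lambda>y. \<Sum>i\<in>UNIV. \<Sum>j\<in>UNIV. h y $ i $ j * P y $ i $ j $ l) x = pd k (\<lambda>y. 0) x"
      by (rule pd_cong[OF open_U x z]) (auto intro!: diffble x smooth_rules P smooth_h)
    moreover have "pd k (\<lambda>y. \<Sum>i\<in>UNIV. \<Sum>j\<in>UNIV. h y $ i $ j * P y $ i $ j $ l) x =
       (\<Sum>i\<in>UNIV. pd k (\<lambda>y. \<Sum>j\<in>UNIV. h y $ i $ j * P y $ i $ j $ l) x)"
      by (rule pd_sum) (intro diffble x smooth_rules P smooth_h)
    moreover have "pd k (\<lambda>y. \<Sum>j\<in>UNIV. h y $ i $ j * P y $ i $ j $ l) x =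
      (\<Sum>j\<in>UNIV. pd k (\<lambda>y. h y $ i $ j) x * P x $ i $ j $ l + h x $ i $ j * pd k (\<lambda>y. P y $ i $ j $ l) x)" for i
      by (rule pd_contract[OF x]; intro smooth_rules smooth_h P)
    ultimately have e: "(\<Sum>i\<in>UNIV. \<Sum>j\<in>UNIV. pd k (\<lambda>y. h y $ i $ j) x * P x $ i $ j $ l + h x $ i $ j * pd k P x $ i $ j $ l) = 0"
      by (simp add: pd_nth3 diffble x P)
    have "tr3 (g x) (cov3 P x k) $ l = (\<Sum>i\<in>UNIV. \<Sum>j\<in>UNIV. pd k (\<lambda>y. h y $ i $ j) x * P x $ i $ j $ l + h x $ i $ j * pd k P x $ i $ j $ l)
       - (\<Sum>m\<in>UNIV. L x $ m $ k $ l * (\<Sum>i\<in>UNIV. \<Sum>j\<in>UNIV. h x $ i $ j * P x $ i $ j $ m))"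
      unfolding inverse_compat[OF x] tr3_def cov3_def by (simp add: sum_2 algebra_simps)
    then show ?thesis unfolding e z[OF x] by simp
  qed
  then show ?thesis by (simp add: vec_eq_iff)
qed

lemma inverse_sym: "x \<in> U \<Longrightarrow> h x $ i $ j = h x $ j $ i"
  using metric_inverse(3)[OF metric] by blast

lemma trace_split:
  assumes x: "x \<in> U" and "\<And>i j. a * g x $ i $ j + Z i j = 0" and "(\<Sum>i\<in>UNIV. \<Sum>j\<in>UNIV. h x $ i $ j * Z i j) = 0"
  shows "a = 0" "Z i j = 0"
proof -
  have "0 = (\<Sum>i\<in>UNIV. \<Sum>j\<in>UNIV. h x $ i $ j * (a * g x $ i $ j + Z i j))" using assms(2) by simp
  also have "\<dots> = a * (\<Sum>i\<in>UNIV. \<Sum>j\<in>UNIV. h x $ i $ j * g x $ j $ i) + (\<Sum>i\<in>UNIV. \<Sum>j\<in>UNIV. h x $ i $ j * Z i j)"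
    using metric_inverse(4)[OF metric[OF x], of 1 2] by (simp add: sum_2 algebra_simps)
  finally show "a = 0" using assms(3) metric_inverse(2)[OF metric[OF x]] by simp
  with assms(2)[of i j] show "Z i j = 0" by simp
qed

text \<open>A tensor of the form \<open>a g + skew + symmetric trace-free\<close> vanishes only if each summand does.\<close>

lemma structure_equations:
  assumes x: "x \<in> U" and b: "smooth_on \<beta> U" and P: "smooth_on P U" and s: "s * s = 1"
    and sym: "\<And>y. y \<in> U \<Longrightarrow> symmetric3 (P y)" and tr: "\<And>y. y \<in> U \<Longrightarrow> tr3 (g y) (P y) = 0"
    and \<Gamma>: "\<And>y. y \<in> U \<Longrightarrow> \<Gamma> y = L y + difference_tensor s (g y) (\<beta> y) (P y)"
    and einstein: "ricci \<Gamma> x = s *\<^sub>R g x"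
  shows "gauss_curvature g x = s + 2 * cubic_norm_sq (g x) (cubic_of (g x) (P x)) - divergence1 \<beta> x"
    and "cov1 \<beta> x i j = cov1 \<beta> x j i"
    and "divergence3 P x i j = 2 * (\<Sum>m\<in>UNIV. raise1 (g x) (\<beta> x) $ m * P x $ m $ i $ j)"
proof -
  define a where "a = gauss_curvature g x + divergence1 \<beta> x - 2 * cubic_norm_sq (g x) (cubic_of (g x) (P x)) - s"
  define Z where "Z i j = s * (divergence3 P x i j - 2 * (\<Sum>m\<in>UNIV. raise1 (g x) (\<beta> x) $ m * P x $ m $ i $ j))" for i j
  have eq: "a * g x $ i $ j + (cov1 \<beta> x i j - cov1 \<beta> x j i) + Z i j = 0" for i j
  proof -
    have "ricci \<Gamma> x $ i $ j =
     (gauss_curvature g x + divergence1 \<beta> x - 2 * cubic_norm_sq (g x) (cubic_of (g x) (P x))) * g x $ i $ j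
     + (cov1 \<beta> x i j - cov1 \<beta> x j i)
     + s * (divergence3 P x i j - 2 * (\<Sum>m\<in>UNIV. raise1 (g x) (\<beta> x) $ m * P x $ m $ i $ j))"
      by (rule ricci_decomposition[OF x b P s sym tr \<Gamma>])
    then show ?thesis using einstein by (simp add: a_def Z_def algebra_simps)
  qed
  have sc: "cov3 P x k $ p $ i $ j = cov3 P x k $ i $ j $ p" "cov3 P x k $ p $ i $ j = cov3 P x k $ p $ j $ i" for k p i j
  proof -
    have "symmetric3 (cov3 P x k)" by (rule symmetric3_cov3[OF x P sym])
    then show "cov3 P x k $ p $ i $ j = cov3 P x k $ i $ j $ p" "cov3 P x k $ p $ i $ j = cov3 P x k $ p $ j $ i"
      unfolding symmetric3_def by metis+
  qed
  have sp: "P x $ p $ i $ j = P x $ i $ j $ p" "P x $ p $ i $ j = P x $ p $ j $ i" for p i j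
    using sym[OF x] unfolding symmetric3_def by metis+
  have Zsym: "Z i j = Z j i" for i j
    unfolding Z_def divergence3_def by (simp add: sc(2)[of _ _ i j] sp(2)[of _ i j])
  have gs: "g x $ i $ j = g x $ j $ i" for i j using metric_inverse(4)[OF metric[OF x]] .
  have closed: "cov1 \<beta> x i j = cov1 \<beta> x j i" for i j
    using eq[of i j] eq[of j i] Zsym[of i j] gs[of i j] by simp
  then show "cov1 \<beta> x i j = cov1 \<beta> x j i" .
  have e0: "a * g x $ i $ j + Z i j = 0" for i j using eq[of i j] closed[of i j] by simp
  have tc: "(\<Sum>i\<in>UNIV. \<Sum>j\<in>UNIV. h x $ i $ j * cov3 P x k $ p $ i $ j) = 0" for k p
  proof -
    have "tr3 (g x) (cov3 P x k) = 0" by (rule tr3_cov3[OF x P tr])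
    then have "tr3 (g x) (cov3 P x k) $ p = 0" by simp
    then show ?thesis unfolding sc(1)[of k p] by (simp add: tr3_def)
  qed
  have tp: "(\<Sum>i\<in>UNIV. \<Sum>j\<in>UNIV. h x $ i $ j * P x $ p $ i $ j) = 0" for p
    unfolding sp(1)[of p] using arg_cong[OF tr[OF x], of "\<lambda>v. v $ p"] by (simp add: tr3_def)
  have "(\<Sum>i\<in>UNIV. \<Sum>j\<in>UNIV. h x $ i $ j * Z i j) =
     s * ((\<Sum>k\<in>UNIV. \<Sum>p\<in>UNIV. h x $ k $ p * (\<Sum>i\<in>UNIV. \<Sum>j\<in>UNIV. h x $ i $ j * cov3 P x k $ p $ i $ j))
       - 2 * (\<Sum>m\<in>UNIV. raise1 (g x) (\<beta> x) $ m * (\<Sum>i\<in>UNIV. \<Sum>j\<in>UNIV. h x $ i $ j * P x $ m $ i $ j)))"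
    unfolding Z_def divergence3_def by (simp add: sum_2 algebra_simps)
  then have zt: "(\<Sum>i\<in>UNIV. \<Sum>j\<in>UNIV. h x $ i $ j * Z i j) = 0" unfolding tc tp by simp
  from trace_split[OF x e0 zt] have "a = 0" "Z i j = 0" for i j by auto
  then show "gauss_curvature g x = s + 2 * cubic_norm_sq (g x) (cubic_of (g x) (P x)) - divergence1 \<beta> x"
    by (simp add: a_def)
  show "divergence3 P x i j = 2 * (\<Sum>m\<in>UNIV. raise1 (g x) (\<beta> x) $ m * P x $ m $ i $ j)"
    using \<open>\<And>i j. Z i j = 0\<close>[of i j] s by (auto simp: Z_def)
qed

lemma extd_cov1:
  assumes x: "x \<in> U"
  shows "extd \<beta> x = (\<chi> i j. cov1 \<beta> x i j - cov1 \<beta> x j i)"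
  by (simp add: vec_eq_iff extd_def cov1_def L_sym[OF x, of _ _ _])

section \<open>The Dolbeault operator in terms of the Levi-Civita connection\<close>

lemma smooth_cubic_of: "smooth_on P U \<Longrightarrow> smooth_on (\<lambda>y. cubic_of (g y) (P y)) U"
  unfolding cubic_of_def by (intro smooth_rules smooth_cstr)

lemma pd_of_real: "f differentiable at x \<Longrightarrow> pd k (\<lambda>y. complex_of_real (f y)) x = complex_of_real (pd k f x)"
  by (rule pd_linear[OF bounded_linear_of_real])

text \<open>The extra summands are those of a covariant derivative: \<open>C = P - \<i> P(J\<cdot>,\<cdot>,\<cdot>)\<close> and \<open>J\<close> is
  parallel, so covariant differentiation of \<open>C\<close> acts on \<open>P\<close> alone.\<close>

lemma pd_cubic_of:
  assumes x: "x \<in> U" and P: "smooth_on P U"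
  shows "pd m (\<lambda>y. cubic_of (g y) (P y)) x $ i $ j $ k = cubic_of (g x) (cov3 P x m) $ i $ j $ k
    + (\<Sum>n\<in>UNIV. complex_of_real (L x $ n $ m $ i) * cubic_of (g x) (P x) $ n $ j $ k
        + complex_of_real (L x $ n $ m $ j) * cubic_of (g x) (P x) $ i $ n $ k
        + complex_of_real (L x $ n $ m $ k) * cubic_of (g x) (P x) $ i $ j $ n)"
proof -
  let ?Q = "\<lambda>y. \<Sum>n\<in>UNIV. cstr (g y) $ n $ i * P y $ n $ j $ k"
  have sQ: "smooth_on ?Q U" by (intro smooth_rules smooth_cstr P)
  have sP: "smooth_on (\<lambda>y. P y $ i $ j $ k) U" by (intro smooth_rules P)
  have "pd m (\<lambda>y. cubic_of (g y) (P y)) x $ i $ j $ k = pd m (\<lambda>y. cubic_of (g y) (P y) $ i $ j $ k) x"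
    by (simp add: pd_nth3 diffble smooth_cubic_of P x)
  also have "\<dots> = pd m (\<lambda>y. complex_of_real (P y $ i $ j $ k) - \<i> * complex_of_real (?Q y)) x"
    by (simp add: cubic_of_def)
  also have "\<dots> = pd m (\<lambda>y. complex_of_real (P y $ i $ j $ k)) x - pd m (\<lambda>y. \<i> * complex_of_real (?Q y)) x"
    by (rule pd_diff; intro diffble x smooth_rules sQ P smooth_cstr)
  also have "pd m (\<lambda>y. \<i> * complex_of_real (?Q y)) x = \<i> * pd m (\<lambda>y. complex_of_real (?Q y)) x"
    using pd_mult[OF differentiable_const, of "\<lambda>y. complex_of_real (?Q y)" x m \<i>] diffble[OF smooth_on_of_real[OF open_U sQ] x] by simp
  also have "pd m (\<lambda>y. complex_of_real (?Q y)) x = complex_of_real (pd m ?Q x)"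
    by (rule pd_of_real[OF diffble[OF sQ x]])
  also have "pd m ?Q x = (\<Sum>n\<in>UNIV. pd m (\<lambda>y. cstr (g y) $ n $ i) x * P x $ n $ j $ k + cstr (g x) $ n $ i * pd m (\<lambda>y. P y $ n $ j $ k) x)"
    by (rule pd_contract[OF x]; intro smooth_rules smooth_cstr P)
  also have "pd m (\<lambda>y. complex_of_real (P y $ i $ j $ k)) x = complex_of_real (pd m P x $ i $ j $ k)"
    using pd_of_real[OF diffble[OF sP x]] by (simp add: pd_nth3 diffble P x)
  finally show ?thesis
    unfolding cstr_compat[OF x] pd_nth3[OF diffble[OF P x]]
    by (simp add: cubic_of_def cov3_def sum_2 algebra_simps)
qed

lemma pd_dbar_vec:
  assumes x: "x \<in> U"
  shows "pd k (\<lambda>y. dbar_vec (g y) l) x $ m = (\<Sum>r\<in>UNIV. complex_of_real (L x $ r $ k $ l) * dbar_vec (g x) r $ m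
     - complex_of_real (L x $ m $ k $ r) * dbar_vec (g x) l $ r)"
proof -
  have sJ: "smooth_on (\<lambda>y. cstr (g y) $ m $ l) U" for m by (intro smooth_rules smooth_cstr)
  have form: "dbar_vec (g y) l $ m = (if m = l then 1/2 else 0) + (\<i>/2) * complex_of_real (cstr (g y) $ m $ l)" for y m
    by (simp add: dbar_vec_def field_simps)
  have "smooth_on (\<lambda>y. \<chi> m. (if m = l then 1/2 else 0) + (\<i>/2) * complex_of_real (cstr (g y) $ m $ l)) U"
    by (intro smooth_rules sJ)
  moreover have "(\<lambda>y. dbar_vec (g y) l) = (\<lambda>y. \<chi> m. (if m = l then 1/2 else 0) + (\<i>/2) * complex_of_real (cstr (g y) $ m $ l))"
    by (simp add: fun_eq_iff vec_eq_iff form)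
  ultimately have "smooth_on (\<lambda>y. dbar_vec (g y) l) U" by simp
  then have "pd k (\<lambda>y. dbar_vec (g y) l) x $ m = pd k (\<lambda>y. dbar_vec (g y) l $ m) x"
    by (simp add: pd_nth diffble x)
  also have "\<dots> = pd k (\<lambda>y. (if m = l then 1/2 else 0) + (\<i>/2) * complex_of_real (cstr (g y) $ m $ l)) x"
    unfolding form ..
  also have "\<dots> = pd k (\<lambda>y. (\<i>/2) * complex_of_real (cstr (g y) $ m $ l)) x"
  proof -
    have "smooth_on (\<lambda>y. (\<i>/2) * complex_of_real (cstr (g y) $ m $ l)) U" by (intro smooth_rules sJ)
    from pd_add[OF differentiable_const diffble[OF this x]] show ?thesis by (simp only: pd_const add_0)
  qed
  also have "\<dots> = (\<i>/2) * complex_of_real (pd k (\<lambda>y. cstr (g y) $ m $ l) x)"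
    using pd_mult[OF differentiable_const diffble[OF smooth_on_of_real[OF open_U sJ] x], of k "\<i>/2" m]
    by (simp add: pd_of_real diffble[OF sJ x])
  also have "\<dots> = (\<Sum>r\<in>UNIV. complex_of_real (L x $ r $ k $ l) * dbar_vec (g x) r $ m
     - complex_of_real (L x $ m $ k $ r) * dbar_vec (g x) l $ r)"
  proof -
    have "\<forall>m l. (\<i>/2) * complex_of_real (\<Sum>r\<in>UNIV. L x $ r $ k $ l * cstr (g x) $ m $ r - L x $ m $ k $ r * cstr (g x) $ r $ l) =
      (\<Sum>r\<in>UNIV. complex_of_real (L x $ r $ k $ l) * dbar_vec (g x) r $ m - complex_of_real (L x $ m $ k $ r) * dbar_vec (g x) l $ r)"
      unfolding forall_2 by (simp add: dbar_vec_def sum_2 field_simps)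
    then show ?thesis unfolding cstr_compat[OF x] by blast
  qed
  finally show ?thesis .
qed

text \<open>The Lie derivative along a vector field may be computed with the torsion-free connection \<open>D\<close>.  The
  fields \<open>X\<^sub>l\<close> form a parallel tensor, so their covariant derivatives are combinations of (0,1)-vectors
  \<open>X\<^sub>r\<close>, and these annihilate \<open>C\<close>.\<close>

lemma delbar_cov3:
  assumes x: "x \<in> U" and P: "smooth_on P U"
    and sym: "\<And>y. y \<in> U \<Longrightarrow> symmetric3 (P y)" and tr: "\<And>y. y \<in> U \<Longrightarrow> tr3 (g y) (P y) = 0"
  shows "delbar g (\<lambda>y. cubic_of (g y) (P y)) x $ l $ i $ j $ k =
    (\<Sum>m\<in>UNIV. dbar_vec (g x) l $ m * cubic_of (g x) (cov3 P x m) $ i $ j $ k)"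
proof -
  define C where "C = cubic_of (g x) (P x)"
  define X where "X l = dbar_vec (g x) l" for l
  have t30: "type30 (g x) C" unfolding C_def by (rule type30_cubic_of[OF metric sym tr]) (rule x)+
  note z = dbar_vec_type30[OF t30, folded X_def]
  have "delbar g (\<lambda>y. cubic_of (g y) (P y)) x $ l $ i $ j $ k =
    (\<Sum>m\<in>UNIV. X l $ m * cubic_of (g x) (cov3 P x m) $ i $ j $ k)
    + (\<Sum>r\<in>UNIV. complex_of_real (L x $ r $ i $ l) * (\<Sum>m\<in>UNIV. X r $ m * C $ m $ j $ k))
    + (\<Sum>r\<in>UNIV. complex_of_real (L x $ r $ j $ l) * (\<Sum>m\<in>UNIV. X r $ m * C $ i $ m $ k))
    + (\<Sum>r\<in>UNIV. complex_of_real (L x $ r $ k $ l) * (\<Sum>m\<in>UNIV. X r $ m * C $ i $ j $ m))"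
    unfolding delbar_def vec_lambda_beta Let_def pd_dbar_vec[OF x] pd_cubic_of[OF x P] C_def[symmetric] X_def[symmetric]
    by (simp add: sum_2 L_sym[OF x, of _ i] L_sym[OF x, of _ j] L_sym[OF x, of _ k] algebra_simps)
  then show ?thesis unfolding z by (simp add: X_def)
qed

lemma cubic_of_diff_scale:
  "cubic_of G (S - r *\<^sub>R T) $ i $ j $ k = cubic_of G S $ i $ j $ k - complex_of_real r * cubic_of G T $ i $ j $ k"
  by (simp add: cubic_of_def sum_2 algebra_simps)

text \<open>The hypothesis on the divergence of \<open>P\<close> says that \<open>DP - 2 \<beta> \<otimes> P\<close> is divergence-free, so that
  \<open>DC - 2 \<beta> \<otimes> C\<close> has no (0,1)-part; and the (0,1)-part of \<open>2 \<beta>\<close> is \<open>\<beta> - \<i> \<star>\<beta>\<close>.\<close>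

lemma delbar_equation:
  assumes x: "x \<in> U" and P: "smooth_on P U"
    and sym: "\<And>y. y \<in> U \<Longrightarrow> symmetric3 (P y)" and tr: "\<And>y. y \<in> U \<Longrightarrow> tr3 (g y) (P y) = 0"
    and div: "\<And>i j. divergence3 P x i j = 2 * (\<Sum>m\<in>UNIV. raise1 (g x) (\<beta> x) $ m * P x $ m $ i $ j)"
  shows "delbar g (\<lambda>y. cubic_of (g y) (P y)) x $ l $ i $ j $ k =
    (complex_of_real (\<beta> x $ l) - \<i> * hodge (g x) (\<beta> x) $ l) * cubic_of (g x) (P x) $ i $ j $ k"
proof -
  define T where "T m = cov3 P x m - (2 * \<beta> x $ m) *\<^sub>R P x" for m
  have Ts: "symmetric3 (T m)" for m
  proof -
    have "symmetric3 (cov3 P x m)" by (rule symmetric3_cov3[OF x P sym])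
    then show ?thesis using sym[OF x] by (simp add: T_def symmetric3_def)
  qed
  have lin: "tr3 G (S - r *\<^sub>R S') = tr3 G S - r *\<^sub>R tr3 G S'" for G S S' r
    by (simp add: tr3_def vec_eq_iff sum_2 algebra_simps)
  have Tt: "tr3 (g x) (T m) = 0" for m
  proof -
    have "tr3 (g x) (cov3 P x m) = 0" by (rule tr3_cov3[OF x P tr])
    then show ?thesis using tr[OF x] by (simp add: T_def lin)
  qed
  have "(\<Sum>m\<in>UNIV. \<Sum>n\<in>UNIV. h x $ m $ n * T m $ n $ i $ j) = 0" for i j
  proof -
    have "(\<Sum>m\<in>UNIV. \<Sum>n\<in>UNIV. h x $ m $ n * T m $ n $ i $ j) = divergence3 P x i j - 2 * (\<Sum>n\<in>UNIV. raise1 (g x) (\<beta> x) $ n * P x $ n $ i $ j)"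
      unfolding divergence3_def T_def raise1_def using inverse_sym[OF x, of 2 1] by (simp add: sum_2 algebra_simps)
    then show ?thesis using div by simp
  qed
  from divergence_free_imp_holomorphic[OF metric[OF x] Ts Tt this]
  have "(\<Sum>m\<in>UNIV. dbar_vec (g x) l $ m * cubic_of (g x) (T m) $ i $ j $ k) = 0" .
  then have "(\<Sum>m\<in>UNIV. dbar_vec (g x) l $ m * cubic_of (g x) (cov3 P x m) $ i $ j $ k) =
     2 * (\<Sum>m\<in>UNIV. dbar_vec (g x) l $ m * complex_of_real (\<beta> x $ m)) * cubic_of (g x) (P x) $ i $ j $ k"
    unfolding T_def cubic_of_diff_scale by (simp add: sum_2 algebra_simps)
  moreover have "delbar g (\<lambda>y. cubic_of (g y) (P y)) x $ l $ i $ j $ k =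
      (\<Sum>m\<in>UNIV. dbar_vec (g x) l $ m * cubic_of (g x) (cov3 P x m) $ i $ j $ k)"
    by (rule delbar_cov3[OF x P sym tr])
  ultimately show ?thesis
    unfolding dbar_vec_one_form[OF metric[OF x]] by simp
qed

end

section \<open>Minimality of the zero section\<close>

lemma sum_UNIV_Plus: "(\<Sum>u\<in>(UNIV :: ('a::finite + 'b::finite) set). f u) = (\<Sum>i\<in>UNIV. f (Inl i)) + (\<Sum>i\<in>UNIV. f (Inr i))"
  unfolding UNIV_Plus_UNIV[symmetric] by (subst sum.Plus) auto

lemma differentiable_vec_lambda:
  fixes f :: "'n::finite \<Rightarrow> 'a::real_normed_vector \<Rightarrow> 'b::real_normed_vector"
  assumes "\<And>i. f i differentiable at x"
  shows "(\<lambda>x. \<chi> i. f i x) differentiable at x"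
  unfolding vec_lambda_axis
  by (intro differentiable_sum ballI finite)
     (use assms bounded_linear.has_derivative[OF bounded_linear_axis] in \<open>auto simp: differentiable_def, blast\<close>)

lemma linear_base: "bounded_linear base"
proof -
  have "linear base" by (rule linearI) (simp_all add: base_def vec_eq_iff)
  then show ?thesis by (simp add: linear_conv_bounded_linear)
qed

lemma linear_fibre: "bounded_linear fibre"
proof -
  have "linear fibre" by (rule linearI) (simp_all add: fibre_def vec_eq_iff)
  then show ?thesis by (simp add: linear_conv_bounded_linear)
qed

lemma linear_zero_section: "bounded_linear zero_section"
proof -
  have "linear zero_section" by (rule linearI) (simp_all add: zero_section_def vec_eq_iff split: sum.split)
  then show ?thesis by (simp add: linear_conv_bounded_linear)
qed

lemma pd_bounded_linear: "bounded_linear f \<Longrightarrow> pd i f x = f (axis i 1)"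
  by (rule pd_has_derivative) (rule bounded_linear_imp_has_derivative)

lemma differentiable_bounded_linear: "bounded_linear f \<Longrightarrow> f differentiable at x"
  using bounded_linear_imp_has_derivative differentiable_def by blast

lemma zero_section_simps [simp]: "base (zero_section x) = x" "fibre (zero_section x) = 0"
  by (simp_all add: base_def fibre_def zero_section_def vec_eq_iff)

lemma pd_base: "pd (Inl k) base p = axis k 1" "pd (Inr k) base p = 0"
  by (simp_all add: pd_bounded_linear linear_base base_def axis_def vec_eq_iff)

lemma pd_fibre: "pd (Inl k) fibre p = 0" "pd (Inr k) fibre p = axis k 1"
  by (simp_all add: pd_bounded_linear linear_fibre fibre_def axis_def vec_eq_iff)

lemma pd_zero_section: "pd i zero_section x = axis (Inl i) 1"
  by (simp add: pd_bounded_linear linear_zero_section zero_section_def axis_def vec_eq_iff split: sum.split)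

lemma h_metric_nth:
  "h_metric \<Gamma> p $ Inl i $ Inl j = - (\<Sum>k\<in>UNIV. fibre p $ k * ((\<Gamma> (base p) $ k $ i $ j + \<Gamma> (base p) $ k $ j $ i) / 2))
      - fibre p $ i * fibre p $ j - (schout \<Gamma> (base p) $ i $ j + schout \<Gamma> (base p) $ j $ i) / 2"
  "h_metric \<Gamma> p $ Inl i $ Inr l = (if i = l then 1/2 else 0)"
  "h_metric \<Gamma> p $ Inr l $ Inl i = (if i = l then 1/2 else 0)"
  "h_metric \<Gamma> p $ Inr l $ Inr k = 0"
proof -
  have d: "psi_dx \<Gamma> p $ u $ Inl j = psi \<Gamma> p $ j $ u" "psi_dx \<Gamma> p $ u $ Inr j = 0" for u j
    by (simp_all add: psi_dx_def if_distrib cong: if_cong)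
  show "h_metric \<Gamma> p $ Inl i $ Inl j = - (\<Sum>k\<in>UNIV. fibre p $ k * ((\<Gamma> (base p) $ k $ i $ j + \<Gamma> (base p) $ k $ j $ i) / 2))
      - fibre p $ i * fibre p $ j - (schout \<Gamma> (base p) $ i $ j + schout \<Gamma> (base p) $ j $ i) / 2"
    by (simp add: h_metric_def transpose_def d psi_def Let_def sum_2 field_simps)
  show "h_metric \<Gamma> p $ Inl i $ Inr l = (if i = l then 1/2 else 0)"
    "h_metric \<Gamma> p $ Inr l $ Inl i = (if i = l then 1/2 else 0)" "h_metric \<Gamma> p $ Inr l $ Inr k = 0"
    by (auto simp: h_metric_def transpose_def d psi_def Let_def)
qed

text \<open>Positivity together with the symmetry of \<open>s Ric(\<nabla>)\<close> encodes that \<open>\<nabla>\<close> is Lagrangian and timelike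
  (\<open>s = 1\<close>) or spacelike (\<open>s = -1\<close>).\<close>

locale minimal_lagrangian_chart =
  fixes U :: "(real^2) set" and \<Gamma> :: "real^2 \<Rightarrow> real^2^2^2" and s :: real
  assumes open_chart: "open U"
    and smooth_\<Gamma>: "smooth_on \<Gamma> U"
    and torsion: "\<And>x k i j. x \<in> U \<Longrightarrow> \<Gamma> x $ k $ i $ j = \<Gamma> x $ k $ j $ i"
    and s: "s * s = 1"
    and definite: "\<And>x. x \<in> U \<Longrightarrow> inner_product (s *\<^sub>R ricci \<Gamma> x)"
    and minimal: "\<And>x. x \<in> U \<Longrightarrow> trace_second_fundamental_form (h_metric \<Gamma>) zero_section x = 0"
begin

definition g :: "real^2 \<Rightarrow> real^2^2" where "g x = s *\<^sub>R ricci \<Gamma> x"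

lemma smooth_ricci: "smooth_on (ricci \<Gamma>) U"
  unfolding ricci_def[abs_def] riem_def
  by (intro smooth_on_vec_lambda smooth_on_sum smooth_on_add smooth_on_diff smooth_on_mult smooth_on_nth smooth_on_pd
      smooth_\<Gamma> open_chart)

lemma smooth_metric: "smooth_on g U"
  unfolding g_def[abs_def] by (rule smooth_on_linear[OF open_chart bounded_linear_scaleR_right smooth_ricci])

sublocale metric_chart U g
  by unfold_locales (simp_all add: open_chart smooth_metric, simp add: g_def definite)

lemma ricci_g: "ricci \<Gamma> x = s *\<^sub>R g x"
  using s by (simp add: g_def)

lemma ricci_symm: "x \<in> U \<Longrightarrow> ricci \<Gamma> x $ i $ j = ricci \<Gamma> x $ j $ i"
  using metric_inverse(4)[OF metric, of x i j] by (simp add: ricci_g)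

lemma schout_eq: "x \<in> U \<Longrightarrow> schout \<Gamma> x = ricci \<Gamma> x"
  by (simp add: schout_def ricci_sym_def ricci_skew_def vec_eq_iff transpose_def)
     (simp add: ricci_symm)

definition A :: "real^2 \<Rightarrow> real^2^2^2" where "A x = \<Gamma> x - L x"

definition A_low :: "real^2 \<Rightarrow> real^2^2^2" where
  "A_low x = (\<chi> k i j. \<Sum>l\<in>UNIV. g x $ k $ l * A x $ l $ i $ j)"

lemma differentiable_base_comp: "x \<in> U \<Longrightarrow> smooth_on f U \<Longrightarrow> (\<lambda>p. f (base p)) differentiable at (zero_section x)"
  by (rule differentiable_chain[OF differentiable_bounded_linear[OF linear_base]]) (simp add: diffble)

lemma pd_base_comp:
  fixes f :: "real^2 \<Rightarrow> real"
  assumes "x \<in> U" "smooth_on f U"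
  shows "pd (Inl k) (\<lambda>p. f (base p)) (zero_section x) = pd k f x" "pd (Inr k) (\<lambda>p. f (base p)) (zero_section x) = 0"
proof -
  have c: "pd u (\<lambda>p. f (base p)) (zero_section x) = (\<Sum>a\<in>UNIV. pd u base (zero_section x) $ a *\<^sub>R pd a f x)" for u
    using pd_chain[OF differentiable_bounded_linear[OF linear_base], of f "zero_section x" u] diffble[OF assms(2,1)] by simp
  show "pd (Inl k) (\<lambda>p. f (base p)) (zero_section x) = pd k f x"
    unfolding c pd_base by (simp add: axis_def if_distribR if_distrib cong: if_cong)
  show "pd (Inr k) (\<lambda>p. f (base p)) (zero_section x) = 0"
    unfolding c pd_base by simp
qed

lemma smooth_schout: "smooth_on (schout \<Gamma>) U"
  by (rule smooth_on_cong[OF open_chart schout_eq[symmetric] smooth_ricci])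

lemma differentiable_fibre: "(\<lambda>p. fibre p $ k) differentiable at p"
  by (rule differentiable_nth[OF differentiable_bounded_linear[OF linear_fibre]])

lemma pd_fibre_nth: "pd u (\<lambda>p. fibre p $ k) p = (if u = Inr k then 1 else 0)"
  unfolding pd_nth[OF differentiable_bounded_linear[OF linear_fibre]]
  by (cases u) (auto simp: pd_fibre axis_def)

lemma differentiable_h_metric:
  assumes x: "x \<in> U"
  shows "h_metric \<Gamma> differentiable at (zero_section x)"
proof -
  have "(\<lambda>p. h_metric \<Gamma> p $ u $ v) differentiable at (zero_section x)" for u v
  proof (cases u; cases v)
    fix i j assume uv: "u = Inl i" "v = Inl j"
    have 1: "(\<lambda>p. (\<Gamma> (base p) $ k $ i $ j + \<Gamma> (base p) $ k $ j $ i) / 2) differentiable at (zero_section x)" for k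
      by (rule differentiable_base_comp[OF x, of "\<lambda>y. (\<Gamma> y $ k $ i $ j + \<Gamma> y $ k $ j $ i) / 2"])
         (simp only: divide_inverse, intro smooth_rules smooth_\<Gamma>)
    have 2: "(\<lambda>p. (schout \<Gamma> (base p) $ i $ j + schout \<Gamma> (base p) $ j $ i) / 2) differentiable at (zero_section x)"
      by (rule differentiable_base_comp[OF x, of "\<lambda>y. (schout \<Gamma> y $ i $ j + schout \<Gamma> y $ j $ i) / 2"])
         (simp only: divide_inverse, intro smooth_rules smooth_schout)
    show ?thesis unfolding uv h_metric_nth
      by (intro differentiable_diff differentiable_minus differentiable_sum differentiable_mult ballI finite
          differentiable_fibre 1 2)
  qed (auto simp: h_metric_nth)
  then have "(\<lambda>p. \<chi> u v. h_metric \<Gamma> p $ u $ v) differentiable at (zero_section x)"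
    by (intro differentiable_vec_lambda)
  then show ?thesis by simp
qed

lemma pd_h_metric:
  assumes x: "x \<in> U"
  shows "pd (Inl k) (h_metric \<Gamma>) (zero_section x) $ Inl i $ Inl j = - pd k (ricci \<Gamma>) x $ i $ j" (is ?A)
    "pd (Inr k) (h_metric \<Gamma>) (zero_section x) $ Inl i $ Inl j = - \<Gamma> x $ k $ i $ j" (is ?B)
    "pd u (h_metric \<Gamma>) (zero_section x) $ Inr l $ v = 0" (is ?C)
proof -
  let ?p = "zero_section x"
  have n: "pd u (h_metric \<Gamma>) ?p $ a $ b = pd u (\<lambda>p. h_metric \<Gamma> p $ a $ b) ?p" for u a b
    using pd_nth[OF differentiable_h_metric[OF x]] pd_nth[OF differentiable_nth[OF differentiable_h_metric[OF x]]] by simp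
  show ?C unfolding n by (cases v) (simp_all add: h_metric_nth)
  define G where "G k y = (\<Gamma> y $ k $ i $ j + \<Gamma> y $ k $ j $ i) / 2" for k y
  define S where "S y = (schout \<Gamma> y $ i $ j + schout \<Gamma> y $ j $ i) / 2" for y
  have sG: "smooth_on (G k) U" for k unfolding G_def[abs_def] by (simp only: divide_inverse, intro smooth_rules smooth_\<Gamma>)
  have sS: "smooth_on S U" unfolding S_def[abs_def] by (simp only: divide_inverse, intro smooth_rules smooth_schout)
  note d = differentiable_base_comp[OF x sG] differentiable_base_comp[OF x sS] differentiable_fibre
  have "pd u (h_metric \<Gamma>) ?p $ Inl i $ Inl j = pd u (\<lambda>p. - (\<Sum>k\<in>UNIV. fibre p $ k * G k (base p)) - fibre p $ i * fibre p $ j - S (base p)) ?p" for u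
    unfolding n h_metric_nth G_def S_def ..
  also have "\<dots> u = - (\<Sum>k\<in>UNIV. (if u = Inr k then 1 else 0) * G k x) - pd u (\<lambda>p. S (base p)) ?p" for u
  proof -
    have m: "(\<lambda>p. fibre p $ k * G k (base p)) differentiable at ?p" for k by (intro differentiable_mult d)
    have m': "(\<lambda>p. fibre p $ i * fibre p $ j) differentiable at ?p" by (intro differentiable_mult d)
    have sm: "(\<lambda>p. \<Sum>k\<in>UNIV. fibre p $ k * G k (base p)) differentiable at ?p" by (intro differentiable_sum m ballI finite)
    show ?thesis
      unfolding pd_diff[OF differentiable_diff[OF differentiable_minus[OF sm] m'] d(2)] pd_diff[OF differentiable_minus[OF sm] m']
        pd_minus[OF sm] pd_sum[OF m] pd_mult[OF d(3) d(1)] pd_mult[OF d(3) d(3)] pd_fibre_nth by simp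
  qed
  finally have e: "pd u (h_metric \<Gamma>) ?p $ Inl i $ Inl j = - (\<Sum>k\<in>UNIV. (if u = Inr k then 1 else 0) * G k x) - pd u (\<lambda>p. S (base p)) ?p" for u .
  have "pd k S x = pd k (\<lambda>y. ricci \<Gamma> y $ i $ j) x"
    by (rule pd_cong[OF open_chart x _ diffble[OF sS x]]) (simp add: S_def schout_eq ricci_symm[of _ j i])
  then show ?A unfolding e pd_base_comp[OF x sS] by (simp add: pd_nth2 diffble[OF smooth_ricci x])
  show ?B unfolding e pd_base_comp[OF x sS] using torsion[OF x, of k j i]
    by (simp add: G_def if_distribR if_distrib cong: if_cong)
qed

lemma matrix_inv_h_metric:
  assumes x: "x \<in> U"
  shows "matrix_inv (h_metric \<Gamma> (zero_section x)) $ Inr k $ Inl l = (if k = l then 2 else 0)"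
    "matrix_inv (h_metric \<Gamma> (zero_section x)) $ Inr k $ Inr l = 4 * ricci \<Gamma> x $ k $ l"
proof -
  define N :: "real^(2+2)^(2+2)" where "N = (\<chi> u v. case u of Inl i \<Rightarrow> (case v of Inl j \<Rightarrow> 0 | Inr j \<Rightarrow> if i = j then 2 else 0)
     | Inr i \<Rightarrow> (case v of Inl j \<Rightarrow> if i = j then 2 else 0 | Inr j \<Rightarrow> 4 * ricci \<Gamma> x $ i $ j))"
  have "(h_metric \<Gamma> (zero_section x) ** N) $ u $ v = (mat 1 :: real^(2+2)^(2+2)) $ u $ v" for u v
    by (cases u; cases v)
       (simp_all add: matrix_matrix_mult_def sum_UNIV_Plus h_metric_nth N_def mat_def schout_eq[OF x] ricci_symm[OF x, of 2 1]
          if_distrib if_distribR cong: if_cong, (simp add: ricci_symm[OF x])?)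
  then have "matrix_inv (h_metric \<Gamma> (zero_section x)) = N"
    by (intro matrix_inv_unique) (simp add: vec_eq_iff)
  then show "matrix_inv (h_metric \<Gamma> (zero_section x)) $ Inr k $ Inl l = (if k = l then 2 else 0)"
    "matrix_inv (h_metric \<Gamma> (zero_section x)) $ Inr k $ Inr l = 4 * ricci \<Gamma> x $ k $ l"
    by (simp_all add: N_def)
qed

lemma pd_ricci: "x \<in> U \<Longrightarrow> pd k (ricci \<Gamma>) x = s *\<^sub>R pd k g x"
  using pd_linear[OF bounded_linear_scaleR_right diffble[OF smooth_metric], of x k s]
  unfolding ricci_g[symmetric] by simp

text \<open>A fibre row of the inverse of \<open>h\<close> consists of twice the identity, which picks up first derivatives
  of the Ricci tensor, that is the Levi-Civita connection of \<open>g\<close>, and of \<open>4 Ric(\<nabla>)\<close>, which is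
  contracted with \<open>\<Gamma>\<close>, the negative fibre derivative of \<open>h\<close>.\<close>

lemma christoffel_h_metric:
  assumes x: "x \<in> U"
  shows "christoffel (h_metric \<Gamma>) (zero_section x) $ Inr k $ Inl i $ Inl j = 2 * s * A_low x $ k $ i $ j"
proof -
  have "christoffel (h_metric \<Gamma>) (zero_section x) $ Inr k $ Inl i $ Inl j =
      - pd i (ricci \<Gamma>) x $ k $ j - pd j (ricci \<Gamma>) x $ k $ i + pd k (ricci \<Gamma>) x $ i $ j
      + 2 * (\<Sum>l\<in>UNIV. ricci \<Gamma> x $ k $ l * \<Gamma> x $ l $ i $ j)"
    unfolding christoffel_def vec_lambda_beta sum_UNIV_Plus matrix_inv_h_metric[OF x] pd_h_metric[OF x]
    by (simp add: if_distribR if_distrib sum_distrib_left cong: if_cong) (simp add: sum_2)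
  also have "\<dots> = s * (2 * (\<Sum>l\<in>UNIV. g x $ k $ l * \<Gamma> x $ l $ i $ j) - (pd i g x $ k $ j + pd j g x $ k $ i - pd k g x $ i $ j))"
    unfolding pd_ricci[OF x] ricci_g by (simp add: sum_2 algebra_simps)
  also have "\<dots> = s * (2 * (\<Sum>l\<in>UNIV. g x $ k $ l * \<Gamma> x $ l $ i $ j) - 2 * (\<Sum>l\<in>UNIV. g x $ k $ l * L x $ l $ i $ j))"
    unfolding lower_L[OF x] by (simp add: field_simps)
  finally show ?thesis by (simp add: A_low_def A_def sum_2 algebra_simps)
qed

text \<open>Vectors tangent to the zero section have no fibre component, so the normal projection leaves fibre
  components unchanged and minimality is a statement about the Christoffel symbols of \<open>h\<close> alone.\<close>

lemma A_trace_free: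
  assumes x: "x \<in> U"
  shows "(\<Sum>i\<in>UNIV. \<Sum>j\<in>UNIV. h x $ i $ j * A_low x $ k $ i $ j) = 0"
proof -
  let ?H = "h_metric \<Gamma>" and ?o = "zero_section :: real^2 \<Rightarrow> real^(2+2)"
  have am: "ambient_derivative ?H ?o x i j $ Inr k = 2 * s * A_low x $ k $ i $ j" for i j
  proof -
    have "pd j ?o = (\<lambda>y. axis (Inl j) 1)" by (simp add: fun_eq_iff pd_zero_section)
    then have d: "pd i (pd j ?o) x = 0" by simp
    have ax: "(axis (Inl a) 1 :: real^(2+2)) $ Inl b = (if b = a then 1 else 0)"
      "(axis (Inl a) 1 :: real^(2+2)) $ Inr b = 0" for a b :: 2
      by (auto simp: axis_def)
    have "ambient_derivative ?H ?o x i j $ Inr k = christoffel ?H (?o x) $ Inr k $ Inl i $ Inl j"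
      unfolding ambient_derivative_def d pd_zero_section vector_add_component vec_lambda_beta sum_UNIV_Plus ax
      using exhaust_2[of i] exhaust_2[of j] by (auto simp: sum_2)
    then show ?thesis unfolding christoffel_h_metric[OF x] .
  qed
  have np: "normal_part ?H ?o x v $ Inr k = v $ Inr k" for v
    by (simp add: normal_part_def pd_zero_section axis_def)
  have im: "induced_metric ?H ?o x = - (s *\<^sub>R g x)"
    unfolding induced_metric_def pd_zero_section
    using ricci_symm[OF x]
    by (simp add: vec_eq_iff inner_axis' matrix_vector_mult_basis column_def h_metric_nth schout_eq[OF x] ricci_g[symmetric])
  have inv: "matrix_inv (induced_metric ?H ?o x) = - (s *\<^sub>R h x)"
  proof (rule matrix_inv_unique)
    have "det (g x) \<noteq> 0" using inner_productD(4)[OF metric[OF x]] by simp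
    from matrix_inv_mult(1)[OF this] have e: "g x ** h x = mat 1" .
    have "(induced_metric ?H ?o x ** - (s *\<^sub>R h x)) = (s * s) *\<^sub>R (g x ** h x)"
      unfolding im by (simp add: vec_eq_iff matrix_matrix_mult_def sum_2 algebra_simps)
    then show "induced_metric ?H ?o x ** - (s *\<^sub>R h x) = mat 1" using e s by simp
  qed
  have "trace_second_fundamental_form ?H ?o x $ Inr k = 0" using minimal[OF x] by simp
  then have "(\<Sum>i\<in>UNIV. \<Sum>j\<in>UNIV. - (s * h x $ i $ j) * (2 * s * A_low x $ k $ i $ j)) = 0"
    unfolding trace_second_fundamental_form_def second_fundamental_form_def inv by (simp add: np am)
  moreover have "(\<Sum>i\<in>UNIV. \<Sum>j\<in>UNIV. - (s * h x $ i $ j) * (2 * s * A_low x $ k $ i $ j)) =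
     - 2 * (s * s) * (\<Sum>i\<in>UNIV. \<Sum>j\<in>UNIV. h x $ i $ j * A_low x $ k $ i $ j)"
    by (simp add: sum_2 algebra_simps)
  ultimately show ?thesis using s by simp
qed

section \<open>The structure equations in a chart\<close>

definition \<beta> :: "real^2 \<Rightarrow> real^2" where "\<beta> x = (3/8) *\<^sub>R tr3 (g x) (Sym (nabla \<Gamma> g x))"
definition P :: "real^2 \<Rightarrow> real^2^2^2" where "P x = - (s/2) *\<^sub>R Sym0 (g x) (nabla \<Gamma> g x)"

text \<open>Since \<open>Dg = 0\<close>, only the difference tensor contributes to \<open>\<nabla>g\<close>.\<close>

lemma nabla_A: "x \<in> U \<Longrightarrow> nabla \<Gamma> g x $ i $ j $ k = - A_low x $ k $ i $ j - A_low x $ j $ i $ k"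
proof -
  assume x: "x \<in> U"
  show ?thesis
    unfolding nabla_def vec_lambda_beta compat[OF x] A_low_def A_def
    by (simp add: sum_2 metric_inverse(4)[OF metric[OF x], of _ k] metric_inverse(4)[OF metric[OF x], of _ j] algebra_simps)
qed

lemma connection_decomposition:
  assumes x: "x \<in> U"
  shows "\<Gamma> x = L x + difference_tensor s (g x) (\<beta> x) (P x)"
proof -
  have low: "A_low x $ k $ i $ j = g x $ i $ j * \<beta> x $ k - g x $ k $ i * \<beta> x $ j - g x $ k $ j * \<beta> x $ i + s * P x $ k $ i $ j" for k i j
    unfolding \<beta>_def P_def
  proof (rule difference_decomposition[OF metric[OF x] s _ A_trace_free[OF x] nabla_A[OF x]])
    show "A_low x $ k $ i $ j = A_low x $ k $ j $ i" for k i j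
      by (simp add: A_low_def A_def torsion[OF x, of _ i j] L_sym[OF x, of _ i j])
  qed
  have hg: "(\<Sum>p\<in>UNIV. h x $ l $ p * (\<Sum>m\<in>UNIV. g x $ p $ m * f m)) = f l" for f l
  proof -
    have "(\<Sum>p\<in>UNIV. h x $ l $ p * (\<Sum>m\<in>UNIV. g x $ p $ m * f m)) = (\<Sum>m\<in>UNIV. (\<Sum>p\<in>UNIV. h x $ l $ p * g x $ p $ m) * f m)"
      by (simp add: sum_2 algebra_simps)
    then show ?thesis
      unfolding metric_inverse(2)[OF metric[OF x]] by (simp add: if_distrib if_distribR cong: if_cong)
  qed
  have "A x $ l $ i $ j = difference_tensor s (g x) (\<beta> x) (P x) $ l $ i $ j" for l i j
  proof -
    have "A x $ l $ i $ j = (\<Sum>p\<in>UNIV. h x $ l $ p * A_low x $ p $ i $ j)"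
      unfolding A_low_def vec_lambda_beta hg ..
    also have "\<dots> = g x $ i $ j * raise1 (g x) (\<beta> x) $ l - (\<Sum>p\<in>UNIV. h x $ l $ p * g x $ p $ i) * \<beta> x $ j
       - (\<Sum>p\<in>UNIV. h x $ l $ p * g x $ p $ j) * \<beta> x $ i + s * raise3 (g x) (P x) $ l $ i $ j"
      unfolding low by (simp add: raise1_def raise3_def sum_2 algebra_simps)
    finally show ?thesis
      unfolding metric_inverse(2)[OF metric[OF x]] by (simp add: difference_tensor_def)
  qed
  then have "A x = difference_tensor s (g x) (\<beta> x) (P x)" by (simp add: vec_eq_iff)
  then show ?thesis by (simp add: A_def algebra_simps)
qed

lemma smooth_nabla: "smooth_on (nabla \<Gamma> g) U"
  unfolding nabla_def[abs_def] by (intro smooth_rules smooth_\<Gamma> smooth_metric)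

lemma smooth_Sym: "smooth_on T U \<Longrightarrow> smooth_on (\<lambda>x. Sym (T x)) U"
  unfolding Sym_def divide_inverse by (intro smooth_rules)

lemma smooth_tr3: "smooth_on T U \<Longrightarrow> smooth_on (\<lambda>x. tr3 (g x) (T x)) U"
  unfolding tr3_def by (intro smooth_rules smooth_h)

lemma smooth_scale: "smooth_on (f :: real^2 \<Rightarrow> 'b::real_normed_vector) U \<Longrightarrow> smooth_on (\<lambda>x. r *\<^sub>R f x) U"
  by (rule smooth_on_linear[OF open_chart bounded_linear_scaleR_right])

lemma smooth_\<beta>: "smooth_on \<beta> U"
  unfolding \<beta>_def[abs_def] by (intro smooth_scale smooth_tr3 smooth_Sym smooth_nabla)

lemma smooth_P: "smooth_on P U"
  unfolding P_def[abs_def] Sym0_def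
  by (intro smooth_scale smooth_on_diff[OF open_chart] smooth_Sym smooth_nabla) (intro smooth_rules smooth_tr3 smooth_Sym smooth_nabla smooth_metric)

lemma symmetric3_P: "symmetric3 (P x)"
  unfolding P_def by (intro symmetric3_scale symmetric3_Sym0)

lemma tr3_P: "x \<in> U \<Longrightarrow> tr3 (g x) (P x) = 0"
proof -
  assume x: "x \<in> U"
  have "tr3 G (r *\<^sub>R T) = r *\<^sub>R tr3 G T" for G r T by (simp add: tr3_def vec_eq_iff sum_2 algebra_simps)
  then show ?thesis unfolding P_def by (simp only: tr3_Sym0[OF metric[OF x]] scaleR_zero_right)
qed

definition C :: "real^2 \<Rightarrow> complex^2^2^2" where "C x = cubic_of (g x) (P x)"

lemma chart_equations:
  assumes x: "x \<in> U"
  shows "type30 (g x) (C x)"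
    and "(\<chi> i j k. Re (C x $ i $ j $ k)) = - (s/2) *\<^sub>R Sym0 (g x) (nabla \<Gamma> g x)"
    and "gauss_curvature g x = s + 2 * cubic_norm_sq (g x) (C x) + codiff g \<beta> x"
    and "delbar g C x $ l $ i $ j $ k = (complex_of_real (\<beta> x $ l) - \<i> * hodge (g x) (\<beta> x) $ l) * C x $ i $ j $ k"
    and "extd \<beta> x = 0"
proof -
  show "type30 (g x) (C x)"
    unfolding C_def by (rule type30_cubic_of[OF metric[OF x] symmetric3_P tr3_P[OF x]])
  show "(\<chi> i j k. Re (C x $ i $ j $ k)) = - (s/2) *\<^sub>R Sym0 (g x) (nabla \<Gamma> g x)"
    unfolding C_def Re_cubic_of by (simp add: vec_eq_iff P_def)
  have eq: "gauss_curvature g x = s + 2 * cubic_norm_sq (g x) (cubic_of (g x) (P x)) - divergence1 \<beta> x"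
    "cov1 \<beta> x i j = cov1 \<beta> x j i"
    "divergence3 P x i j = 2 * (\<Sum>m\<in>UNIV. raise1 (g x) (\<beta> x) $ m * P x $ m $ i $ j)" for i j
    by (rule structure_equations[OF x smooth_\<beta> smooth_P s symmetric3_P tr3_P connection_decomposition ricci_g]; assumption)+
  show "gauss_curvature g x = s + 2 * cubic_norm_sq (g x) (C x) + codiff g \<beta> x"
    unfolding eq(1) codiff_divergence[OF x smooth_\<beta>] C_def by simp
  have "C = (\<lambda>y. cubic_of (g y) (P y))" by (simp add: fun_eq_iff C_def)
  moreover have "delbar g (\<lambda>y. cubic_of (g y) (P y)) x $ l $ i $ j $ k =
     (complex_of_real (\<beta> x $ l) - \<i> * hodge (g x) (\<beta> x) $ l) * cubic_of (g x) (P x) $ i $ j $ k"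
    by (rule delbar_equation[OF x smooth_P symmetric3_P tr3_P]) (assumption, rule eq(3))
  ultimately show "delbar g C x $ l $ i $ j $ k = (complex_of_real (\<beta> x $ l) - \<i> * hodge (g x) (\<beta> x) $ l) * C x $ i $ j $ k"
    by simp
  show "extd \<beta> x = 0"
    unfolding extd_cov1[OF x] using eq(2) by (simp add: vec_eq_iff)
qed

lemma smooth_C: "smooth_on C U"
  unfolding C_def[abs_def] by (rule smooth_cubic_of[OF smooth_P])

end

section \<open>Change of coordinates\<close>

lemma jacobian_nth: "jacobian f (at x) $ a $ i = pd i f x $ a"
  by (simp add: jacobian_def matrix_def pd_def)

text \<open>\<open>\<tau>\<close> is a transition map from the overlap \<open>V\<close> into the image \<open>V'\<close> of a second chart; \<open>\<Gamma>\<close> and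
  \<open>\<Gamma>'\<close> are the components of one connection in the two charts.\<close>

locale coordinate_change =
  fixes V V' :: "(real^2) set" and \<tau> :: "real^2 \<Rightarrow> real^2" and \<Gamma> \<Gamma>' :: "real^2 \<Rightarrow> real^2^2^2"
  assumes open_V: "open V" and open_V': "open V'"
    and smooth_\<tau>: "smooth_on \<tau> V" and maps: "\<And>x. x \<in> V \<Longrightarrow> \<tau> x \<in> V'"
    and smooth1: "smooth_on \<Gamma> V" and smooth2: "smooth_on \<Gamma>' V'"
    and oriented: "\<And>x. x \<in> V \<Longrightarrow> det (jacobian \<tau> (at x)) > 0"
    and connection_law: "\<And>x m i j. x \<in> V \<Longrightarrow>
       (\<Sum>k\<in>UNIV. pd k \<tau> x $ m * \<Gamma> x $ k $ i $ j) =
         pd i (pd j \<tau>) x $ m + (\<Sum>a\<in>UNIV. \<Sum>b\<in>UNIV. pd i \<tau> x $ a * pd j \<tau> x $ b * \<Gamma>' (\<tau> x) $ m $ a $ b)"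
begin

abbreviation J where "J x \<equiv> jacobian \<tau> (at x)"

lemma diff_V: "smooth_on f V \<Longrightarrow> x \<in> V \<Longrightarrow> f differentiable at x"
  using smooth_on_differentiable open_V by blast

lemma diff_V': "smooth_on f V' \<Longrightarrow> x \<in> V \<Longrightarrow> f differentiable at (\<tau> x)"
  using smooth_on_differentiable open_V' maps by blast

lemma diff_pull: "smooth_on f V' \<Longrightarrow> x \<in> V \<Longrightarrow> (\<lambda>y. f (\<tau> y)) differentiable at x"
  using differentiable_chain[OF diff_V[OF smooth_\<tau>] diff_V'] by blast

lemma pd_pull:
  fixes f :: "real^2 \<Rightarrow> real"
  shows "smooth_on f V' \<Longrightarrow> x \<in> V \<Longrightarrow> pd i (\<lambda>y. f (\<tau> y)) x = (\<Sum>a\<in>UNIV. pd i \<tau> x $ a * pd a f (\<tau> x))"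
  unfolding real_scaleR_def[symmetric] by (rule pd_chain[OF diff_V[OF smooth_\<tau>] diff_V'])

lemma pd_pd_nth:
  assumes x: "x \<in> V"
  shows "(\<lambda>y. pd j \<tau> y $ m) differentiable at x" "pd k (\<lambda>y. pd j \<tau> y $ m) x = pd k (pd j \<tau>) x $ m"
    "pd k (pd j \<tau>) x $ m = pd j (pd k \<tau>) x $ m"
proof -
  have s: "smooth_on (pd j \<tau>) V" for j by (rule smooth_on_pd[OF smooth_\<tau>])
  show "(\<lambda>y. pd j \<tau> y $ m) differentiable at x" by (rule differentiable_nth[OF diff_V[OF s x]])
  have n: "pd k (\<lambda>y. pd j \<tau> y $ m) x = pd k (pd j \<tau>) x $ m" for k j by (rule pd_nth[OF diff_V[OF s x]])
  then show "pd k (\<lambda>y. pd j \<tau> y $ m) x = pd k (pd j \<tau>) x $ m" .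
  have c: "pd k (\<lambda>y. pd j \<tau> y $ m) x = pd k (pd j (\<lambda>y. \<tau> y $ m)) x" for k j
    by (rule pd_cong[OF open_V x]) (simp_all add: pd_nth diff_V[OF smooth_\<tau>] differentiable_nth[OF diff_V[OF s x]])
  show "pd k (pd j \<tau>) x $ m = pd j (pd k \<tau>) x $ m"
    unfolding n[symmetric] c by (rule pd_commute[OF open_V x smooth_on_nth[OF open_V smooth_\<tau>]])
qed

lemma third_derivative_commute:
  assumes x: "x \<in> V"
  shows "pd k (\<lambda>y. pd i (pd j \<tau>) y $ m) x = pd i (\<lambda>y. pd k (pd j \<tau>) y $ m) x"
proof -
  have s: "smooth_on (pd j \<tau>) V" for j by (rule smooth_on_pd[OF smooth_\<tau>])
  have c: "pd k (\<lambda>y. pd i (pd j \<tau>) y $ m) x = pd k (pd i (\<lambda>y. pd j \<tau> y $ m)) x" for k i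
    by (rule pd_cong[OF open_V x])
       (simp_all add: pd_nth diff_V[OF s] differentiable_nth[OF diff_V[OF smooth_on_pd[OF s] x]])
  show ?thesis
    unfolding c by (rule pd_commute[OF open_V x smooth_on_nth[OF open_V s]])
qed

lemma differentiated_law:
  assumes x: "x \<in> V"
  shows "(\<Sum>l\<in>UNIV. pd k (pd l \<tau>) x $ m * \<Gamma> x $ l $ i $ j + pd l \<tau> x $ m * pd k \<Gamma> x $ l $ i $ j) =
    pd k (\<lambda>y. pd i (pd j \<tau>) y $ m) x +
    (\<Sum>a\<in>UNIV. \<Sum>b\<in>UNIV. (pd k (pd i \<tau>) x $ a * pd j \<tau> x $ b + pd i \<tau> x $ a * pd k (pd j \<tau>) x $ b) * \<Gamma>' (\<tau> x) $ m $ a $ b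
        + pd i \<tau> x $ a * pd j \<tau> x $ b * (\<Sum>c\<in>UNIV. pd k \<tau> x $ c * pd c \<Gamma>' (\<tau> x) $ m $ a $ b))"
proof -
  note dt = pd_pd_nth[OF x]
  have dG: "(\<lambda>y. \<Gamma> y $ l $ i $ j) differentiable at x" for l i j
    by (intro differentiable_nth diff_V[OF smooth1 x])
  have sG': "smooth_on (\<lambda>y. \<Gamma>' y $ m $ a $ b) V'" for m a b by (intro smooth_on_nth open_V' smooth2)
  have dG': "(\<lambda>y. \<Gamma>' (\<tau> y) $ m $ a $ b) differentiable at x" for m a b
    by (rule diff_pull[OF sG' x])
  have pG': "pd k (\<lambda>y. \<Gamma>' (\<tau> y) $ m $ a $ b) x = (\<Sum>c\<in>UNIV. pd k \<tau> x $ c * pd c \<Gamma>' (\<tau> x) $ m $ a $ b)" for m a b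
    by (simp add: pd_pull[OF sG' x] pd_nth3[OF diff_V'[OF smooth2 x]])
  have dlhs: "(\<lambda>y. pd l \<tau> y $ m * \<Gamma> y $ l $ i $ j) differentiable at x" for l
    by (intro differentiable_mult dt dG)
  have dJJ: "(\<lambda>y. pd i \<tau> y $ a * pd j \<tau> y $ b) differentiable at x" for a b by (intro differentiable_mult dt)
  have drhs: "(\<lambda>y. pd i \<tau> y $ a * pd j \<tau> y $ b * \<Gamma>' (\<tau> y) $ m $ a $ b) differentiable at x" for a b
    by (intro differentiable_mult dt dG')
  have drhs': "(\<lambda>y. \<Sum>b\<in>UNIV. pd i \<tau> y $ a * pd j \<tau> y $ b * \<Gamma>' (\<tau> y) $ m $ a $ b) differentiable at x" for a
    by (intro differentiable_sum ballI finite drhs)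
  have drhs'': "(\<lambda>y. \<Sum>a\<in>UNIV. \<Sum>b\<in>UNIV. pd i \<tau> y $ a * pd j \<tau> y $ b * \<Gamma>' (\<tau> y) $ m $ a $ b) differentiable at x"
    by (intro differentiable_sum ballI finite drhs)
  have d3: "(\<lambda>y. pd i (pd j \<tau>) y $ m) differentiable at x"
    by (intro differentiable_nth diff_V[OF smooth_on_pd[OF smooth_on_pd[OF smooth_\<tau>]] x])
  have "pd k (\<lambda>y. \<Sum>l\<in>UNIV. pd l \<tau> y $ m * \<Gamma> y $ l $ i $ j) x =
     pd k (\<lambda>y. pd i (pd j \<tau>) y $ m + (\<Sum>a\<in>UNIV. \<Sum>b\<in>UNIV. pd i \<tau> y $ a * pd j \<tau> y $ b * \<Gamma>' (\<tau> y) $ m $ a $ b)) x"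
    by (rule pd_cong[OF open_V x connection_law]) (auto intro!: differentiable_sum dlhs)
  moreover have "pd k (\<lambda>y. \<Sum>l\<in>UNIV. pd l \<tau> y $ m * \<Gamma> y $ l $ i $ j) x =
     (\<Sum>l\<in>UNIV. pd k (pd l \<tau>) x $ m * \<Gamma> x $ l $ i $ j + pd l \<tau> x $ m * pd k \<Gamma> x $ l $ i $ j)"
    unfolding pd_sum[OF dlhs] pd_mult[OF dt(1) dG] dt(2) pd_nth3[OF diff_V[OF smooth1 x]] ..
  moreover have "pd k (\<lambda>y. pd i (pd j \<tau>) y $ m + (\<Sum>a\<in>UNIV. \<Sum>b\<in>UNIV. pd i \<tau> y $ a * pd j \<tau> y $ b * \<Gamma>' (\<tau> y) $ m $ a $ b)) x
    = pd k (\<lambda>y. pd i (pd j \<tau>) y $ m) x +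
    (\<Sum>a\<in>UNIV. \<Sum>b\<in>UNIV. (pd k (pd i \<tau>) x $ a * pd j \<tau> x $ b + pd i \<tau> x $ a * pd k (pd j \<tau>) x $ b) * \<Gamma>' (\<tau> x) $ m $ a $ b
        + pd i \<tau> x $ a * pd j \<tau> x $ b * (\<Sum>c\<in>UNIV. pd k \<tau> x $ c * pd c \<Gamma>' (\<tau> x) $ m $ a $ b))"
    unfolding pd_add[OF d3 drhs''] pd_sum[OF drhs'] pd_sum[OF drhs] pd_mult[OF dJJ dG'] pd_mult[OF dt(1) dt(1)] dt(2) pG' ..
  ultimately show ?thesis by simp
qed

text \<open>Skew-symmetrising the differentiated law in \<open>k\<close> and \<open>i\<close> removes the third derivatives of \<open>\<tau>\<close>; the
  remaining second derivatives are eliminated with the transformation law itself.\<close>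

lemma riem_transform:
  assumes x: "x \<in> V"
  shows "(\<Sum>l\<in>UNIV. pd l \<tau> x $ m * riem \<Gamma> x k i j l) =
    (\<Sum>a\<in>UNIV. \<Sum>b\<in>UNIV. \<Sum>c\<in>UNIV. pd k \<tau> x $ a * pd i \<tau> x $ b * pd j \<tau> x $ c * riem \<Gamma>' (\<tau> x) a b c m)"
proof -
  have H: "pd i (pd j \<tau>) x $ m = (\<Sum>k\<in>UNIV. pd k \<tau> x $ m * \<Gamma> x $ k $ i $ j)
      - (\<Sum>a\<in>UNIV. \<Sum>b\<in>UNIV. pd i \<tau> x $ a * pd j \<tau> x $ b * \<Gamma>' (\<tau> x) $ m $ a $ b)" for i j m
    using connection_law[OF x, of m i j] by simp
  (* abbreviating these symmetric derivatives protects them from the substitution H *)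
  define S where "S a = pd k (pd i \<tau>) x $ a" for a
  define T where "T = pd k (\<lambda>y. pd i (pd j \<tau>) y $ m) x"
  have S: "pd k (pd i \<tau>) x $ a = S a" "pd i (pd k \<tau>) x $ a = S a" for a
    by (simp_all add: S_def pd_pd_nth(3)[OF x, of i k])
  have T: "pd k (\<lambda>y. pd i (pd j \<tau>) y $ m) x = T" "pd i (\<lambda>y. pd k (pd j \<tau>) y $ m) x = T"
    by (simp_all add: T_def third_derivative_commute[OF x, of i k])
  note d1 = differentiated_law[OF x, of k m i j, unfolded S T]
  note d2 = differentiated_law[OF x, of i m k j, unfolded S T]
  show ?thesis
    using d1 d2 unfolding riem_def H sum_2 by (simp add: algebra_simps)
qed

lemma det_nonzero: "x \<in> V \<Longrightarrow> det (J x) \<noteq> 0"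
  using oriented by fastforce

text \<open>For fixed \<open>i\<close> and \<open>j\<close> the curvature, viewed as an endomorphism, is conjugated by the Jacobian, and the
  Ricci tensor is its trace.\<close>

lemma ricci_transform:
  assumes x: "x \<in> V"
  shows "ricci \<Gamma> x = pull2 (J x) (ricci \<Gamma>' (\<tau> x))"
proof -
  have "ricci \<Gamma> x $ i $ j = pull2 (J x) (ricci \<Gamma>' (\<tau> x)) $ i $ j" for i j
  proof -
    define R :: "real^2^2" where "R = (\<chi> l k. riem \<Gamma> x k i j l)"
    define Q :: "real^2^2" where "Q = (\<chi> m a. \<Sum>b\<in>UNIV. \<Sum>c\<in>UNIV. pd i \<tau> x $ b * pd j \<tau> x $ c * riem \<Gamma>' (\<tau> x) a b c m)"
    note I = matrix_inv_mult[OF det_nonzero[OF x]]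
    have "J x ** R = Q ** J x"
      using riem_transform[OF x, of _ _ i j]
      by (simp add: vec_eq_iff matrix_matrix_mult_def R_def Q_def jacobian_nth sum_2 algebra_simps)
    then have "matrix_inv (J x) ** (J x ** R) = matrix_inv (J x) ** (Q ** J x)" by simp
    then have "R = matrix_inv (J x) ** (Q ** J x)" by (simp only: matrix_mul_assoc I matrix_mul_lid)
    then have "trace R = trace (Q ** J x ** matrix_inv (J x))" using trace_mul_sym by metis
    also have "\<dots> = trace Q" by (simp only: matrix_mul_assoc[symmetric] I matrix_mul_rid)
    finally show ?thesis
      by (simp add: trace_def R_def Q_def ricci_def pull2_def jacobian_nth sum_2 algebra_simps)
  qed
  then show ?thesis by (simp add: vec_eq_iff)
qed

text \<open>The second derivatives of \<open>\<tau>\<close> produced by differentiating the metric cancel those in the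
  transformation law of the connection.\<close>

lemma nabla_transform:
  assumes x: "x \<in> V" and g: "\<And>y. y \<in> V \<Longrightarrow> g y = pull2 (J y) (g' (\<tau> y))"
    and sg: "smooth_on g V" and sg': "smooth_on g' V'"
  shows "nabla \<Gamma> g x = pull3 (J x) (nabla \<Gamma>' g' (\<tau> x))"
proof -
  note dt = pd_pd_nth[OF x]
  have gn: "g y $ j $ k = (\<Sum>a\<in>UNIV. \<Sum>b\<in>UNIV. pd j \<tau> y $ a * pd k \<tau> y $ b * g' (\<tau> y) $ a $ b)" if "y \<in> V" for y j k
    by (simp add: g[OF that] pull2_def jacobian_nth)
  have sg'n: "smooth_on (\<lambda>y. g' y $ a $ b) V'" for a b by (intro smooth_on_nth open_V' sg')
  have dg': "(\<lambda>y. g' (\<tau> y) $ a $ b) differentiable at x" for a b by (rule diff_pull[OF sg'n x])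
  have pg': "pd i (\<lambda>y. g' (\<tau> y) $ a $ b) x = (\<Sum>c\<in>UNIV. pd i \<tau> x $ c * pd c g' (\<tau> x) $ a $ b)" for a b i
    by (simp add: pd_pull[OF sg'n x] pd_nth2[OF diff_V'[OF sg' x]])
  have dJJ: "(\<lambda>y. pd i \<tau> y $ a * pd j \<tau> y $ b) differentiable at x" for a b i j by (intro differentiable_mult dt)
  have dr: "(\<lambda>y. pd j \<tau> y $ a * pd k \<tau> y $ b * g' (\<tau> y) $ a $ b) differentiable at x" for a b j k
    by (intro differentiable_mult dt dg')
  have dr': "(\<lambda>y. \<Sum>b\<in>UNIV. pd j \<tau> y $ a * pd k \<tau> y $ b * g' (\<tau> y) $ a $ b) differentiable at x" for a j k
    by (intro differentiable_sum ballI finite dr)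
  have pg: "pd i g x $ j $ k = (\<Sum>a\<in>UNIV. \<Sum>b\<in>UNIV. (pd i (pd j \<tau>) x $ a * pd k \<tau> x $ b + pd j \<tau> x $ a * pd i (pd k \<tau>) x $ b) * g' (\<tau> x) $ a $ b
     + pd j \<tau> x $ a * pd k \<tau> x $ b * (\<Sum>c\<in>UNIV. pd i \<tau> x $ c * pd c g' (\<tau> x) $ a $ b))" for i j k
  proof -
    have "pd i g x $ j $ k = pd i (\<lambda>y. g y $ j $ k) x" by (simp add: pd_nth2[OF diff_V[OF sg x]])
    also have "\<dots> = pd i (\<lambda>y. \<Sum>a\<in>UNIV. \<Sum>b\<in>UNIV. pd j \<tau> y $ a * pd k \<tau> y $ b * g' (\<tau> y) $ a $ b) x"
      by (rule pd_cong[OF open_V x gn]) (auto intro!: differentiable_nth diff_V[OF sg x])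
    also have "\<dots> = (\<Sum>a\<in>UNIV. \<Sum>b\<in>UNIV. (pd i (pd j \<tau>) x $ a * pd k \<tau> x $ b + pd j \<tau> x $ a * pd i (pd k \<tau>) x $ b) * g' (\<tau> x) $ a $ b
     + pd j \<tau> x $ a * pd k \<tau> x $ b * (\<Sum>c\<in>UNIV. pd i \<tau> x $ c * pd c g' (\<tau> x) $ a $ b))"
      unfolding pd_sum[OF dr'] pd_sum[OF dr] pd_mult[OF dJJ dg'] pd_mult[OF dt(1) dt(1)] dt(2) pg' ..
    finally show ?thesis .
  qed
  have "nabla \<Gamma> g x $ i $ j $ k = pull3 (J x) (nabla \<Gamma>' g' (\<tau> x)) $ i $ j $ k" for i j k
  proof -
    have H: "pd i (pd j \<tau>) x $ m = (\<Sum>k\<in>UNIV. pd k \<tau> x $ m * \<Gamma> x $ k $ i $ j)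
      - (\<Sum>a\<in>UNIV. \<Sum>b\<in>UNIV. pd i \<tau> x $ a * pd j \<tau> x $ b * \<Gamma>' (\<tau> x) $ m $ a $ b)" for i j m
      using connection_law[OF x, of m i j] by simp
    show ?thesis
      unfolding nabla_def pull3_def vec_lambda_beta pg jacobian_nth gn[OF x] H sum_2
      by (simp add: algebra_simps)
  qed
  then show ?thesis by (simp add: vec_eq_iff)
qed

end

text \<open>The overlap is open because a chart is a homeomorphism onto an open set.\<close>

lemma transition_facts:
  assumes S: "oriented_surface X A" and c: "c \<in> A" and c': "c' \<in> A"
  shows "open (overlap c c')" "overlap c c' \<subseteq> cimg c" "transition c c' ` overlap c c' \<subseteq> cimg c'"
    "smooth_on (transition c c') (overlap c c')"
    "\<And>x. x \<in> overlap c c' \<Longrightarrow> det (jacobian (transition c c') (at x)) > 0"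
proof -
  from S c c' have ch: "openin X (cdom c)" "openin X (cdom c')" "open (cimg c)"
    and hm: "homeomorphic_map (subtopology X (cdom c)) (top_of_set (cimg c)) (crd c)"
    unfolding oriented_surface_def by blast+
  have top: "topspace (subtopology X (cdom c)) = cdom c" using openin_subset[OF ch(1)] by auto
  have inj: "inj_on (crd c) (cdom c)" using homeomorphic_imp_injective_map[OF hm] top by simp
  have "openin (subtopology X (cdom c)) (cdom c \<inter> cdom c')"
    using ch(2) by (metis openin_subtopology inf_commute)
  then have "openin (top_of_set (cimg c)) (crd c ` (cdom c \<inter> cdom c'))"
    using homeomorphic_imp_open_map[OF hm] by (simp add: open_map_def)
  then show "open (overlap c c')" unfolding overlap_def using ch(3) openin_open_trans by blast
  show "overlap c c' \<subseteq> cimg c" by (auto simp: overlap_def cimg_def)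
  show "transition c c' ` overlap c c' \<subseteq> cimg c'"
    using inj by (auto simp: overlap_def cimg_def transition_def)
  show "smooth_on (transition c c') (overlap c c')"
    "\<And>x. x \<in> overlap c c' \<Longrightarrow> det (jacobian (transition c c') (at x)) > 0"
    using S c c' unfolding oriented_surface_def by blast+
qed

section \<open>The triple of a minimal Lagrangian connection\<close>

theorem proposition5p1:
  fixes X :: "'a topology" and A :: "'a chart set"
    and \<Gamma> :: "('a, real^2^2^2) field" and s :: real
  assumes "oriented_surface X A"
    and "connection A \<Gamma>" and "torsion_free A \<Gamma>"
    and "timelike A \<Gamma> \<and> s = 1 \<or> spacelike A \<Gamma> \<and> s = -1"
    and "lagrangian A \<Gamma>" and "minimal A \<Gamma>"
  shows "\<exists>g \<beta> C.
      riemannian_metric A g \<and> one_form A \<beta> \<and> cubic_differential A g C \<and>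
      (\<forall>c\<in>A. \<forall>x\<in>cimg c.
         g c x = s *\<^sub>R ricci (\<Gamma> c) x \<and>
         \<beta> c x = (3/8) *\<^sub>R tr3 (g c x) (Sym (nabla (\<Gamma> c) (g c) x)) \<and>
         (\<chi> i j k. Re (C c x $ i $ j $ k)) = - (s/2) *\<^sub>R Sym0 (g c x) (nabla (\<Gamma> c) (g c) x) \<and>
         gauss_curvature (g c) x = s + 2 * cubic_norm_sq (g c x) (C c x) + codiff (g c) (\<beta> c) x \<and>
         (\<forall>l i j k. delbar (g c) (C c) x $ l $ i $ j $ k =
            (complex_of_real (\<beta> c x $ l) - \<i> * hodge (g c x) (\<beta> c x) $ l) * C c x $ i $ j $ k) \<and>
         extd (\<beta> c) x = 0)"
proof -
  have ss: "s * s = 1" using assms(4) by auto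
  have open_img: "open (cimg c)" if "c \<in> A" for c
    using assms(1) that unfolding oriented_surface_def by blast
  have inner: "inner_product (s *\<^sub>R ricci (\<Gamma> c) x)" if c: "c \<in> A" and x: "x \<in> cimg c" for c x
  proof -
    have "ricci_skew (\<Gamma> c) x = 0" using assms(5) c x unfolding lagrangian_def by blast
    then have tr: "transpose (ricci (\<Gamma> c) x) = ricci (\<Gamma> c) x" by (simp add: ricci_skew_def)
    then have rs: "ricci_sym (\<Gamma> c) x = ricci (\<Gamma> c) x" by (simp add: ricci_sym_def flip: scaleR_2)
    have pos: "v \<bullet> (s *\<^sub>R ricci (\<Gamma> c) x *v v) > 0" if "v \<noteq> 0" for v
    proof -
      have "v \<bullet> (s *\<^sub>R ricci (\<Gamma> c) x *v v) = s * (v \<bullet> (ricci (\<Gamma> c) x *v v))"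
        by (simp add: scaleR_matrix_vector_assoc[symmetric])
      then show ?thesis
        using assms(4) c x that unfolding timelike_def spacelike_def rs[symmetric] by auto
    qed
    have "transpose (s *\<^sub>R ricci (\<Gamma> c) x) = s *\<^sub>R ricci (\<Gamma> c) x"
      using tr by (simp add: transpose_scalar)
    then show ?thesis using pos by (simp add: inner_product_def)
  qed
  have chart: "minimal_lagrangian_chart (cimg c) (\<Gamma> c) s" if c: "c \<in> A" for c
  proof
    show "smooth_on (\<Gamma> c) (cimg c)" using assms(2) c by (simp add: connection_def)
    show "\<Gamma> c x $ k $ i $ j = \<Gamma> c x $ k $ j $ i" if "x \<in> cimg c" for x k i j
      using assms(3) c that unfolding torsion_free_def by blast
    show "trace_second_fundamental_form (h_metric (\<Gamma> c)) zero_section x = 0" if "x \<in> cimg c" for x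
      using assms(6) c that unfolding Defs.minimal_def by blast
  qed (use open_img[OF c] ss inner[OF c] in auto)
  define g where "g c = minimal_lagrangian_chart.g (\<Gamma> c) s" for c
  define \<beta> where "\<beta> c = minimal_lagrangian_chart.\<beta> (\<Gamma> c) s" for c
  define P where "P c = minimal_lagrangian_chart.P (\<Gamma> c) s" for c
  define C where "C c = minimal_lagrangian_chart.C (\<Gamma> c) s" for c
  note defs = minimal_lagrangian_chart.g_def[OF chart, folded g_def]
    minimal_lagrangian_chart.\<beta>_def[OF chart, folded g_def \<beta>_def]
    minimal_lagrangian_chart.P_def[OF chart, folded g_def P_def]
    minimal_lagrangian_chart.C_def[OF chart, folded g_def P_def C_def]
  note smooths = minimal_lagrangian_chart.smooth_metric[OF chart, folded g_def]
    minimal_lagrangian_chart.smooth_\<beta>[OF chart, folded \<beta>_def]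
    minimal_lagrangian_chart.smooth_C[OF chart, folded C_def]
  note eqs = minimal_lagrangian_chart.chart_equations[OF chart, folded g_def \<beta>_def C_def]
  have g: "g c x = s *\<^sub>R ricci (\<Gamma> c) x" if "c \<in> A" for c x by (rule defs(1)[OF that])
  have metric: "inner_product (g c x)" if "c \<in> A" "x \<in> cimg c" for c x
    unfolding g[OF that(1)] by (rule inner[OF that])
  have trans: "g c x = pull2 J (g c' y) \<and> \<beta> c x = pull1 J (\<beta> c' y) \<and>
      C c x = cubic_of (pull2 J (g c' y)) (pull3 J (P c' y)) \<and> det J > 0 \<and> det (g c' y) > 0"
    if c: "c \<in> A" and c': "c' \<in> A" and x: "x \<in> overlap c c'"
      and J: "J = jacobian (transition c c') (at x)" and y: "y = transition c c' x" for c c' x J y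
  proof -
    note tf = transition_facts[OF assms(1) c c']
    interpret coordinate_change "overlap c c'" "cimg c'" "transition c c'" "\<Gamma> c" "\<Gamma> c'"
    proof
      show "smooth_on (\<Gamma> c) (overlap c c')" "smooth_on (\<Gamma> c') (cimg c')"
        using assms(2) c c' smooth_on_subset[OF _ tf(2)] by (auto simp: connection_def)
      show "(\<Sum>k\<in>UNIV. pd k (transition c c') x $ m * \<Gamma> c x $ k $ i $ j) =
         pd i (pd j (transition c c')) x $ m + (\<Sum>a\<in>UNIV. \<Sum>b\<in>UNIV. pd i (transition c c') x $ a * pd j (transition c c') x $ b * \<Gamma> c' (transition c c' x) $ m $ a $ b)"
        if "x \<in> overlap c c'" for x m i j
        using assms(2) c c' that unfolding connection_def Let_def jacobian_nth by blast
    qed (use tf open_img[OF c'] in auto)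
    have gt: "g c z = pull2 (jacobian (transition c c') (at z)) (g c' (transition c c' z))" if "z \<in> overlap c c'" for z
      unfolding g[OF c] g[OF c'] ricci_transform[OF that]
      by (simp add: vec_eq_iff pull2_def sum_2 algebra_simps)
    have nt: "nabla (\<Gamma> c) (g c) x = pull3 J (nabla (\<Gamma> c') (g c') y)"
      unfolding J y
      by (rule nabla_transform[OF x gt]) (use smooths(1)[OF c] smooths(1)[OF c'] smooth_on_subset[OF _ tf(2)] in auto)
    have dJ: "det J > 0" using tf(5)[OF x] J by simp
    have "y \<in> cimg c'" using tf(3) x y by auto
    then have dg: "det (g c' y) > 0" using inner_productD(4)[OF metric[OF c']] by blast
    have nz: "det J \<noteq> 0" "det (g c' y) \<noteq> 0" using dJ dg by auto
    have gx: "g c x = pull2 J (g c' y)" using gt[OF x] J y by simp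
    have "\<beta> c x = pull1 J (\<beta> c' y)"
      unfolding defs(2)[OF c] defs(2)[OF c'] nt gx Sym_pull tr3_pull[OF nz]
      by (simp add: vec_eq_iff pull1_def sum_2 algebra_simps)
    moreover have "P c x = pull3 J (P c' y)"
      unfolding defs(3)[OF c] defs(3)[OF c'] nt gx Sym0_pull[OF nz] pull3_scale ..
    then have "C c x = cubic_of (pull2 J (g c' y)) (pull3 J (P c' y))"
      unfolding defs(4)[OF c] gx by simp
    ultimately show ?thesis using gx dJ dg by blast
  qed
  have "riemannian_metric A g"
    unfolding riemannian_metric_def tensor2_field_def Let_def
    using smooths(1) metric trans by (auto simp: inner_product_def pull2_def)
  moreover have "one_form A \<beta>"
    unfolding one_form_def Let_def using smooths(2) trans by (auto simp: pull1_def)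
  moreover have "cubic_differential A g C"
    unfolding cubic_differential_def complex_tensor3_field_def Let_def
  proof (intro conjI ballI allI)
    fix c x assume c: "c \<in> A"
    show "smooth_on (C c) (cimg c)" by (rule smooths(3)[OF c])
    show "type30 (g c x) (C c x)" if "x \<in> cimg c" by (rule eqs(1)[OF c that])
    fix c' i j k assume c': "c' \<in> A" and x: "x \<in> overlap c c'"
    show "C c x $ i $ j $ k = (\<Sum>a\<in>UNIV. \<Sum>b\<in>UNIV. \<Sum>d\<in>UNIV.
       complex_of_real (jacobian (transition c c') (at x) $ a $ i * jacobian (transition c c') (at x) $ b $ j * jacobian (transition c c') (at x) $ d $ k) *
       C c' (transition c c' x) $ a $ b $ d)"
      using trans[OF c c' x refl refl] cubic_of_pull unfolding defs(4)[OF c'] by simp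
  qed
  moreover have "\<forall>c\<in>A. \<forall>x\<in>cimg c.
         g c x = s *\<^sub>R ricci (\<Gamma> c) x \<and>
         \<beta> c x = (3/8) *\<^sub>R tr3 (g c x) (Sym (nabla (\<Gamma> c) (g c) x)) \<and>
         (\<chi> i j k. Re (C c x $ i $ j $ k)) = - (s/2) *\<^sub>R Sym0 (g c x) (nabla (\<Gamma> c) (g c) x) \<and>
         gauss_curvature (g c) x = s + 2 * cubic_norm_sq (g c x) (C c x) + codiff (g c) (\<beta> c) x \<and>
         (\<forall>l i j k. delbar (g c) (C c) x $ l $ i $ j $ k =
            (complex_of_real (\<beta> c x $ l) - \<i> * hodge (g c x) (\<beta> c x) $ l) * C c x $ i $ j $ k) \<and>
         extd (\<beta> c) x = 0"
  proof (intro ballI conjI allI)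
    fix c x assume cx: "c \<in> A" "x \<in> cimg c"
    show "g c x = s *\<^sub>R ricci (\<Gamma> c) x" by (rule g[OF cx(1)])
    show "\<beta> c x = (3/8) *\<^sub>R tr3 (g c x) (Sym (nabla (\<Gamma> c) (g c) x))" by (rule defs(2)[OF cx(1)])
  qed (fact eqs(2-))+
  ultimately show ?thesis by blast
qed

end
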